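(* Each of the following calibrations $\alpha$ (with the indicated group $\mathrm{G}$) is compliant: (1) the Kähler calibration $\alpha=\frac1{p!}\omega^p$ on $\mathbb C^m=\mathbb R^{2m}$, for $1\le p\le m$, with $\mathrm{G}=\mathrm{U}(m)$; (2) the special Lagrangian calibration $\alpha=\mathrm{Re}(\Upsilon)$ on $\mathbb C^m=\mathbb R^{2m}$, with $\mathrm{G}=\mathrm{SU}(m)$; (3) the associative calibration $\alpha=\varphi$ on $\mathbb R^7$, with $\mathrm{G}=\mathrm{G}_2$; (4) the coassociative calibration $\alpha=\psi$ on $\mathbb R^7$, with $\mathrm{G}=\mathrm{G}_2$; (5) the Cayley calibration $\alpha=\Phi$ on $\mathbb R^8$, with $\mathrm{G}=\mathrm{Spin}(7)$.
   Context: $\mathbb R^n$ has its standard inner product and orientation; vectors and covectors are identified, so $\Lambda^2(\mathbb R^n)=\mathfrak{so}(n)$ with its standard inner product. A form $\alpha\in\Lambda^k(\mathbb R^n)$ is a calibration if $\alpha|_W\le\mathrm{vol}_W$ for every oriented $k$-plane $W$, with equality for at least one $W$; $W$ is $\alpha$-calibrated if $\alpha|_W=\mathrm{vol}_W$. Given a calibration $\alpha$ and a closed subgroup $\mathrm{G}\subset\mathrm{SO}(n)$ (the common stabilizer of finitely many forms including $\alpha$) acting transitively on the $\alpha$-calibrated planes, let $\mathfrak g$ be its Lie algebra. For a calibrated $W$, the group $\mathrm{H}_W=\{P\in\mathrm{G}:P(W)=W\}$ has Lie algebra $\mathfrak h_W=\mathfrak g\cap(\Lambda^2W\oplus\Lambda^2W^\perp)$;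 $\mathfrak h_W^{\perp_{\mathfrak g}}$ is its orthogonal complement in $\mathfrak g$. $\alpha$ is compliant if $\mathfrak h_W^{\perp_{\mathfrak g}}=\mathfrak g\cap(W\otimes W^\perp)$ for the calibrated planes $W$ (independent of the choice of $W$ by transitivity), where $\Lambda^2(\mathbb R^n)=(\Lambda^2W\oplus\Lambda^2W^\perp)\oplus(W\otimes W^\perp)$. In all five cases it is known (Harvey–Lawson) that $\alpha$ is a calibration and that $\mathrm{G}$ acts transitively on the calibrated planes. Definitions (with $dx^{ab\cdots}=dx^a\wedge dx^b\wedge\cdots$). On $\mathbb C^m$ with $z^j=x^j+iy^j$: $\omega=\sum_{j=1}^m dx^j\wedge dy^j$ and $\Upsilon=dz^1\wedge\cdots\wedge dz^m$; $\mathrm{U}(m)$ is the stabilizer of $\omega$ in $\mathrm{SO}(2m)$, and $\mathrm{SU}(m)$ is the stabilizer of $\omega,\mathrm{Re}\,\Upsilon,\mathrm{Im}\,\Upsilon$ in $\mathrm{SO}(2m)$. On $\mathbb R^7$ with coordinates $x^1,\dots,x^7$: $$\varphi=dx^{123}-dx^1\wedge(dx^{45}+dx^{67})-dx^2\wedge(dx^{46}+dx^{75})-dx^3\wedge(dx^{47}+dx^{56}),$$ $$\psi=\star\varphi=dx^{4567}-dx^{23}\wedge(dx^{45}+dx^{67})-dx^{31}\wedge(dx^{46}+dx^{75})-dx^{12}\wedge(dx^{47}+dx^{56}),$$ and $\mathrm{G}_2$ is the stabilizer of $\varphi$ (equivalently of $\psi$) in $\mathrm{SO}(7)$. On $\mathbb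 R^8$ with coordinates $x^0,\dots,x^7$: $\Phi=dx^0\wedge\varphi+\psi$, and $\mathrm{Spin}(7)$ is the stabilizer of $\Phi$ in $\mathrm{SO}(8)$. *)

theory Defs
  imports "HOL-Analysis.Analysis" "HOL-Library.Function_Algebras"
begin

section \<open>Exterior forms on Euclidean space\<close>

text \<open>
  A form is evaluated on a list of vectors.  A \<open>k\<close>-form is extended by \<open>0\<close> to lists
  of length other than \<open>k\<close>, so that degrees need not be carried as parameters, and \<open>+\<close>, \<open>-\<close>
  are the pointwise operations.  Coefficients \<open>'c\<close> are real or complex.
\<close>

type_synonym ('n, 'c) form = "(real ^ 'n) list \<Rightarrow> 'c"

definition alternating_form :: "nat \<Rightarrow> ('n::finite, real) form \<Rightarrow> bool" where
  "alternating_form k \<alpha> \<longleftrightarrow>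
     (\<forall>vs. length vs \<noteq> k \<longrightarrow> \<alpha> vs = 0) \<and>
     (\<forall>vs i. length vs = k \<and> i < k \<longrightarrow> linear (\<lambda>x. \<alpha> (vs[i := x]))) \<and>
     (\<forall>vs i j. length vs = k \<and> i < j \<and> j < k \<and> vs ! i = vs ! j \<longrightarrow> \<alpha> vs = 0)"

text \<open>
  The wedge product as a sum over shuffles: \<open>I\<close> is the set of positions whose arguments go to
  \<open>\<alpha>\<close>, with the sign of the corresponding shuffle.  On a \<open>k\<close>-form and an \<open>l\<close>-form this is
  \<open>1/(k! l!)\<close> times the signed sum over all permutations of the \<open>k + l\<close> arguments.
\<close>

definition wedge :: "('n::finite, 'c::comm_ring_1) form \<Rightarrow> ('n, 'c) form \<Rightarrow> ('n, 'c) form"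
    (infixr \<open>\<^bold>\<and>\<close> 70) where
  "\<alpha> \<^bold>\<and> \<beta> = (\<lambda>vs. \<Sum>I\<in>Pow {..<length vs}.
      (- 1) ^ card {(i, j). i \<in> I \<and> j \<in> {..<length vs} - I \<and> j < i} *
      \<alpha> (nths vs I) * \<beta> (nths vs (- I)))"

definition unit_form :: "('n::finite, 'c::comm_ring_1) form" where
  "unit_form = (\<lambda>vs. if vs = [] then 1 else 0)"

definition wedge_list :: "('n::finite, 'c::comm_ring_1) form list \<Rightarrow> ('n, 'c) form" where
  "wedge_list \<alpha>s = foldr wedge \<alpha>s unit_form"

definition wedge_power :: "('n::finite, 'c::comm_ring_1) form \<Rightarrow> nat \<Rightarrow> ('n, 'c) form" where
  "wedge_power \<alpha> p = wedge_list (replicate p \<alpha>)"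

definition covector :: "real ^ 'n \<Rightarrow> ('n::finite, real) form" where
  "covector u = (\<lambda>vs. case vs of [v] \<Rightarrow> u \<bullet> v | _ \<Rightarrow> 0)"

definition dx :: "'n list \<Rightarrow> ('n::finite, real) form" where
  "dx js = wedge_list (map (\<lambda>j. covector (axis j 1)) js)"


section \<open>Calibrations\<close>

text \<open>
  An oriented \<open>k\<close>-plane is given by a positively oriented orthonormal basis \<open>es\<close>: the plane is
  \<open>span (set es)\<close> and its volume form is the restriction of \<open>vol_form es\<close>.
\<close>

definition orthonormal_list :: "nat \<Rightarrow> (real ^ 'n::finite) list \<Rightarrow> bool" where
  "orthonormal_list k es \<longleftrightarrow> length es = k \<and>
     (\<forall>i<k. \<forall>j<k. es ! i \<bullet> es ! j = (if i = j then 1 else 0))"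

definition vol_form :: "(real ^ 'n::finite) list \<Rightarrow> ('n, real) form" where
  "vol_form es = wedge_list (map covector es)"

definition restricts_to_vol :: "('n::finite, real) form \<Rightarrow> (real ^ 'n) list \<Rightarrow> bool" where
  "restricts_to_vol \<alpha> es \<longleftrightarrow> (\<forall>vs. set vs \<subseteq> span (set es) \<longrightarrow> \<alpha> vs = vol_form es vs)"

text \<open>
  The order on top-degree forms of an oriented plane is the order of their values on
  positively oriented tuples.
\<close>

definition calibration :: "nat \<Rightarrow> ('n::finite, real) form \<Rightarrow> bool" where
  "calibration k \<alpha> \<longleftrightarrow> alternating_form k \<alpha> \<and>
     (\<forall>es. orthonormal_list k es \<longrightarrow>
        (\<forall>vs. set vs \<subseteq> span (set es) \<and> vol_form es vs > 0 \<longrightarrow> \<alpha> vs \<le> vol_form es vs)) \<and>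
     (\<exists>es. orthonormal_list k es \<and> restricts_to_vol \<alpha> es)"

definition calibrated_plane :: "nat \<Rightarrow> ('n::finite, real) form \<Rightarrow> (real ^ 'n) set \<Rightarrow> bool" where
  "calibrated_plane k \<alpha> W \<longleftrightarrow>
     (\<exists>es. orthonormal_list k es \<and> W = span (set es) \<and> restricts_to_vol \<alpha> es)"


section \<open>Groups of rotations and their Lie algebras\<close>

definition pullback :: "real ^ 'n ^ 'n \<Rightarrow> ('n::finite, 'c) form \<Rightarrow> ('n, 'c) form" where
  "pullback P \<alpha> = (\<lambda>vs. \<alpha> (map ((*v) P) vs))"

definition SO_stabilizer :: "('n::finite, real) form set \<Rightarrow> (real ^ 'n ^ 'n) set" where
  "SO_stabilizer S = {P. rotation_matrix P \<and> (\<forall>\<alpha>\<in>S. pullback P \<alpha> = \<alpha>)}"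

definition plane_stabilizer ::
    "(real ^ 'n ^ 'n) set \<Rightarrow> (real ^ 'n::finite) set \<Rightarrow> (real ^ 'n ^ 'n) set" where
  "plane_stabilizer G W = {P \<in> G. (*v) P ` W = W}"

definition matrix_exp :: "real ^ 'n ^ 'n \<Rightarrow> real ^ 'n::finite ^ 'n" where
  "matrix_exp A = (\<Sum>k. (((**) A ^^ k) (mat 1)) /\<^sub>R fact k)"

definition lie_algebra :: "(real ^ 'n ^ 'n) set \<Rightarrow> (real ^ 'n::finite ^ 'n) set" where
  "lie_algebra G = {A. \<forall>t::real. matrix_exp (t *\<^sub>R A) \<in> G}"


section \<open>Compliance\<close>

text \<open>The skew matrix of the endomorphism \<open>x \<mapsto> (u \<bullet> x) w - (w \<bullet> x) u\<close>.\<close>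

definition bivector :: "real ^ 'n \<Rightarrow> real ^ 'n \<Rightarrow> real ^ 'n::finite ^ 'n" where
  "bivector u w = (\<chi> i j. w $ i * u $ j - u $ i * w $ j)"

text \<open>\<open>W \<otimes> W\<^sup>\<bottom>\<close> as a subspace of \<open>\<Lambda>\<^sup>2(\<real>\<^sup>n) = so(n)\<close>.\<close>

definition mixed_bivectors :: "(real ^ 'n::finite) set \<Rightarrow> (real ^ 'n ^ 'n) set" where
  "mixed_bivectors W = span {bivector w u | w u. w \<in> W \<and> u \<in> W\<^sup>\<bottom>}"

text \<open>
  Orthogonal complements in \<open>so(n)\<close> are taken for the inner product of \<open>real ^ 'n ^ 'n\<close>,
  which is twice the standard inner product of \<open>\<Lambda>\<^sup>2(\<real>\<^sup>n)\<close>.  The condition is imposed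
  for every calibrated plane, so transitivity of \<open>G\<close> on these planes is not needed for the
  notion to be independent of choices.
\<close>

definition compliant :: "nat \<Rightarrow> ('n::finite, real) form \<Rightarrow> (real ^ 'n ^ 'n) set \<Rightarrow> bool" where
  "compliant k \<alpha> G \<longleftrightarrow> calibration k \<alpha> \<and>
     (\<forall>W. calibrated_plane k \<alpha> W \<longrightarrow>
        lie_algebra G \<inter> (lie_algebra (plane_stabilizer G W))\<^sup>\<bottom>
          = lie_algebra G \<inter> mixed_bivectors W)"


section \<open>The calibrations and their groups\<close>

text \<open>
  \<open>\<complex>\<^sup>m\<close> is \<open>real ^ ('m + 'm)\<close> with \<open>m = CARD('m)\<close>; the coordinates \<open>x\<^sup>j\<close>, \<open>y\<^sup>j\<close> carry
  the labels \<open>Inl j\<close>, \<open>Inr j\<close>.  The linear order on \<open>'m\<close> fixes the order of the factors of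
  \<open>\<Upsilon>\<close>.
\<close>

definition kaehler_form :: "('m::finite + 'm, real) form" where
  "kaehler_form = (\<Sum>j\<in>UNIV. dx [Inl j] \<^bold>\<and> dx [Inr j])"

definition kaehler_calibration :: "nat \<Rightarrow> ('m::finite + 'm, real) form" where
  "kaehler_calibration p = (\<lambda>vs. wedge_power kaehler_form p vs / fact p)"

definition dz :: "'m \<Rightarrow> ('m::finite + 'm, complex) form" where
  "dz j = (\<lambda>vs. complex_of_real (dx [Inl j] vs) + \<i> * complex_of_real (dx [Inr j] vs))"

definition Upsilon :: "('m::{finite,linorder} + 'm, complex) form" where
  "Upsilon = wedge_list (map dz (sorted_list_of_set UNIV))"

definition Re_form :: "('n, complex) form \<Rightarrow> ('n, real) form" where
  "Re_form \<alpha> = (\<lambda>vs. Re (\<alpha> vs))"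

definition Im_form :: "('n, complex) form \<Rightarrow> ('n, real) form" where
  "Im_form \<alpha> = (\<lambda>vs. Im (\<alpha> vs))"

definition U_group :: "(real ^ ('m + 'm) ^ ('m::finite + 'm)) set" where
  "U_group = SO_stabilizer {kaehler_form}"

definition SU_group :: "(real ^ ('m + 'm) ^ ('m::{finite,linorder} + 'm)) set" where
  "SU_group = SO_stabilizer {kaehler_form, Re_form Upsilon, Im_form Upsilon}"

text \<open>
  \<open>\<phi>\<close> and \<open>\<psi>\<close> are used both on \<open>\<real>\<^sup>7\<close> and, as part of \<open>\<Phi>\<close>, on \<open>\<real>\<^sup>8\<close>, hence the
  polymorphic index type.  The label \<open>7\<close> of \<open>x\<^sup>7\<close> is the element \<open>7 = 0\<close> of the type \<open>7\<close>;
  the labels \<open>1, \<dots>, 7\<close> in the type \<open>7\<close> and \<open>0, \<dots>, 7\<close> in the type \<open>8\<close> are distinct.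
\<close>

definition phi_form :: "('n::{finite,numeral}, real) form" where
  "phi_form = dx [1,2,3] - dx [1] \<^bold>\<and> (dx [4,5] + dx [6,7])
     - dx [2] \<^bold>\<and> (dx [4,6] + dx [7,5]) - dx [3] \<^bold>\<and> (dx [4,7] + dx [5,6])"

definition psi_form :: "('n::{finite,numeral}, real) form" where
  "psi_form = dx [4,5,6,7] - dx [2,3] \<^bold>\<and> (dx [4,5] + dx [6,7])
     - dx [3,1] \<^bold>\<and> (dx [4,6] + dx [7,5]) - dx [1,2] \<^bold>\<and> (dx [4,7] + dx [5,6])"

definition cayley_form :: "(8, real) form" where
  "cayley_form = dx [0] \<^bold>\<and> phi_form + psi_form"

definition G2_group :: "(real ^ 7 ^ 7) set" where
  "G2_group = SO_stabilizer {phi_form}"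

definition Spin7_group :: "(real ^ 8 ^ 8) set" where
  "Spin7_group = SO_stabilizer {cayley_form}"

end

theory Submission
  imports Defs
begin

text \<open>
  Let \<open>R\<close> be the reflection that is \<open>+1\<close> on a calibrated plane \<open>W\<close> and \<open>-1\<close> on its complement.
  If \<open>R\<close> maps each form defining \<open>G\<close> to plus or minus itself, conjugation by \<open>R\<close> is an isometric
  involution of the Lie algebra of \<open>G\<close>.  Its \<open>+1\<close> eigenspace is the Lie algebra of the stabilizer
  of \<open>W\<close>, its \<open>-1\<close> eigenspace consists of the elements in \<open>W \<otimes> W\<^sup>\<bottom>\<close>, and compliance follows.
  The behaviour of the forms under \<open>R\<close> comes from the equality case of each calibration inequality.
  In the Kaehler case \<open>W\<close> is complex and \<open>R\<close> commutes with \<open>J\<close>.  In the special Lagrangian case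
  \<open>W\<close> is Lagrangian, so \<open>R\<close> anticommutes with \<open>J\<close> and sends \<open>\<Upsilon>\<close> to its conjugate.  In the Cayley
  case the components of \<open>\<Phi>\<close> with an odd number of arguments in \<open>W\<close> vanish.  The associative and
  coassociative cases reduce to it: with \<open>\<real>\<^sup>8 = \<real> \<oplus> \<real>\<^sup>7\<close>, the plane
  \<open>\<real> \<oplus> W\<close> is Cayley if \<open>W\<close> is associative, and \<open>W\<close> itself is Cayley if it is coassociative.
\<close>

section \<open>Wedge products\<close>

text \<open>The reflection \<open>R\<close> need not lie in \<open>G\<close>: it conjugates
  \<Upsilon> at a special Lagrangian plane and negates \<phi> at a coassociative one. Conjugation
  uses \<open>R\<close> twice, so the signs cancel and \<open>R\<close> still normalizes
  \<open>G\<close>. As \<open>R\<close> is symmetric and orthogonal, conjugation is self-adjoint,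
  which makes its two eigenspaces orthogonal complements of each other in the Lie algebra. The real
  work is to turn the single number \<open>\<alpha> es = 1\<close> into geometry of the plane.
  Kaehler: inserting \<open>e\<close> into \<omega>^p/p! leaves the one-form dual to
  \<open>J e\<close> times the next lower power, so equality in Cauchy-Schwarz puts
  \<open>J e\<close> into the plane. Special Lagrangian: the first-order condition at a maximum over
  unit frames gives orthonormality and the Lagrangian property at once, and serves both the
  inequality and its equality case. Cayley: \<Phi>(x, y, z, .) is dual to a threefold cross product
  whose length comes from the octonion norm, and equality closes the plane under this product. All
  algebra of forms is done by peeling off the first argument, that is, by interior products.\<close>

abbreviation (input) contract :: "real ^ 'n \<Rightarrow> ('n::finite, 'c) form \<Rightarrow> ('n, 'c) form" where
  "contract v \<alpha> \<equiv> (\<lambda>vs. \<alpha> (v # vs))"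

definition homogeneous :: "nat \<Rightarrow> ('n::finite, 'c::zero) form \<Rightarrow> bool" where
  "homogeneous k \<alpha> \<longleftrightarrow> (\<forall>vs. length vs \<noteq> k \<longrightarrow> \<alpha> vs = 0)"

lemma wedge_Nil [simp]: "(\<alpha> \<^bold>\<and> \<beta>) [] = \<alpha> [] * \<beta> []"
  by (simp add: wedge_def)

text \<open>The Leibniz rule for the interior product. The shuffles split according to which factor
  receives the first argument; if \<beta> does, that argument is overtaken by all \<open>k\<close>
  arguments of \<alpha>.\<close>

lemma wedge_Cons:
  fixes \<alpha> \<beta> :: "('n::finite, 'c::comm_ring_1) form"
  assumes "homogeneous k \<alpha>"
  shows "(\<alpha> \<^bold>\<and> \<beta>) (v # vs) = (contract v \<alpha> \<^bold>\<and> \<beta>) vs + (-1) ^ k * (\<alpha> \<^bold>\<and> contract v \<beta>) vs"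
proof -
  define n where "n = length vs"
  define inv where "inv N I = {(i, j). i \<in> I \<and> j \<in> {..<N} - I \<and> j < i}" for N :: nat and I
  define f where "f I = (-1) ^ card (inv (Suc n) I) * \<alpha> (nths (v # vs) I) * \<beta> (nths (v # vs) (- I))" for I
  have inj1: "inj_on (\<lambda>I. Suc ` I) X" "inj_on (\<lambda>I. insert 0 (Suc ` I)) X" for X
    by (auto simp: inj_on_def inj_image_eq_iff)
  have P: "Pow {..<Suc n} = (\<lambda>I. Suc ` I) ` Pow {..<n} \<union> (\<lambda>I. insert 0 (Suc ` I)) ` Pow {..<n}"
    unfolding lessThan_Suc_eq_insert_0 Pow_insert image_Pow_surj[OF refl, symmetric] image_image ..
  have fin: "finite (inv N I)" if "I \<subseteq> {..<N}" for N I
    by (rule finite_subset[of _ "{..<N} \<times> {..<N}"]) (use that in \<open>auto simp: inv_def\<close>)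
  have card_Suc_Suc: "card (map_prod Suc Suc ` X) = card X" for X
    by (rule card_image[OF inj_on_subset[OF prod.inj_map[OF inj_Suc inj_Suc] subset_UNIV]])
  have c0: "card (inv (Suc n) (insert 0 (Suc ` I))) = card (inv n I)" if "I \<in> Pow {..<n}" for I
  proof -
    have "inv (Suc n) (insert 0 (Suc ` I)) = map_prod Suc Suc ` inv n I"
      by (auto simp: inv_def image_iff lessThan_Suc_eq_insert_0)
    then show ?thesis by (simp add: card_Suc_Suc)
  qed
  \<comment> \<open>Position 0 is outside the shifted set and below all its elements, so each
    element gains exactly one inversion.\<close>
  have c1: "card (inv (Suc n) (Suc ` I)) = card (inv n I) + card I" if "I \<in> Pow {..<n}" for I
  proof -
    have eq: "inv (Suc n) (Suc ` I) = map_prod Suc Suc ` inv n I \<union> (\<lambda>i. (Suc i, 0)) ` I"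
      by (auto simp: inv_def image_iff lessThan_Suc_eq_insert_0)
    have "card (inv (Suc n) (Suc ` I)) = card (map_prod Suc Suc ` inv n I) + card ((\<lambda>i. (Suc i, 0::nat)) ` I)"
      unfolding eq using that fin[of I n] finite_subset[of I "{..<n}"]
      by (intro card_Un_disjoint) auto
    then show ?thesis
      by (simp add: card_Suc_Suc card_image inj_on_def)
  qed
  have f0: "f (insert 0 (Suc ` I)) =
      (-1) ^ card (inv n I) * contract v \<alpha> (nths vs I) * \<beta> (nths vs (- I))" if "I \<in> Pow {..<n}" for I
    using that by (simp add: f_def c0 nths_Cons inj_image_mem_iff Collect_neg_eq[symmetric])
      (simp add: Compl_eq)
  have f1: "f (Suc ` I) =
      (-1) ^ k * ((-1) ^ card (inv n I) * \<alpha> (nths vs I) * contract v \<beta> (nths vs (- I)))"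
    if "I \<in> Pow {..<n}" for I
  proof -
    have len: "length (nths vs I) = card I"
      using that by (auto simp: length_nths n_def intro!: arg_cong[where f = card])
    have "f (Suc ` I) = (-1) ^ card (inv n I) * (-1) ^ card I * \<alpha> (nths vs I) * \<beta> (v # nths vs (- I))"
      using that by (simp add: f_def c1 nths_Cons inj_image_mem_iff power_add image_iff)
        (simp add: Compl_eq)
    \<comment> \<open>Homogeneity kills every subset of the wrong size, so the sign depending on
      \<open>card I\<close> may be replaced by the constant \<open>(-1) ^ k\<close>.\<close>
    moreover have "\<alpha> (nths vs I) = 0" if "card I \<noteq> k"
      using assms len that by (simp add: homogeneous_def)
    ultimately show ?thesis by (cases "card I = k") (simp_all add: mult_ac)
  qed
  have "(\<alpha> \<^bold>\<and> \<beta>) (v # vs) = sum f (Pow {..<Suc n})"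
    by (simp add: wedge_def f_def inv_def n_def)
  also have "\<dots> = sum f ((\<lambda>I. insert 0 (Suc ` I)) ` Pow {..<n}) + sum f ((\<lambda>I. Suc ` I) ` Pow {..<n})"
    unfolding P by (subst sum.union_disjoint) (auto simp: add.commute)
  also have "\<dots> = (\<Sum>I\<in>Pow {..<n}. f (insert 0 (Suc ` I))) + (\<Sum>I\<in>Pow {..<n}. f (Suc ` I))"
    unfolding sum.reindex[OF inj1(1)] sum.reindex[OF inj1(2)] o_def by (rule refl)
  also have "\<dots> = (contract v \<alpha> \<^bold>\<and> \<beta>) vs + (-1) ^ k * (\<alpha> \<^bold>\<and> contract v \<beta>) vs"
    using f0 f1 by (simp add: wedge_def inv_def n_def sum_distrib_left)
  finally show ?thesis .
qed

lemma contract_wedge: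
  fixes \<alpha> \<beta> :: "('n::finite, 'c::comm_ring_1) form"
  assumes "homogeneous k \<alpha>"
  shows "contract v (\<alpha> \<^bold>\<and> \<beta>) = (\<lambda>vs. (contract v \<alpha> \<^bold>\<and> \<beta>) vs + (-1) ^ k * (\<alpha> \<^bold>\<and> contract v \<beta>) vs)"
  using wedge_Cons[OF assms] by (simp add: fun_eq_iff)

lemma wedge_add_left: "((\<lambda>vs. \<alpha> vs + \<beta> vs) \<^bold>\<and> \<gamma>) vs = (\<alpha> \<^bold>\<and> \<gamma>) vs + (\<beta> \<^bold>\<and> \<gamma>) vs"
  by (simp add: wedge_def algebra_simps sum.distrib)

lemma wedge_add_right: "(\<gamma> \<^bold>\<and> (\<lambda>vs. \<alpha> vs + \<beta> vs)) vs = (\<gamma> \<^bold>\<and> \<alpha>) vs + (\<gamma> \<^bold>\<and> \<beta>) vs"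
  by (simp add: wedge_def algebra_simps sum.distrib)

lemma wedge_scale_left: "((\<lambda>vs. c * \<alpha> vs) \<^bold>\<and> \<gamma>) vs = c * (\<alpha> \<^bold>\<and> \<gamma>) vs"
  by (simp add: wedge_def algebra_simps sum_distrib_left)

lemma wedge_scale_right: "(\<gamma> \<^bold>\<and> (\<lambda>vs. c * \<alpha> vs)) vs = c * (\<gamma> \<^bold>\<and> \<alpha>) vs"
  by (simp add: wedge_def algebra_simps sum_distrib_left)

lemma wedge_zero_left [simp]: "((\<lambda>vs. 0) \<^bold>\<and> \<gamma>) vs = 0"
  by (simp add: wedge_def)

lemma wedge_zero_right [simp]: "(\<gamma> \<^bold>\<and> (\<lambda>vs. 0)) vs = 0"
  by (simp add: wedge_def)

section \<open>Alternating forms\<close>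

text \<open>Recursion through the first argument matches the Leibniz rule \<open>wedge_Cons\<close>,
  so closure properties follow by induction on the degree. Conditions at the front suffice because
  contractions carry them to later positions; \<open>alternating_alternating_form\<close> recovers
  the positional notion. Coefficients stay general to include complex forms.\<close>

primrec alternating :: "nat \<Rightarrow> ('n::finite, 'c::real_normed_field) form \<Rightarrow> bool" where
  "alternating 0 \<alpha> \<longleftrightarrow> homogeneous 0 \<alpha>"
| "alternating (Suc k) \<alpha> \<longleftrightarrow> \<alpha> [] = 0 \<and> (\<forall>v. alternating k (contract v \<alpha>)) \<and>
     (\<forall>vs. linear (\<lambda>v. \<alpha> (v # vs))) \<and> (\<forall>v vs. \<alpha> (v # v # vs) = 0)"

lemma alternating_homogeneous: "alternating k \<alpha> \<Longrightarrow> homogeneous k \<alpha>"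
proof (induction k arbitrary: \<alpha>)
  case (Suc k)
  then have "homogeneous k (contract v \<alpha>)" for v by (metis alternating.simps(2))
  then have "\<alpha> (v # vs) = 0" if "length vs \<noteq> k" for v vs
    using that by (auto simp: homogeneous_def)
  moreover have "\<alpha> [] = 0" using Suc.prems by simp
  ultimately show ?case
    unfolding homogeneous_def by (metis length_Cons list.exhaust)
qed simp

lemma alternating_length: "alternating k \<alpha> \<Longrightarrow> length vs \<noteq> k \<Longrightarrow> \<alpha> vs = 0"
  using alternating_homogeneous by (auto simp: homogeneous_def)

lemma linear_zero_fun: "linear (\<lambda>v. 0 :: 'c::real_vector)"
  by (simp add: linear_iff)

lemma alternating_linear: "alternating k \<alpha> \<Longrightarrow> linear (\<lambda>v. \<alpha> (us @ v # vs))"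
proof (induction us arbitrary: k \<alpha>)
  case Nil
  then show ?case
    by (cases k) (auto simp: homogeneous_def linear_iff)
next
  case (Cons u us)
  show ?case
  proof (cases k)
    case 0
    then show ?thesis using Cons.prems by (simp add: homogeneous_def linear_iff)
  next
    case (Suc m)
    then show ?thesis using Cons.prems Cons.IH[of m "contract u \<alpha>"] by simp
  qed
qed

lemma alternating_linear_hd: "alternating k \<alpha> \<Longrightarrow> linear (\<lambda>v. \<alpha> (v # vs))"
  using alternating_linear[of k \<alpha> "[]"] by simp

text \<open>In degree 0 the contraction is the zero form, so the truncated \<open>k - 1\<close> does
  no harm and later inductions need no case split.\<close>

lemma alternating_contract:
  assumes "alternating k \<alpha>" shows "alternating (k - 1) (contract v \<alpha>)"
  using assms by (cases k) (auto simp: homogeneous_def)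

lemma alternating_same:
  assumes "alternating k \<alpha>" shows "\<alpha> (v # v # vs) = 0"
  using assms by (cases k) (auto simp: homogeneous_def)

lemma alternating_zero [simp]: "alternating k (\<lambda>vs. 0)"
  by (induction k) (auto simp: homogeneous_def linear_iff)

lemma alternating_add:
  "alternating k \<alpha> \<Longrightarrow> alternating k \<beta> \<Longrightarrow> alternating k (\<lambda>vs. \<alpha> vs + \<beta> vs)"
proof (induction k arbitrary: \<alpha> \<beta>)
  case (Suc k)
  have "alternating k (\<lambda>vs. contract v \<alpha> vs + contract v \<beta> vs)" for v
    by (rule Suc.IH) (use Suc.prems in auto)
  then show ?case using Suc.prems
    by (auto simp: linear_compose_add)
qed (auto simp: homogeneous_def)

lemma alternating_scale:
  "alternating k \<alpha> \<Longrightarrow> alternating k (\<lambda>vs. c * \<alpha> vs)"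
proof (induction k arbitrary: \<alpha>)
  case (Suc k)
  have "alternating k (\<lambda>vs. c * contract v \<alpha> vs)" for v
    by (rule Suc.IH) (use Suc.prems in auto)
  then show ?case using Suc.prems
    by (auto simp: linear_iff algebra_simps)
qed (auto simp: homogeneous_def)

lemma alternating_diff:
  "alternating k \<alpha> \<Longrightarrow> alternating k \<beta> \<Longrightarrow> alternating k (\<lambda>vs. \<alpha> vs - \<beta> vs)"
  using alternating_add[of k \<alpha> "\<lambda>vs. (-1) * \<beta> vs"] alternating_scale[of k \<beta> "-1"] by simp

lemma alternating_sum:
  "(\<And>i. i \<in> I \<Longrightarrow> alternating k (\<alpha> i)) \<Longrightarrow> alternating k (\<lambda>vs. \<Sum>i\<in>I. \<alpha> i vs)"
  by (induction I rule: infinite_finite_induct) (auto intro: alternating_add)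

lemma alternating_linear_image:
  assumes "alternating k \<alpha>" "linear L"
  shows "alternating k (\<lambda>vs. L (\<alpha> vs))"
  using assms
proof (induction k arbitrary: \<alpha>)
  case 0
  then show ?case by (auto simp: homogeneous_def linear_0)
next
  case (Suc k)
  have "alternating k (\<lambda>vs. L (contract v \<alpha> vs))" for v
    by (rule Suc.IH) (use Suc.prems in auto)
  then show ?case using Suc.prems
    by (auto simp: linear_0 intro: linear_compose[unfolded o_def])
qed

lemma alternating_map:
  assumes "alternating k \<alpha>" "linear f"
  shows "alternating k (\<lambda>vs. \<alpha> (map f vs))"
  using assms(1)
proof (induction k arbitrary: \<alpha>)
  case (Suc k)
  have "alternating k (\<lambda>vs. contract (f v) \<alpha> (map f vs))" for v
    by (rule Suc.IH) (use Suc.prems in auto)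
  then show ?case using Suc.prems linear_compose[OF assms(2)]
    by (auto simp: o_def)
qed (auto simp: homogeneous_def)

lemma alternating_swap:
  assumes "alternating k \<alpha>" shows "\<alpha> (v # w # vs) = - \<alpha> (w # v # vs)"
proof -
  have l1: "linear (\<lambda>x. \<alpha> (x # y # vs))" for y
    using alternating_linear_hd[OF assms] .
  have l2: "linear (\<lambda>y. \<alpha> (x # y # vs))" for x
    using alternating_linear[OF assms, of "[x]"] by simp
  have "\<alpha> ((v + w) # (v + w) # vs) = 0"
    by (rule alternating_same[OF assms])
  moreover have "\<alpha> ((v + w) # (v + w) # vs)
      = \<alpha> (v # v # vs) + \<alpha> (v # w # vs) + (\<alpha> (w # v # vs) + \<alpha> (w # w # vs))"
    by (simp add: linear_add[OF l1] linear_add[OF l2])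
  ultimately have "\<alpha> (v # w # vs) + \<alpha> (w # v # vs) = 0"
    by (simp add: alternating_same[OF assms])
  then show ?thesis by (simp add: eq_neg_iff_add_eq_0)
qed

lemma alternating_mem:
  assumes "alternating k \<alpha>" "v \<in> set vs" shows "\<alpha> (v # vs) = 0"
  using assms
proof (induction vs arbitrary: k \<alpha>)
  case (Cons w vs)
  show ?case
  proof (cases "v = w")
    case True
    then show ?thesis using alternating_same[OF Cons.prems(1)] by simp
  next
    case False
    then have "contract w \<alpha> (v # vs) = 0"
      using Cons.IH[OF alternating_contract[OF Cons.prems(1)]] Cons.prems by auto
    then show ?thesis using alternating_swap[OF Cons.prems(1), of v w] by simp
  qed
qed simp

lemma alternating_not_distinct:
  assumes "alternating k \<alpha>" "\<not> distinct vs" shows "\<alpha> vs = 0"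
  using assms
proof (induction vs arbitrary: k \<alpha>)
  case (Cons v vs)
  then show ?case
    using alternating_mem[OF Cons.prems(1)] Cons.IH[OF alternating_contract[OF Cons.prems(1), of v]]
    by auto
qed simp

lemma alternating_alternating_form:
  assumes "alternating k (\<alpha> :: ('n::finite, real) form)" shows "alternating_form k \<alpha>"
  unfolding alternating_form_def
proof (intro conjI allI impI)
  fix vs :: "(real ^ 'n) list" and i
  assume "length vs = k \<and> i < k"
  then show "linear (\<lambda>x. \<alpha> (vs[i := x]))"
    using alternating_linear[OF assms] by (simp add: upd_conv_take_nth_drop)
next
  fix vs :: "(real ^ 'n) list" and i j
  assume "length vs = k \<and> i < j \<and> j < k \<and> vs ! i = vs ! j"
  then have "\<not> distinct vs" by (metis nat_neq_iff nth_eq_iff_index_eq order_less_trans)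
  then show "\<alpha> vs = 0" by (rule alternating_not_distinct[OF assms])
qed (use alternating_length[OF assms] in auto)

lemma alternating_move_front:
  assumes "alternating k \<alpha>"
  shows "\<alpha> (us @ v # vs) = (-1) ^ length us * \<alpha> (v # us @ vs)"
  using assms
proof (induction us arbitrary: k \<alpha>)
  case (Cons u us)
  show ?case
    using Cons.IH[OF alternating_contract[OF Cons.prems, of u]] alternating_swap[OF Cons.prems, of u v]
    by simp
qed simp

text \<open>The sign is left open: it is applied to vanishing statements and absolute values
  only.\<close>

lemma alternating_perm:
  assumes "alternating k \<alpha>" "mset vs = mset ws"
  shows "\<alpha> ws = \<alpha> vs \<or> \<alpha> ws = - \<alpha> vs"
  using assms
proof (induction vs arbitrary: k \<alpha> ws)
  case (Cons v vs)
  then have "v \<in> set ws" by (metis list.set_intros(1) mset_eq_setD)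
  then obtain as bs where ws: "ws = as @ v # bs" by (meson split_list)
  then have "mset vs = mset (as @ bs)" using Cons.prems by simp
  from Cons.IH[OF alternating_contract[OF Cons.prems(1), of v] this]
  have "\<alpha> (v # as @ bs) = \<alpha> (v # vs) \<or> \<alpha> (v # as @ bs) = - \<alpha> (v # vs)" by simp
  moreover have "(-1) ^ length as = (1::'b) \<or> (-1) ^ length as = (-1::'b)"
    by (cases "even (length as)") auto
  ultimately show ?case
    unfolding ws alternating_move_front[OF Cons.prems(1), of as] by auto
qed simp

lemma alternating_eq_0_span:
  assumes "alternating k \<alpha>" "\<And>vs. set vs \<subseteq> B \<Longrightarrow> \<alpha> vs = 0" "set vs \<subseteq> span B"
  shows "\<alpha> vs = 0"
  using assms
proof (induction vs arbitrary: k \<alpha>)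
  case (Cons v vs)
  have "\<alpha> (b # vs) = 0" if "b \<in> B" for b
  proof -
    have "contract b \<alpha> vs = 0"
      by (rule Cons.IH[OF alternating_contract[OF Cons.prems(1)]]) (use that Cons.prems in auto)
    then show ?thesis by simp
  qed
  then show ?case
    using linear_eq_0_on_span[OF alternating_linear_hd[OF Cons.prems(1)], of B vs v] Cons.prems(3)
    by auto
qed auto

text \<open>A list of full length drawn from \<open>es\<close> either repeats an entry or permutes
  \<open>es\<close>.\<close>

lemma alternating_eq_0_list:
  assumes "alternating (length es) \<alpha>" "distinct es" "\<alpha> es = 0" "set vs \<subseteq> set es"
  shows "\<alpha> vs = 0"
proof (cases "distinct vs \<and> length vs = length es")
  case True
  then have "set vs = set es"
    using assms by (intro card_subset_eq) (auto simp: distinct_card)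
  then have "mset es = mset vs" using True assms(2) set_eq_iff_mset_eq_distinct by blast
  from alternating_perm[OF assms(1) this] show ?thesis using assms(3) by auto
next
  case False
  then show ?thesis
    using alternating_not_distinct[OF assms(1)] alternating_length[OF assms(1)] by auto
qed

lemma alternating_eq_0:
  assumes "alternating (length es) \<alpha>" "distinct es" "\<alpha> es = 0" "set vs \<subseteq> span (set es)"
  shows "\<alpha> vs = 0"
  using alternating_eq_0_span[OF assms(1) alternating_eq_0_list[OF assms(1-3)] assms(4)] .

lemma homogeneous_contract: "homogeneous k \<alpha> \<Longrightarrow> homogeneous (k - 1) (contract v \<alpha>)"
  by (cases k) (auto simp: homogeneous_def)

text \<open>Induction on the total degree: by the Leibniz rule a contraction of the product is a sum
  of products of lower total degree.\<close>

lemma alternating_wedge: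
  assumes "alternating k \<alpha>" "alternating l \<beta>"
  shows "alternating (k + l) (\<alpha> \<^bold>\<and> \<beta>)"
  using assms
proof (induction "k + l" arbitrary: k l \<alpha> \<beta>)
  case 0
  then have h: "homogeneous 0 \<alpha>" "homogeneous 0 \<beta>" by simp_all
  then have "contract v \<alpha> = (\<lambda>vs. 0)" "contract v \<beta> = (\<lambda>vs. 0)" for v
    by (auto simp: homogeneous_def fun_eq_iff)
  then have "(\<alpha> \<^bold>\<and> \<beta>) (v # vs) = 0" for v vs by (simp add: wedge_Cons[OF h(1)])
  then show ?case using 0 by (auto simp: homogeneous_def neq_Nil_conv)
next
  case (Suc n)
  note h = alternating_homogeneous[OF Suc.prems(1)]
  have zero: "contract v \<gamma> = (\<lambda>vs. 0)" if "alternating 0 \<gamma>" for v and \<gamma> :: "('a, 'b) form"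
    using that by (auto simp: homogeneous_def fun_eq_iff)
  have "alternating n (contract v \<alpha> \<^bold>\<and> \<beta>)" for v
  proof (cases k)
    case 0
    then have "contract v \<alpha> \<^bold>\<and> \<beta> = (\<lambda>vs. 0)"
      using zero[of \<alpha> v] Suc.prems(1) by (intro ext) simp
    then show ?thesis by simp
  next
    case (Suc k')
    then show ?thesis using Suc.hyps(1)[of k' l "contract v \<alpha>" \<beta>] Suc.hyps(2) Suc.prems by simp
  qed
  moreover have "alternating n (\<alpha> \<^bold>\<and> contract v \<beta>)" for v
  proof (cases l)
    case 0
    then have "\<alpha> \<^bold>\<and> contract v \<beta> = (\<lambda>vs. 0)"
      using zero[of \<beta> v] Suc.prems(2) by (intro ext) simp
    then show ?thesis by simp
  next
    case (Suc l')
    then show ?thesis using Suc.hyps(1)[of k l' \<alpha> "contract v \<beta>"] Suc.hyps(2) Suc.prems by simp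
  qed
  ultimately have c: "alternating n (contract v (\<alpha> \<^bold>\<and> \<beta>))" for v
    unfolding contract_wedge[OF h] by (intro alternating_add alternating_scale) auto
  have l: "linear (\<lambda>v. (\<alpha> \<^bold>\<and> \<beta>) (v # vs))" for vs
    unfolding wedge_Cons[OF h] unfolding wedge_def
    using alternating_linear_hd[OF Suc.prems(1)] alternating_linear_hd[OF Suc.prems(2)]
    by (intro linear_compose_add linear_compose_sum ballI)
       (auto simp: linear_iff algebra_simps sum_distrib_left sum.distrib scaleR_sum_right)
  have s: "(\<alpha> \<^bold>\<and> \<beta>) (v # v # vs) = 0" for v vs
  proof -
    have "contract v (contract v \<alpha>) = (\<lambda>vs. 0)" "contract v (contract v \<beta>) = (\<lambda>vs. 0)"
      using alternating_same Suc.prems by (auto simp: fun_eq_iff)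
    then have "(\<alpha> \<^bold>\<and> \<beta>) (v # v # vs)
        = (-1) ^ (k - 1) * (contract v \<alpha> \<^bold>\<and> contract v \<beta>) vs + (-1) ^ k * (contract v \<alpha> \<^bold>\<and> contract v \<beta>) vs"
      by (simp add: wedge_Cons[OF h] wedge_Cons[OF homogeneous_contract[OF h]])
    \<comment> \<open>The two mixed terms cancel by opposite signs, except that for
      \<open>k = 0\<close> truncated subtraction makes the signs equal; there the contraction of
      \<alpha> is itself zero.\<close>
    moreover have "contract v \<alpha> = (\<lambda>vs. 0)" if "k = 0"
      using that zero Suc.prems(1) by auto
    ultimately show ?thesis by (cases k) auto
  qed
  have "(\<alpha> \<^bold>\<and> \<beta>) [] = 0"
    using Suc.hyps(2) alternating_length[OF Suc.prems(1), of "[]"] alternating_length[OF Suc.prems(2), of "[]"]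
    by (cases k) auto
  with c l s show ?case unfolding Suc.hyps(2)[symmetric] by simp
qed

lemma alternating_one_form:
  assumes "linear f" shows "alternating 1 (\<lambda>vs. case vs of [v] \<Rightarrow> f v | _ \<Rightarrow> 0)"
proof -
  have "linear (\<lambda>v. case v # vs of [v] \<Rightarrow> f v | _ \<Rightarrow> 0)" for vs
    using assms by (cases vs) (auto simp: linear_zero_fun)
  then show ?thesis
    by (auto simp: homogeneous_def split: list.split)
qed

lemma alternating_covector: "alternating 1 (covector u)"
  unfolding covector_def by (intro alternating_one_form linear_iff[THEN iffD2]) (simp add: inner_add_right)

lemma alternating_wedge_list:
  "(\<And>\<alpha>. \<alpha> \<in> set \<alpha>s \<Longrightarrow> alternating k \<alpha>) \<Longrightarrow> alternating (k * length \<alpha>s) (wedge_list \<alpha>s)"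
  unfolding wedge_list_def
proof (induction \<alpha>s)
  case (Cons \<alpha> \<alpha>s)
  then show ?case using alternating_wedge[of k \<alpha>] by simp
qed (simp add: homogeneous_def unit_form_def)

lemma alternating_dx: "alternating (length js) (dx js)"
proof -
  have "alternating (1 * length (map (\<lambda>j. covector (axis j 1)) js)) (dx js)"
    unfolding dx_def by (rule alternating_wedge_list) (auto simp only: set_map alternating_covector)
  then show ?thesis by simp
qed

lemma alternating_vol_form: "alternating (length es) (vol_form es)"
proof -
  have "alternating (1 * length (map covector es)) (vol_form es)"
    unfolding vol_form_def by (rule alternating_wedge_list) (auto simp only: set_map alternating_covector)
  then show ?thesis by simp
qed

lemma wedge_one_form_Cons:
  assumes "homogeneous 1 \<alpha>"
  shows "(\<alpha> \<^bold>\<and> \<beta>) (v # vs) = \<alpha> [v] * \<beta> vs - (\<alpha> \<^bold>\<and> contract v \<beta>) vs"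
proof -
  have "homogeneous 0 (contract v \<alpha>)"
    using homogeneous_contract[OF assms, of v] by simp
  then have c: "contract v \<alpha> = (\<lambda>vs. \<alpha> [v] * unit_form vs)"
    by (auto simp: fun_eq_iff unit_form_def homogeneous_def)
  have "(unit_form \<^bold>\<and> \<beta>) vs = \<beta> vs" for \<beta> :: "('a, 'b) form"
  proof (induction vs arbitrary: \<beta>)
    case (Cons v vs)
    have h: "homogeneous 0 (unit_form :: ('a, 'b) form)" by (simp add: homogeneous_def unit_form_def)
    have "contract v (unit_form :: ('a, 'b) form) = (\<lambda>vs. 0)" by (simp add: unit_form_def)
    then show ?case using Cons.IH[of "contract v \<beta>"] by (simp add: wedge_Cons[OF h])
  qed (simp add: unit_form_def)
  then show ?thesis
    by (simp add: wedge_Cons[OF assms] c wedge_scale_left)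
qed

lemma wedge_one_form_vanish:
  assumes "homogeneous 1 \<alpha>" "\<And>v. v \<in> set vs \<Longrightarrow> \<alpha> [v] = 0"
  shows "(\<alpha> \<^bold>\<and> \<beta>) vs = 0"
  using assms(2)
proof (induction vs arbitrary: \<beta>)
  case Nil
  then show ?case using assms(1) by (simp add: homogeneous_def)
next
  case (Cons v vs)
  then show ?case by (simp add: wedge_one_form_Cons[OF assms(1)])
qed

lemma homogeneous_covector [simp]: "homogeneous (Suc 0) (covector u)"
  using alternating_homogeneous[OF alternating_covector] by simp

lemma covector_apply [simp]: "covector u [v] = u \<bullet> v"
  by (simp add: covector_def)

section \<open>Orthonormal lists\<close>

lemma orthonormal_list_Nil [simp]: "orthonormal_list k [] \<longleftrightarrow> k = 0"
  by (auto simp: orthonormal_list_def)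

lemma orthonormal_list_Cons:
  "orthonormal_list k (e # es) \<longleftrightarrow>
     k = Suc (length es) \<and> e \<bullet> e = 1 \<and> (\<forall>x\<in>set es. e \<bullet> x = 0) \<and> orthonormal_list (length es) es"
proof -
  have P: "(\<forall>i<Suc m. \<forall>j<Suc m. (e # es) ! i \<bullet> (e # es) ! j = (if i = j then 1 else 0)) \<longleftrightarrow>
    e \<bullet> e = 1 \<and> (\<forall>j<m. e \<bullet> es ! j = 0) \<and> (\<forall>i<m. es ! i \<bullet> e = 0) \<and>
     (\<forall>i<m. \<forall>j<m. es ! i \<bullet> es ! j = (if i = j then 1 else 0))" for m
    unfolding All_less_Suc2 by (auto simp: inner_commute)
  have 1: "(\<forall>x\<in>set es. e \<bullet> x = 0) \<longleftrightarrow> (\<forall>j<length es. e \<bullet> es ! j = 0)"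
    by (metis in_set_conv_nth)
  have 2: "(\<forall>i<length es. es ! i \<bullet> e = 0) \<longleftrightarrow> (\<forall>j<length es. e \<bullet> es ! j = 0)"
    by (simp add: inner_commute)
  show ?thesis
  proof (cases "k = Suc (length es)")
    case True
    show ?thesis
      unfolding orthonormal_list_def True length_Cons P 1 2 by blast
  next
    case False
    then show ?thesis by (auto simp: orthonormal_list_def)
  qed
qed

lemma orthonormal_list_distinct: "orthonormal_list k es \<Longrightarrow> distinct es"
  by (induction es arbitrary: k) (auto simp: orthonormal_list_Cons)

lemma orthonormal_list_inner:
  "orthonormal_list k es \<Longrightarrow> x \<in> set es \<Longrightarrow> y \<in> set es \<Longrightarrow> x \<bullet> y = (if x = y then 1 else 0)"
  by (induction es arbitrary: k) (auto simp: orthonormal_list_Cons inner_commute)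

lemma vol_form_self:
  "orthonormal_list k es \<Longrightarrow> vol_form es es = 1"
proof (induction es arbitrary: k)
  case Nil
  then show ?case by (simp add: vol_form_def wedge_list_def unit_form_def)
next
  case (Cons e es)
  have "vol_form (e # es) = covector e \<^bold>\<and> vol_form es"
    by (simp add: vol_form_def wedge_list_def)
  then show ?case using Cons
    by (auto simp: wedge_one_form_Cons orthonormal_list_Cons wedge_one_form_vanish)
qed

text \<open>Forms of top degree on a plane make up a line, and \<open>vol_form es\<close> takes the
  value 1 at \<open>es\<close>. Hence the number \<open>\<alpha> es\<close> decides every comparison
  with the volume form.\<close>

lemma alternating_eq_vol_form:
  assumes "alternating k \<alpha>" "orthonormal_list k es" "set vs \<subseteq> span (set es)"
  shows "\<alpha> vs = \<alpha> es * vol_form es vs"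
proof -
  have k: "k = length es" using assms by (simp add: orthonormal_list_def)
  have "(\<lambda>vs. \<alpha> vs - \<alpha> es * vol_form es vs) vs = 0"
    by (rule alternating_eq_0[where es = es])
       (use assms k in \<open>auto intro!: alternating_diff alternating_scale alternating_vol_form
          simp: vol_form_self orthonormal_list_distinct\<close>)
  then show ?thesis by simp
qed

lemma calibrationI:
  fixes \<alpha> :: "('n::finite, real) form"
  assumes "alternating k \<alpha>" "\<And>es. orthonormal_list k es \<Longrightarrow> \<alpha> es \<le> 1"
    "orthonormal_list k bs" "\<alpha> bs = 1"
  shows "calibration k \<alpha>"
  unfolding calibration_def
proof (intro conjI allI impI exI[of _ bs])
  show "alternating_form k \<alpha>" using assms(1) by (rule alternating_alternating_form)
next
  fix es vs :: "(real ^ 'n) list"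
  assume "orthonormal_list k es" "set vs \<subseteq> span (set es) \<and> 0 < vol_form es vs"
  then show "\<alpha> vs \<le> vol_form es vs"
    using alternating_eq_vol_form[OF assms(1), of es vs] assms(2)[of es] by simp
next
  show "restricts_to_vol \<alpha> bs"
    unfolding restricts_to_vol_def
    using alternating_eq_vol_form[OF assms(1,3)] assms(4) by simp
qed (use assms in auto)

lemma restricts_to_vol_self:
  fixes es :: "(real ^ 'n::finite) list"
  shows "orthonormal_list k es \<Longrightarrow> restricts_to_vol \<alpha> es \<Longrightarrow> \<alpha> es = 1"
  using vol_form_self span_superset by (metis restricts_to_vol_def)

section \<open>Matrix exponentials\<close>

lemma matrix_add_rdistrib: "(A + B) ** C = A ** C + B ** (C :: real ^ 'n ^ 'm::finite)"
  by (simp add: vec_eq_iff matrix_matrix_mult_def distrib_right sum.distrib)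

definition mpow :: "real ^ 'n ^ 'n \<Rightarrow> nat \<Rightarrow> real ^ 'n::finite ^ 'n" where
  "mpow A k = ((**) A ^^ k) (mat 1)"

lemma mpow_0 [simp]: "mpow A 0 = mat 1" and mpow_Suc: "mpow A (Suc k) = A ** mpow A k"
  by (simp_all add: mpow_def)

lemma mpow_scaleR: "mpow (t *\<^sub>R A) k = t ^ k *\<^sub>R mpow A k"
  by (induction k) (simp_all add: mpow_Suc scalar_matrix_assoc matrix_scalar_ac mult.commute)

text \<open>The sum of the absolute values of all entries dominates each row sum. This crude bound
  is enough to compare with the scalar exponential series.\<close>

lemma mpow_bound: "\<bar>mpow A k $ i $ j\<bar> \<le> (\<Sum>i\<in>UNIV. \<Sum>j\<in>UNIV. \<bar>A $ i $ j\<bar>) ^ k"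
proof (induction k arbitrary: i)
  case 0
  then show ?case by (simp add: mat_def)
next
  case (Suc k)
  let ?B = "\<Sum>i\<in>UNIV. \<Sum>j\<in>UNIV. \<bar>A $ i $ j\<bar>"
  have "\<bar>mpow A (Suc k) $ i $ j\<bar> \<le> (\<Sum>l\<in>UNIV. \<bar>A $ i $ l\<bar> * \<bar>mpow A k $ l $ j\<bar>)"
    by (simp add: mpow_Suc matrix_matrix_mult_def abs_mult[symmetric])
  also have "\<dots> \<le> (\<Sum>l\<in>UNIV. \<bar>A $ i $ l\<bar> * ?B ^ k)"
    by (intro sum_mono mult_left_mono Suc.IH) auto
  also have "\<dots> = (\<Sum>l\<in>UNIV. \<bar>A $ i $ l\<bar>) * ?B ^ k"
    by (simp add: sum_distrib_right)
  also have "\<dots> \<le> ?B * ?B ^ k"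
    by (intro mult_right_mono member_le_sum[of i UNIV "\<lambda>i. \<Sum>l\<in>UNIV. \<bar>A $ i $ l\<bar>"])
       (auto intro!: sum_nonneg zero_le_power)
  finally show ?case by simp
qed

text \<open>The factor \<open>t ^ k\<close> presents each entry of the exponential of
  \<open>t A\<close> as an everywhere convergent power series in \<open>t\<close>, ready for
  termwise differentiation.\<close>

lemma summable_mpow: "summable (\<lambda>k. mpow A k $ i $ j / fact k * t ^ k)"
proof (rule summable_comparison_test'[where N = 0])
  let ?B = "\<Sum>i\<in>UNIV. \<Sum>j\<in>UNIV. \<bar>A $ i $ j\<bar>"
  show "summable (\<lambda>k. inverse (fact k) * (?B * \<bar>t\<bar>) ^ k)" by (rule summable_exp)
  show "norm (mpow A k $ i $ j / fact k * t ^ k) \<le> inverse (fact k) * (?B * \<bar>t\<bar>) ^ k" for k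
    using mpow_bound[of A k i j]
    by (simp add: abs_mult power_mult_distrib power_abs divide_inverse mult_ac
        mult_left_mono mult_right_mono)
qed

lemma matrix_exp_sums: "(\<lambda>k. mpow A k /\<^sub>R fact k) sums matrix_exp A"
proof -
  define S where "S = (\<chi> i j. \<Sum>k. mpow A k $ i $ j / fact k)"
  have "(\<lambda>k. mpow A k $ i $ j / fact k) sums S $ i $ j" for i j
    using summable_sums[OF summable_mpow[of A i j 1]] by (simp add: S_def)
  then have "(\<lambda>k. mpow A k /\<^sub>R fact k) sums S"
    unfolding sums_def by (intro vec_tendstoI) (simp add: divide_inverse mult.commute)
  moreover from this have "matrix_exp A = S"
    unfolding matrix_exp_def mpow_def[symmetric] by (rule sums_unique[symmetric])
  ultimately show ?thesis by simp
qed

lemma matrix_exp_nth: "matrix_exp (t *\<^sub>R A) $ i $ j = (\<Sum>k. mpow A k $ i $ j / fact k * t ^ k)"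
  using sums_unique[OF sums_vec_nth[OF sums_vec_nth[OF matrix_exp_sums[of "t *\<^sub>R A"]]], of i j]
  by (simp add: mpow_scaleR divide_inverse mult_ac)

lemma matrix_exp_0 [simp]: "matrix_exp 0 = mat 1"
proof -
  have "matrix_exp 0 $ i $ j = mat 1 $ i $ (j::'a)" for i j
  proof -
    have "matrix_exp (0 *\<^sub>R 0) $ i $ j = (\<Sum>k. mpow 0 k $ i $ j / fact k * 0 ^ k)"
      by (rule matrix_exp_nth)
    also have "\<dots> = mpow 0 0 $ i $ j / fact 0" by (rule powser_zero)
    finally show ?thesis by simp
  qed
  then show ?thesis by (simp add: vec_eq_iff)
qed

lemma matrix_vector_mult_minus_left: "(- A) *v x = - ((A :: real ^ 'n ^ 'm::finite) *v x)"
  by (simp add: vec_eq_iff matrix_vector_mult_def sum_negf)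

lemma matrix_exp_has_derivative:
  "((\<lambda>t. (matrix_exp (t *\<^sub>R A) *v x) $ i) has_real_derivative
      (A *v (matrix_exp (t *\<^sub>R A) *v x)) $ i) (at t)"
proof -
  have d: "((\<lambda>t. matrix_exp (t *\<^sub>R A) $ i $ j) has_real_derivative
      (A ** matrix_exp (t *\<^sub>R A)) $ i $ j) (at t)" for j
  proof -
    let ?c = "\<lambda>i k. mpow A k $ i $ j / fact k"
    \<comment> \<open>The factor \<open>k + 1\<close> from differentiation cancels against
      \<open>fact (k + 1)\<close>, and the extra factor \<open>A\<close> in the next power comes out
      on the left.\<close>
    have "diffs (?c i) k = (\<Sum>l\<in>UNIV. A $ i $ l * ?c l k)" for k
      by (simp add: diffs_def mpow_Suc matrix_matrix_mult_def sum_distrib_left sum_divide_distrib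
          del: of_nat_Suc)
    then have "(\<Sum>k. diffs (?c i) k * t ^ k) = (\<Sum>k. \<Sum>l\<in>UNIV. A $ i $ l * (?c l k * t ^ k))"
      by (simp add: sum_distrib_left sum_distrib_right mult_ac)
    also have "\<dots> = (\<Sum>l\<in>UNIV. A $ i $ l * (\<Sum>k. ?c l k * t ^ k))"
      by (subst suminf_sum[OF summable_mult[OF summable_mpow]])
         (rule sum.cong[OF refl suminf_mult[OF summable_mpow]])
    also have "\<dots> = (A ** matrix_exp (t *\<^sub>R A)) $ i $ j"
      by (simp add: matrix_matrix_mult_def matrix_exp_nth)
    finally show ?thesis
      using termdiffs_strong_converges_everywhere[OF summable_mpow[of A i j], of t]
      by (simp add: matrix_exp_nth)
  qed
  have "((\<lambda>t. \<Sum>j\<in>UNIV. matrix_exp (t *\<^sub>R A) $ i $ j * x $ j) has_real_derivative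
      (\<Sum>j\<in>UNIV. (A ** matrix_exp (t *\<^sub>R A)) $ i $ j * x $ j)) (at t)"
    by (intro DERIV_sum DERIV_cmult_right d)
  then show ?thesis
    by (simp add: matrix_vector_mul_assoc) (simp add: matrix_vector_mult_def)
qed

lemma matrix_exp_conjugate:
  assumes "R ** R = mat 1"
  shows "matrix_exp (R ** A ** R) = R ** matrix_exp A ** R"
proof -
  have p: "mpow (R ** A ** R) k = R ** mpow A k ** R" for k
  proof (induction k)
    case (Suc k)
    have "mpow (R ** A ** R) (Suc k) = R ** A ** (R ** R) ** mpow A k ** R"
      by (simp add: mpow_Suc Suc matrix_mul_assoc)
    then show ?case by (simp add: assms mpow_Suc matrix_mul_assoc)
  qed (simp add: assms)
  have "linear (\<lambda>X. R ** X ** R)"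
    by (rule linearI) (simp_all add: matrix_add_ldistrib matrix_add_rdistrib matrix_scalar_ac scalar_matrix_assoc)
  then have bl: "bounded_linear (\<lambda>X. R ** X ** R)" by (simp add: linear_conv_bounded_linear)
  have "(\<lambda>k. R ** (mpow A k /\<^sub>R fact k) ** R) sums (R ** matrix_exp A ** R)"
    by (rule bounded_linear.sums[OF bl matrix_exp_sums])
  then have "(\<lambda>k. mpow (R ** A ** R) k /\<^sub>R fact k) sums (R ** matrix_exp A ** R)"
    by (simp add: p matrix_scalar_ac scalar_matrix_assoc)
  then show ?thesis using matrix_exp_sums sums_unique2 by blast
qed

section \<open>The Lie algebra of a stabilizer\<close>

text \<open>The derivative at \<open>t = 0\<close> of the pullback of \<alpha> along the exponential
  of \<open>t A\<close>.\<close>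

definition infinitesimal_action :: "real ^ 'n ^ 'n \<Rightarrow> ('n::finite, real) form \<Rightarrow> ('n, real) form" where
  "infinitesimal_action A \<alpha> = (\<lambda>vs. \<Sum>i<length vs. \<alpha> (vs[i := A *v vs ! i]))"

lemma linear_coordinates:
  fixes f :: "real ^ 'n::finite \<Rightarrow> real"
  assumes "linear f" shows "f x = (\<Sum>i\<in>UNIV. x $ i * f (axis i 1))"
proof -
  have "f x = f (\<Sum>i\<in>UNIV. x $ i *\<^sub>R axis i 1)" by (simp add: basis_expansion scalar_mult_eq_scaleR[symmetric])
  also have "\<dots> = (\<Sum>i\<in>UNIV. x $ i * f (axis i 1))" by (simp add: linear_sum[OF assms] linear_cmul[OF assms])
  finally show ?thesis .
qed

text \<open>Expanding the first argument in coordinates turns the form into a finite sum of scalar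
  products, to which the product rule and the induction hypothesis apply.\<close>

lemma alternating_has_derivative:
  fixes \<alpha> :: "('n::finite, real) form"
  assumes "alternating k \<alpha>"
    "\<And>v i. ((\<lambda>t. \<gamma> t v $ i) has_real_derivative \<gamma>' v $ i) (at t)"
  shows "((\<lambda>t. \<alpha> (map (\<gamma> t) vs)) has_real_derivative
      (\<Sum>i<length vs. \<alpha> ((map (\<gamma> t) vs)[i := \<gamma>' (vs ! i)]))) (at t)"
  using assms(1)
proof (induction vs arbitrary: k \<alpha>)
  case Nil
  then show ?case by simp
next
  case (Cons v vs)
  let ?D = "\<lambda>\<alpha>. \<Sum>i<length vs. \<alpha> ((map (\<gamma> t) vs)[i := \<gamma>' (vs ! i)])"
  have e: "\<alpha> (x # us) = (\<Sum>i\<in>UNIV. x $ i * \<alpha> (axis i 1 # us))" for x us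
    by (rule linear_coordinates[OF alternating_linear_hd[OF Cons.prems]])
  have "((\<lambda>t. \<Sum>i\<in>UNIV. \<gamma> t v $ i * \<alpha> (axis i 1 # map (\<gamma> t) vs)) has_real_derivative
      (\<Sum>i\<in>UNIV. \<gamma>' v $ i * \<alpha> (axis i 1 # map (\<gamma> t) vs)
         + ?D (contract (axis i 1) \<alpha>) * \<gamma> t v $ i)) (at t)"
    by (intro DERIV_sum DERIV_mult assms(2) Cons.IH[OF alternating_contract[OF Cons.prems]])
  also have "(\<Sum>i\<in>UNIV. \<gamma>' v $ i * \<alpha> (axis i 1 # map (\<gamma> t) vs)
         + ?D (contract (axis i 1) \<alpha>) * \<gamma> t v $ i)
      = \<alpha> (\<gamma>' v # map (\<gamma> t) vs) + ?D (contract (\<gamma> t v) \<alpha>)"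
    unfolding e[of "\<gamma>' v"] e[of "\<gamma> t v"]
    by (subst sum.swap) (simp add: sum.distrib sum_distrib_left sum_distrib_right mult.commute)
  finally show ?case
    by (simp add: e[symmetric] sum.lessThan_Suc_shift del: sum.lessThan_Suc)
qed

text \<open>The derivative at every \<open>t\<close>, not only at 0, is the infinitesimal action
  evaluated at the moved arguments. If that action vanishes, the pullback is constant in
  \<open>t\<close>.\<close>

lemma pullback_matrix_exp_iff:
  fixes \<alpha> :: "('n::finite, real) form"
  assumes "alternating k \<alpha>"
  shows "(\<forall>t. pullback (matrix_exp (t *\<^sub>R A)) \<alpha> = \<alpha>) \<longleftrightarrow> infinitesimal_action A \<alpha> = (\<lambda>vs. 0)"
proof -
  let ?E = "\<lambda>t. (*v) (matrix_exp (t *\<^sub>R A))"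
  have d: "((\<lambda>t. \<alpha> (map (?E t) vs)) has_real_derivative infinitesimal_action A \<alpha> (map (?E t) vs)) (at t)" for t vs
    using alternating_has_derivative[OF assms, of ?E "\<lambda>v. A *v (?E t v)" t vs]
    by (simp add: matrix_exp_has_derivative infinitesimal_action_def)
  show ?thesis
  proof
    assume "\<forall>t. pullback (matrix_exp (t *\<^sub>R A)) \<alpha> = \<alpha>"
    then have c: "\<alpha> (map (?E t) vs) = \<alpha> vs" for t vs
      by (simp add: pullback_def fun_eq_iff)
    have "infinitesimal_action A \<alpha> vs = 0" for vs
      using DERIV_unique[OF d[of vs 0], of 0] by (simp add: c map_idI)
    then show "infinitesimal_action A \<alpha> = (\<lambda>vs. 0)" by auto
  next
    assume 0: "infinitesimal_action A \<alpha> = (\<lambda>vs. 0)"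
    have "\<alpha> (map (?E t) vs) = \<alpha> (map (?E 0) vs)" for t vs
      by (rule DERIV_isconst_all) (use d 0 in auto)
    then show "\<forall>t. pullback (matrix_exp (t *\<^sub>R A)) \<alpha> = \<alpha>"
      by (simp add: pullback_def fun_eq_iff map_idI)
  qed
qed

definition skew :: "real ^ 'n ^ 'n \<Rightarrow> bool" where
  "skew A \<longleftrightarrow> (\<forall>x y. (A *v x) \<bullet> y + x \<bullet> (A *v y) = 0)"

lemma skew_0: "skew 0"
  by (simp add: skew_def)

lemma skew_add:
  assumes "skew A" "skew B" shows "skew (A + B)"
  unfolding skew_def
proof (intro allI)
  fix x y
  have "(A *v x) \<bullet> y + x \<bullet> (A *v y) + ((B *v x) \<bullet> y + x \<bullet> (B *v y)) = 0"
    using assms by (simp add: skew_def)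
  then show "((A + B) *v x) \<bullet> y + x \<bullet> ((A + B) *v y) = 0"
    by (simp add: matrix_vector_mult_add_rdistrib inner_add_left inner_add_right)
qed

lemma skew_scaleR: "skew A \<Longrightarrow> skew (c *\<^sub>R A)"
  by (simp add: skew_def scaleR_matrix_vector_assoc[symmetric] distrib_left[symmetric])

lemma orthogonal_matrix_inner:
  "orthogonal_matrix (P :: real ^ 'n ^ 'n::finite) \<longleftrightarrow> (\<forall>x y. (P *v x) \<bullet> (P *v y) = x \<bullet> y)"
  using orthogonal_transformation_matrix[of "(*v) P"]
  by (auto simp: orthogonal_transformation_def)

text \<open>Skewness is the vanishing derivative of the inner products along the flow. The
  determinant is continuous on the line with values in {1, -1}, hence keeps its value 1 from
  \<open>t = 0\<close>.\<close>

lemma rotation_matrix_exp_iff: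
  "(\<forall>t. rotation_matrix (matrix_exp (t *\<^sub>R A))) \<longleftrightarrow> skew A"
proof -
  let ?E = "\<lambda>t. (*v) (matrix_exp (t *\<^sub>R A))"
  have d: "((\<lambda>t. ?E t x \<bullet> ?E t y) has_real_derivative
      (A *v ?E t x) \<bullet> ?E t y + ?E t x \<bullet> (A *v ?E t y)) (at t)" for t x y
  proof -
    have "((\<lambda>t. \<Sum>i\<in>UNIV. ?E t x $ i * ?E t y $ i) has_real_derivative
      (\<Sum>i\<in>UNIV. (A *v ?E t x) $ i * ?E t y $ i + (A *v ?E t y) $ i * ?E t x $ i)) (at t)"
      by (intro DERIV_sum DERIV_mult matrix_exp_has_derivative)
    then show ?thesis by (simp add: inner_vec_def sum.distrib mult.commute)
  qed
  show ?thesis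
  proof
    assume "\<forall>t. rotation_matrix (matrix_exp (t *\<^sub>R A))"
    then have c: "?E t x \<bullet> ?E t y = x \<bullet> y" for t x y
      by (simp add: rotation_matrix_def orthogonal_matrix_inner)
    have "(A *v x) \<bullet> y + x \<bullet> (A *v y) = 0" for x y
      using DERIV_unique[OF d[of x y 0], of 0] by (simp add: c)
    then show "skew A" by (simp add: skew_def)
  next
    assume skew: "skew A"
    have "?E t x \<bullet> ?E t y = ?E 0 x \<bullet> ?E 0 y" for t x y
      by (rule DERIV_isconst_all) (use d skew in \<open>auto simp: skew_def\<close>)
    then have o: "orthogonal_matrix (matrix_exp (t *\<^sub>R A))" for t
      by (simp add: orthogonal_matrix_inner)
    have entry: "matrix_exp (t *\<^sub>R A) $ i $ j = ?E t (axis j 1) $ i" for t i j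
      by (simp add: matrix_vector_mul_component inner_axis)
    have "isCont (\<lambda>t. ?E t x $ i) t" for t x i
      by (rule DERIV_isCont[OF matrix_exp_has_derivative])
    then have "continuous_on UNIV (\<lambda>t. matrix_exp (t *\<^sub>R A) $ i $ j)" for i j
      unfolding entry by (simp add: continuous_at_imp_continuous_on)
    then have cont: "continuous_on UNIV (\<lambda>t. det (matrix_exp (t *\<^sub>R A)))"
      unfolding det_def
      by (intro continuous_on_sum continuous_on_mult continuous_on_const continuous_on_prod)
    have "range (\<lambda>t. det (matrix_exp (t *\<^sub>R A))) \<subseteq> {1, -1}"
      using det_orthogonal_matrix[OF o] by auto
    then have "finite (range (\<lambda>t. det (matrix_exp (t *\<^sub>R A))))"
      by (rule finite_subset) simp
    from continuous_finite_range_constant[OF connected_UNIV cont this]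
    have "det (matrix_exp (t *\<^sub>R A)) = det (matrix_exp (0 *\<^sub>R A))" for t
      unfolding constant_on_def by (metis UNIV_I)
    then show "\<forall>t. rotation_matrix (matrix_exp (t *\<^sub>R A))"
      using o by (simp add: rotation_matrix_def)
  qed
qed

text \<open>Membership through exponentials is not visibly additive. These equations are linear in
  \<open>A\<close>, which yields closure under addition and so puts \<open>A + R ** A ** R\<close>
  into the Lie algebra.\<close>

lemma lie_algebra_SO_stabilizer:
  assumes "\<forall>\<beta>\<in>S. \<exists>k. alternating k \<beta>"
  shows "A \<in> lie_algebra (SO_stabilizer S) \<longleftrightarrow>
    skew A \<and> (\<forall>\<beta>\<in>S. infinitesimal_action A \<beta> = (\<lambda>vs. 0))"
proof -
  have "A \<in> lie_algebra (SO_stabilizer S) \<longleftrightarrow>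
    (\<forall>t. rotation_matrix (matrix_exp (t *\<^sub>R A))) \<and>
    (\<forall>\<beta>\<in>S. \<forall>t. pullback (matrix_exp (t *\<^sub>R A)) \<beta> = \<beta>)"
    by (auto simp: lie_algebra_def SO_stabilizer_def)
  also have "\<dots> \<longleftrightarrow> skew A \<and> (\<forall>\<beta>\<in>S. infinitesimal_action A \<beta> = (\<lambda>vs. 0))"
    using pullback_matrix_exp_iff assms unfolding rotation_matrix_exp_iff by blast
  finally show ?thesis .
qed

lemma infinitesimal_action_add:
  assumes "alternating k \<alpha>"
  shows "infinitesimal_action (A + B) \<alpha> vs = infinitesimal_action A \<alpha> vs + infinitesimal_action B \<alpha> vs"
proof -
  have "\<alpha> (vs[i := (A + B) *v vs ! i]) = \<alpha> (vs[i := A *v vs ! i]) + \<alpha> (vs[i := B *v vs ! i])"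
    if "i < length vs" for i
    using that linear_add[OF alternating_linear[OF assms]]
    by (simp add: upd_conv_take_nth_drop matrix_vector_mult_add_rdistrib)
  then show ?thesis by (simp add: infinitesimal_action_def sum.distrib)
qed

lemma lie_algebra_SO_stabilizer_add:
  assumes "\<forall>\<beta>\<in>S. \<exists>k. alternating k \<beta>"
    "A \<in> lie_algebra (SO_stabilizer S)" "B \<in> lie_algebra (SO_stabilizer S)"
  shows "A + B \<in> lie_algebra (SO_stabilizer S)"
proof -
  note iff = lie_algebra_SO_stabilizer[OF assms(1)]
  have "infinitesimal_action (A + B) \<beta> = (\<lambda>vs. 0)" if \<beta>: "\<beta> \<in> S" for \<beta>
  proof -
    obtain k where "alternating k \<beta>" using assms(1) \<beta> by blast
    moreover have "infinitesimal_action A \<beta> = (\<lambda>vs. 0)" "infinitesimal_action B \<beta> = (\<lambda>vs. 0)"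
      using assms(2,3) \<beta> unfolding iff by auto
    ultimately show ?thesis by (simp add: fun_eq_iff infinitesimal_action_add)
  qed
  moreover have "skew (A + B)"
    using assms(2,3) unfolding iff by (blast intro: skew_add)
  ultimately show ?thesis unfolding iff by blast
qed

section \<open>Reflections\<close>

definition proj :: "(real ^ 'n::finite) list \<Rightarrow> real ^ 'n \<Rightarrow> real ^ 'n" where
  "proj es x = (\<Sum>e\<in>set es. (e \<bullet> x) *\<^sub>R e)"

definition reflection :: "(real ^ 'n::finite) list \<Rightarrow> real ^ 'n \<Rightarrow> real ^ 'n" where
  "reflection es x = 2 *\<^sub>R proj es x - x"

lemma linear_proj: "linear (proj es)"
  by (rule linearI) (simp_all add: proj_def inner_add_right scaleR_add_left sum.distrib scaleR_sum_right)

lemma linear_reflection: "linear (reflection es)"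
  unfolding reflection_def[abs_def]
  by (intro linear_compose_sub linear_compose_scale_right linear_proj linear_ident)

lemma proj_in_span: "proj es x \<in> span (set es)"
  unfolding proj_def by (intro span_sum span_scale span_base)

lemma proj_inner: "proj es x \<bullet> y = x \<bullet> proj es y"
  by (simp add: proj_def inner_sum_left inner_sum_right inner_commute mult.commute)

lemma inner_proj:
  assumes "orthonormal_list k es" "e \<in> set es"
  shows "e \<bullet> proj es x = e \<bullet> x"
proof -
  have "e \<bullet> proj es x = (\<Sum>e'\<in>set es. if e' = e then e \<bullet> x else 0)"
    unfolding proj_def inner_sum_right
    by (intro sum.cong) (auto simp: orthonormal_list_inner[OF assms(1,2)])
  then show ?thesis using assms(2) by simp
qed

lemma proj_id:
  assumes "orthonormal_list k es" "x \<in> span (set es)" shows "proj es x = x"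
proof -
  have "proj es e = e" if "e \<in> set es" for e
  proof -
    have "proj es e = (\<Sum>e'\<in>set es. if e' = e then e else 0)"
      unfolding proj_def
      by (intro sum.cong) (use that in \<open>auto simp: orthonormal_list_inner[OF assms(1)]\<close>)
    then show ?thesis using that by simp
  qed
  then show ?thesis
    using linear_eq_on_span[OF linear_proj linear_ident _ assms(2)] by blast
qed

lemma proj_0: "(\<And>e. e \<in> set es \<Longrightarrow> e \<bullet> x = 0) \<Longrightarrow> proj es x = 0"
  by (simp add: proj_def)

lemma scaleR_2_diff: "2 *\<^sub>R x - x = (x :: 'a::real_vector)"
  by (simp add: scaleR_2)

lemma reflection_id: "orthonormal_list k es \<Longrightarrow> x \<in> span (set es) \<Longrightarrow> reflection es x = x"
  by (simp add: reflection_def proj_id scaleR_2_diff)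

lemma reflection_neg: "(\<And>e. e \<in> set es \<Longrightarrow> e \<bullet> x = 0) \<Longrightarrow> reflection es x = - x"
  by (simp add: reflection_def proj_0)

lemma reflection_reflection:
  assumes "orthonormal_list k es" shows "reflection es (reflection es x) = x"
proof -
  have "proj es (2 *\<^sub>R proj es x - x) = proj es x"
    by (simp only: linear_diff[OF linear_proj] linear_cmul[OF linear_proj]
        proj_id[OF assms proj_in_span] scaleR_2_diff)
  then show ?thesis by (simp add: reflection_def)
qed

lemma reflection_inner: "reflection es x \<bullet> y = x \<bullet> reflection es y"
  by (simp add: reflection_def inner_diff_left inner_diff_right proj_inner)

lemma reflection_isometry: "orthonormal_list k es \<Longrightarrow> reflection es x \<bullet> reflection es y = x \<bullet> y"
  by (simp add: reflection_inner reflection_reflection)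

lemma orthogonal_comp_span_iff:
  "x \<in> (span (set es))\<^sup>\<bottom> \<longleftrightarrow> (\<forall>e\<in>set es. e \<bullet> x = 0)"
proof -
  have "x \<in> (span (set es))\<^sup>\<bottom> \<longleftrightarrow> (\<forall>y\<in>span (set es). orthogonal x y)"
    by (auto simp: orthogonal_comp_def orthogonal_commute)
  also have "\<dots> \<longleftrightarrow> (\<forall>y\<in>set es. orthogonal x y)"
    using orthogonal_to_span span_base by blast
  finally show ?thesis by (auto simp: orthogonal_def inner_commute)
qed

lemma bivector_mult: "bivector u w *v x = (u \<bullet> x) *\<^sub>R w - (w \<bullet> x) *\<^sub>R u"
  by (simp add: vec_eq_iff bivector_def matrix_vector_mult_def inner_vec_def
      sum_subtractf[symmetric] sum_distrib_left sum_distrib_right algebra_simps)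

lemma matrix_inner_mult_left: "(P ** A) \<bullet> B = A \<bullet> (transpose P ** (B :: real ^ 'n ^ 'n::finite))"
proof -
  have "(P ** A) \<bullet> B = (\<Sum>i\<in>UNIV. \<Sum>j\<in>UNIV. \<Sum>k\<in>UNIV. P $ i $ k * A $ k $ j * B $ i $ j)"
    by (simp add: inner_vec_def matrix_matrix_mult_def sum_distrib_right)
  also have "\<dots> = (\<Sum>i\<in>UNIV. \<Sum>k\<in>UNIV. \<Sum>j\<in>UNIV. P $ i $ k * A $ k $ j * B $ i $ j)"
    by (rule sum.cong[OF refl sum.swap])
  also have "\<dots> = (\<Sum>k\<in>UNIV. \<Sum>i\<in>UNIV. \<Sum>j\<in>UNIV. P $ i $ k * A $ k $ j * B $ i $ j)"
    by (rule sum.swap)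
  also have "\<dots> = (\<Sum>k\<in>UNIV. \<Sum>j\<in>UNIV. \<Sum>i\<in>UNIV. P $ i $ k * A $ k $ j * B $ i $ j)"
    by (rule sum.cong[OF refl sum.swap])
  also have "\<dots> = A \<bullet> (transpose P ** B)"
    by (simp add: inner_vec_def matrix_matrix_mult_def transpose_def sum_distrib_left mult_ac)
  finally show ?thesis .
qed

lemma matrix_inner_transpose: "transpose A \<bullet> transpose B = (A :: real ^ 'n ^ 'n::finite) \<bullet> (B :: real ^ 'n ^ 'n::finite)"
  unfolding inner_vec_def by (subst sum.swap) (simp add: transpose_def inner_vec_def)

lemma matrix_inner_mult_right: "((A :: real ^ 'n ^ 'n) ** P) \<bullet> B = A \<bullet> (B ** transpose (P :: real ^ 'n ^ 'n::finite))"
  using matrix_inner_mult_left[of "transpose P" "transpose A" "transpose B"]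
  by (metis matrix_inner_transpose matrix_transpose_mul transpose_transpose)

lemma matrix_eq_mult: "(\<And>x. A *v x = B *v x) \<Longrightarrow> A = (B :: real ^ 'n ^ 'm::finite)"
  by (simp add: matrix_eq)

text \<open>Anticommuting with the reflection means exchanging the plane and its complement. So the
  mixed bivectors are exactly the skew matrices in the -1 eigenspace of conjugation.\<close>

lemma mixed_bivectors_iff:
  assumes "orthonormal_list k es"
  shows "A \<in> mixed_bivectors (span (set es)) \<longleftrightarrow>
    skew A \<and> (\<forall>x. A *v reflection es x = - reflection es (A *v x))"
proof
  have sub: "subspace {A. skew A \<and> (\<forall>x. A *v reflection es x = - reflection es (A *v x))}"
    unfolding subspace_def
    by (auto intro: skew_0 skew_add skew_scaleR
        simp: matrix_vector_mult_add_rdistrib scaleR_matrix_vector_assoc[symmetric]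
        linear_add[OF linear_reflection] linear_cmul[OF linear_reflection] linear_0[OF linear_reflection])
  have "bivector w u \<in> {A. skew A \<and> (\<forall>x. A *v reflection es x = - reflection es (A *v x))}"
    if "w \<in> span (set es)" "u \<in> (span (set es))\<^sup>\<bottom>" for w u
  proof -
    have w: "reflection es w = w" using reflection_id[OF assms that(1)] .
    have u: "reflection es u = - u" using that(2) by (simp add: orthogonal_comp_span_iff reflection_neg)
    have "skew (bivector w u)"
      by (simp add: bivector_mult skew_def inner_diff_left inner_diff_right inner_commute mult.commute)
    moreover have "w \<bullet> reflection es x = w \<bullet> x" "u \<bullet> reflection es x = - (u \<bullet> x)" for x
      using w u by (simp_all flip: reflection_inner)
    then have "bivector w u *v reflection es x = - reflection es (bivector w u *v x)" for x
      by (simp add: bivector_mult linear_diff[OF linear_reflection] linear_cmul[OF linear_reflection] w u)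
    ultimately show ?thesis by blast
  qed
  then have "mixed_bivectors (span (set es)) \<subseteq> {A. skew A \<and> (\<forall>x. A *v reflection es x = - reflection es (A *v x))}"
    unfolding mixed_bivectors_def by (intro span_minimal sub) blast
  moreover assume "A \<in> mixed_bivectors (span (set es))"
  ultimately show "skew A \<and> (\<forall>x. A *v reflection es x = - reflection es (A *v x))"
    by fast
next
  assume A: "skew A \<and> (\<forall>x. A *v reflection es x = - reflection es (A *v x))"
  have perp: "A *v e \<in> (span (set es))\<^sup>\<bottom>" if "e \<in> set es" for e
  proof -
    have "reflection es (A *v e) = - (A *v e)"
      using A reflection_id[OF assms span_base[OF that]] by (metis minus_minus)
    then have "proj es (A *v e) = 0" by (simp add: reflection_def)
    then show ?thesis
      unfolding orthogonal_comp_span_iff using inner_proj[OF assms] by (metis inner_zero_right)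
  qed
  \<comment> \<open>The summands record only the block from the plane to its complement; skewness of
    \<open>A\<close> supplies the opposite block as \<open>proj es (A *v x)\<close>.\<close>
  have "A = (\<Sum>e\<in>set es. bivector e (A *v e))"
  proof (rule matrix_eq_mult)
    fix x
    have "(\<Sum>e\<in>set es. bivector e (A *v e)) *v x = (\<Sum>e\<in>set es. bivector e (A *v e) *v x)"
      by (induction rule: infinite_finite_induct) (simp_all add: matrix_vector_mult_add_rdistrib)
    also have "\<dots> = A *v proj es x + proj es (A *v x)"
    proof -
      have "(A *v e) \<bullet> x = - (e \<bullet> (A *v x))" for e
        using A by (simp add: skew_def eq_neg_iff_add_eq_0)
      then show ?thesis
        by (simp add: bivector_mult proj_def linear_sum[OF matrix_vector_mul_linear]
            linear_cmul[OF matrix_vector_mul_linear] sum.distrib)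
    qed
    also have "\<dots> = A *v x"
    proof -
      \<comment> \<open>In terms of the projection, anticommutation says that \<open>A\<close> is
        the sum of its products with \<open>proj es\<close> on either side.\<close>
      have "A *v reflection es x = - reflection es (A *v x)" using A by blast
      then have "2 *\<^sub>R (A *v proj es x) - A *v x = A *v x - 2 *\<^sub>R proj es (A *v x)"
        by (simp add: reflection_def linear_diff[OF matrix_vector_mul_linear] linear_cmul[OF matrix_vector_mul_linear])
      then have "2 *\<^sub>R (A *v proj es x + proj es (A *v x)) = 2 *\<^sub>R (A *v x)"
        by (simp add: scaleR_add_right scaleR_2[of "A *v x"] algebra_simps)
      then show ?thesis by simp
    qed
    finally show "A *v x = (\<Sum>e\<in>set es. bivector e (A *v e)) *v x" ..
  qed
  also have "\<dots> \<in> mixed_bivectors (span (set es))"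
    unfolding mixed_bivectors_def
    by (intro span_sum span_base) (use perp span_base in blast)
  finally show "A \<in> mixed_bivectors (span (set es))" .
qed

section \<open>Compliance from the behaviour of the forms under the reflection\<close>

lemma lie_algebra_complement:
  fixes es :: "(real ^ 'n::finite) list"
  assumes es: "orthonormal_list k es"
    and S: "\<forall>\<beta>\<in>S. \<exists>k. alternating k \<beta>"
    and inv: "\<And>\<beta>. \<beta> \<in> S \<Longrightarrow> (\<forall>vs. \<beta> (map (reflection es) vs) = \<beta> vs) \<or> (\<forall>vs. \<beta> (map (reflection es) vs) = - \<beta> vs)"
  shows "lie_algebra (SO_stabilizer S) \<inter> (lie_algebra (plane_stabilizer (SO_stabilizer S) (span (set es))))\<^sup>\<bottom>
       = lie_algebra (SO_stabilizer S) \<inter> mixed_bivectors (span (set es))"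
proof -
  define G where "G = SO_stabilizer S"
  define W where "W = span (set es)"
  define R where "R = matrix (reflection es)"
  have Rv: "R *v x = reflection es x" for x
    by (simp add: R_def matrix_works linear_reflection)
  have RR: "R ** R = mat 1"
    by (rule matrix_eq_mult) (simp add: matrix_vector_mul_assoc[symmetric] Rv reflection_reflection[OF es])
  have oR: "orthogonal_matrix R"
    by (simp add: orthogonal_matrix_inner Rv reflection_isometry[OF es])
  have tR: "transpose R = R"
    using oR RR unfolding orthogonal_matrix_def by (metis matrix_mul_assoc matrix_mul_lid matrix_mul_rid)
  have dR: "det R * det R = 1"
    using RR by (metis det_I det_mul)
  have inner: "(R ** A ** R) \<bullet> B = A \<bullet> (R ** B ** R)" for A B
    using matrix_inner_mult_right[of "R ** A" R B] matrix_inner_mult_left[of R A "B ** R"]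
    by (simp only: tR matrix_mul_assoc)
  have conjG: "R ** P ** R \<in> G" if "P \<in> G" for P
  proof -
    have "rotation_matrix P" using that by (simp add: G_def SO_stabilizer_def)
    \<comment> \<open>\<open>R\<close> may reverse orientation, but its determinant enters
      squared.\<close>
    then have "rotation_matrix (R ** P ** R)"
      using oR dR by (auto simp: rotation_matrix_def det_mul mult.commute intro!: orthogonal_matrix_mul)
    moreover have "\<beta> (map ((*v) (R ** P ** R)) vs) = \<beta> vs" if "\<beta> \<in> S" for \<beta> vs
    proof -
      have P: "\<beta> (map ((*v) P) ws) = \<beta> ws" for ws
        using that \<open>P \<in> G\<close> by (auto simp: G_def SO_stabilizer_def pullback_def fun_eq_iff)
      have m: "map ((*v) (R ** P ** R)) vs = map (reflection es) (map ((*v) P) (map (reflection es) vs))"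
        by (simp add: matrix_vector_mul_assoc[symmetric] Rv o_def)
      show ?thesis
        unfolding m using inv[OF that] by (auto simp: P simp del: map_map)
    qed
    ultimately show ?thesis by (simp add: G_def SO_stabilizer_def pullback_def fun_eq_iff)
  qed
  have expconj: "matrix_exp (t *\<^sub>R (R ** A ** R)) = R ** matrix_exp (t *\<^sub>R A) ** R" for t A
    using matrix_exp_conjugate[OF RR, of "t *\<^sub>R A"] by (simp add: matrix_scalar_ac scalar_matrix_assoc)
  have conj: "R ** A ** R \<in> lie_algebra G" if "A \<in> lie_algebra G" for A
    using that conjG by (simp add: lie_algebra_def expconj)
  have invol: "R ** (R ** A ** R) ** R = A" for A
    by (metis RR matrix_mul_assoc matrix_mul_lid matrix_mul_rid)
  have h: "A \<in> lie_algebra (plane_stabilizer G W) \<longleftrightarrow> A \<in> lie_algebra G \<and> R ** A ** R = A" for A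
  proof
    assume A: "A \<in> lie_algebra (plane_stabilizer G W)"
    then have G: "A \<in> lie_algebra G" by (simp add: lie_algebra_def plane_stabilizer_def)
    have skew: "skew A" using G S by (simp add: G_def lie_algebra_SO_stabilizer)
    \<comment> \<open>The curve obtained by applying the exponential of \<open>t A\<close> to
      \<open>w\<close> stays in the plane, so its inner product with a normal \<open>u\<close> is
      identically zero; its derivative at 0 removes the mixed block of \<open>A\<close>.\<close>
    have AW: "u \<bullet> (A *v w) = 0" if w: "w \<in> W" and u: "\<And>e. e \<in> set es \<Longrightarrow> e \<bullet> u = 0" for u w
    proof -
      have u': "u \<bullet> x = 0" if "x \<in> W" for x
      proof -
        have "u \<in> (span (set es))\<^sup>\<bottom>" using u by (simp add: orthogonal_comp_span_iff)
        then show ?thesis using that by (auto simp: W_def orthogonal_comp_def orthogonal_def inner_commute)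
      qed
      have "matrix_exp (t *\<^sub>R A) *v w \<in> W" for t
        using A w by (auto simp: lie_algebra_def plane_stabilizer_def)
      then have 0: "(\<lambda>t. u \<bullet> (matrix_exp (t *\<^sub>R A) *v w)) = (\<lambda>t. 0)" using u' by auto
      have "((\<lambda>t. \<Sum>i\<in>UNIV. u $ i * (matrix_exp (t *\<^sub>R A) *v w) $ i) has_real_derivative
          (\<Sum>i\<in>UNIV. u $ i * (A *v (matrix_exp (0 *\<^sub>R A) *v w)) $ i)) (at 0)"
        by (intro DERIV_sum DERIV_cmult matrix_exp_has_derivative)
      then have "((\<lambda>t. u \<bullet> (matrix_exp (t *\<^sub>R A) *v w)) has_real_derivative u \<bullet> (A *v w)) (at 0)"
        by (simp add: inner_vec_def)
      then show ?thesis unfolding 0 using DERIV_unique[OF _ DERIV_const] by blast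
    qed
    have "proj es (A *v x) = A *v proj es x" for x
    proof -
      have pW: "proj es z \<in> W" for z unfolding W_def by (rule proj_in_span)
      have perp: "e \<bullet> (z - proj es z) = 0" if "e \<in> set es" for e z
        using inner_proj[OF es that] by (simp add: inner_diff_right)
      define a where "a = proj es x"
      define b where "b = x - proj es x"
      have x: "x = a + b" by (simp add: a_def b_def)
      have "proj es (A *v b) = 0"
      proof (rule proj_0)
        fix e assume e: "e \<in> set es"
        have "b \<bullet> (A *v e) = 0"
          by (rule AW) (use e perp in \<open>auto simp: W_def b_def intro: span_base\<close>)
        then show "e \<bullet> (A *v b) = 0" using skew by (metis add_0 inner_commute skew_def)
      qed
      moreover have "proj es (A *v a) = A *v a"
      proof -
        define d where "d = A *v a - proj es (A *v a)"
        have "d \<bullet> (A *v a) = 0"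
          by (rule AW) (auto simp: a_def d_def pW perp)
        moreover have "d \<bullet> proj es (A *v a) = 0"
          unfolding proj_inner[symmetric] d_def
          by (simp add: linear_diff[OF linear_proj] proj_id[OF es proj_in_span])
        ultimately have "d \<bullet> d = 0" by (simp add: d_def inner_diff_right)
        then show ?thesis by (simp add: d_def)
      qed
      ultimately show ?thesis
        by (simp add: x matrix_vector_right_distrib linear_add[OF linear_proj] flip: a_def)
           (simp add: a_def b_def linear_diff[OF linear_proj] proj_id[OF es proj_in_span])
    qed
    then have "R ** A = A ** R"
      by (intro matrix_eq_mult)
         (simp add: matrix_vector_mul_assoc[symmetric] Rv reflection_def
            linear_diff[OF matrix_vector_mul_linear] linear_cmul[OF matrix_vector_mul_linear])
    then have "R ** A ** R = A" by (metis RR matrix_mul_assoc matrix_mul_rid)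
    with G show "A \<in> lie_algebra G \<and> R ** A ** R = A" by blast
  next
    assume A: "A \<in> lie_algebra G \<and> R ** A ** R = A"
    have "(*v) (matrix_exp (t *\<^sub>R A)) ` W = W" for t
    \<comment> \<open>The exponential is injective, so inclusion suffices by dimension. Inclusion
      holds because it commutes with \<open>R\<close>, whose fixed vectors are exactly the
      plane.\<close>
    proof (rule subspace_dim_equal)
      define P where "P = matrix_exp (t *\<^sub>R A)"
      have "P \<in> G" using A by (simp add: P_def lie_algebra_def)
      then have "orthogonal_matrix P" by (simp add: G_def SO_stabilizer_def rotation_matrix_def)
      then have inj: "inj ((*v) P)"
        unfolding orthogonal_matrix_def by (intro injI) (metis matrix_vector_mul_assoc matrix_vector_mul_lid)
      have W: "subspace W" by (simp add: W_def)
      show "subspace ((*v) (matrix_exp (t *\<^sub>R A)) ` W)"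
        by (rule linear_subspace_image[OF matrix_vector_mul_linear W])
      show "subspace W" by fact
      show "dim ((*v) (matrix_exp (t *\<^sub>R A)) ` W) \<ge> dim W"
        using dim_image_eq[of "(*v) P" W] inj inj_on_subset[of "(*v) P" UNIV] by (simp add: P_def)
      have "R ** P ** R = P" using A expconj[of t A] by (simp add: P_def)
      then have RP: "R ** P = P ** R" by (metis RR matrix_mul_assoc matrix_mul_rid)
      show "(*v) (matrix_exp (t *\<^sub>R A)) ` W \<subseteq> W"
      proof (clarify, fold P_def)
        fix w assume "w \<in> W"
        then have "R *v w = w" unfolding Rv W_def using reflection_id[OF es] by blast
        then have "reflection es (P *v w) = P *v w"
          unfolding Rv[symmetric] by (metis RP matrix_vector_mul_assoc)
        then have "P *v w = proj es (P *v w)" by (simp add: reflection_def algebra_simps flip: scaleR_2)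
        then show "P *v w \<in> W" unfolding W_def using proj_in_span by metis
      qed
    qed
    then show "A \<in> lie_algebra (plane_stabilizer G W)"
      using A by (simp add: lie_algebra_def plane_stabilizer_def)
  qed
  have mixed: "A \<in> mixed_bivectors W \<longleftrightarrow> R ** A ** R = - A" if "A \<in> lie_algebra G" for A
  proof -
    have "skew A" using that S by (simp add: G_def lie_algebra_SO_stabilizer)
    then have "A \<in> mixed_bivectors W \<longleftrightarrow> (\<forall>x. A *v reflection es x = - reflection es (A *v x))"
      unfolding W_def mixed_bivectors_iff[OF es] by blast
    also have "\<dots> \<longleftrightarrow> A ** R = - (R ** A)"
      unfolding matrix_eq
      by (simp add: matrix_vector_mul_assoc[symmetric] Rv matrix_vector_mult_minus_left)
    also have "\<dots> \<longleftrightarrow> R ** A ** R = - A"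
    proof
      assume "A ** R = - (R ** A)"
      then have "R ** (A ** R) = - (R ** (R ** A))"
        by (simp add: matrix_matrix_mult_def sum_negf vec_eq_iff)
      then show "R ** A ** R = - A" by (simp add: matrix_mul_assoc RR)
    next
      assume "R ** A ** R = - A"
      then have "R ** (R ** A ** R) = - (R ** A)"
        by (simp add: matrix_matrix_mult_def sum_negf vec_eq_iff)
      then show "A ** R = - (R ** A)" by (simp add: matrix_mul_assoc RR)
    qed
    finally show ?thesis .
  qed
  have "A \<in> (lie_algebra (plane_stabilizer G W))\<^sup>\<bottom> \<longleftrightarrow> R ** A ** R = - A" if A: "A \<in> lie_algebra G" for A
  proof
    assume "A \<in> (lie_algebra (plane_stabilizer G W))\<^sup>\<bottom>"
    \<comment> \<open>The symmetrized element is fixed by conjugation, hence orthogonal to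
      \<open>A\<close>. Self-adjointness makes it orthogonal to \<open>R ** A ** R\<close> too, so
      it is orthogonal to itself and vanishes.\<close>
    moreover have "R ** (A + R ** A ** R) ** R = A + R ** A ** R"
      by (simp add: matrix_add_ldistrib matrix_add_rdistrib invol add.commute)
    then have "A + R ** A ** R \<in> lie_algebra (plane_stabilizer G W)"
      using lie_algebra_SO_stabilizer_add[OF S A[unfolded G_def] conj[OF A, unfolded G_def]]
      unfolding h by (simp add: G_def)
    ultimately have 0: "(A + R ** A ** R) \<bullet> A = 0"
      by (auto simp: orthogonal_comp_def orthogonal_def)
    have "(A + R ** A ** R) \<bullet> (R ** A ** R) = (R ** (A + R ** A ** R) ** R) \<bullet> A"
      by (rule inner[symmetric])
    also have "\<dots> = 0" using 0 \<open>R ** (A + R ** A ** R) ** R = A + R ** A ** R\<close> by simp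
    finally have "(A + R ** A ** R) \<bullet> (A + R ** A ** R) = 0" using 0 by (simp add: inner_add_right)
    then show "R ** A ** R = - A" by (simp add: eq_neg_iff_add_eq_0 add.commute)
  next
    assume RA: "R ** A ** R = - A"
    \<comment> \<open>Moving the conjugation from \<open>B\<close> to \<open>A\<close> shows that
      the inner product equals its own negative.\<close>
    have "B \<bullet> A = 0" if "R ** B ** R = B" for B
      using inner[of B A] that RA by simp
    then show "A \<in> (lie_algebra (plane_stabilizer G W))\<^sup>\<bottom>"
      by (simp add: orthogonal_comp_def orthogonal_def h)
  qed
  with mixed have "lie_algebra G \<inter> (lie_algebra (plane_stabilizer G W))\<^sup>\<bottom> = lie_algebra G \<inter> mixed_bivectors W"
    by (intro set_eqI) (simp cong: conj_cong)
  then show ?thesis by (simp add: G_def W_def)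
qed

text \<open>The forms \<open>S\<close> that cut out the group are kept apart from \<alpha>: the
  group is given by \<omega> when \<alpha> is a power of it, and by \<phi> when \<alpha> is
  \<psi>.\<close>

lemma compliantI:
  fixes \<alpha> :: "('n::finite, real) form"
  assumes "alternating k \<alpha>" "\<And>es. orthonormal_list k es \<Longrightarrow> \<alpha> es \<le> 1"
    "orthonormal_list k bs" "\<alpha> bs = 1"
    "\<forall>\<beta>\<in>S. \<exists>k. alternating k \<beta>"
    "\<And>es \<beta>. orthonormal_list k es \<Longrightarrow> \<alpha> es = 1 \<Longrightarrow> \<beta> \<in> S \<Longrightarrow>
      (\<forall>vs. \<beta> (map (reflection es) vs) = \<beta> vs) \<or> (\<forall>vs. \<beta> (map (reflection es) vs) = - \<beta> vs)"
  shows "compliant k \<alpha> (SO_stabilizer S)"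
  unfolding compliant_def
proof (intro conjI allI impI)
  show "calibration k \<alpha>" by (rule calibrationI[OF assms(1-4)])
next
  fix W :: "(real ^ 'n) set"
  assume "calibrated_plane k \<alpha> W"
  then obtain es where es: "orthonormal_list k es" "W = span (set es)" "restricts_to_vol \<alpha> es"
    by (auto simp: calibrated_plane_def)
  then show "lie_algebra (SO_stabilizer S) \<inter> (lie_algebra (plane_stabilizer (SO_stabilizer S) W))\<^sup>\<bottom>
       = lie_algebra (SO_stabilizer S) \<inter> mixed_bivectors W"
    unfolding es(2)
    by (intro lie_algebra_complement[OF es(1) assms(5)] assms(6)[OF es(1)] restricts_to_vol_self[OF es(1)])
qed

section \<open>Commutation rules for wedge products\<close>

lemma wedge_diff_right: "(\<gamma> \<^bold>\<and> (\<lambda>vs. \<alpha> vs - \<beta> vs)) vs = (\<gamma> \<^bold>\<and> \<alpha>) vs - (\<gamma> \<^bold>\<and> \<beta>) vs"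
  by (simp add: wedge_def algebra_simps sum_subtractf)

lemma wedge_one_form_anticommute:
  assumes "homogeneous 1 \<alpha>" "homogeneous 1 \<beta>"
  shows "(\<alpha> \<^bold>\<and> (\<beta> \<^bold>\<and> \<gamma>)) vs = - (\<beta> \<^bold>\<and> (\<alpha> \<^bold>\<and> \<gamma>)) vs"
proof (induction vs arbitrary: \<gamma>)
  case Nil
  then show ?case using assms by (simp add: homogeneous_def)
next
  case (Cons v vs)
  then show ?case
    by (simp add: wedge_one_form_Cons[OF assms(1)] wedge_one_form_Cons[OF assms(2)]
        wedge_diff_right wedge_scale_right)
qed

lemma wedge_two_form_commute:
  assumes "homogeneous 2 \<alpha>" "homogeneous 1 \<beta>"
  shows "(\<alpha> \<^bold>\<and> (\<beta> \<^bold>\<and> \<gamma>)) vs = (\<beta> \<^bold>\<and> (\<alpha> \<^bold>\<and> \<gamma>)) vs"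
proof (induction vs arbitrary: \<gamma>)
  case Nil
  then show ?case using assms by (simp add: homogeneous_def)
next
  case (Cons v vs)
  have h: "homogeneous 1 (contract v \<alpha>)" for v
    using homogeneous_contract[OF assms(1)] by simp
  show ?case
    by (simp add: wedge_one_form_Cons[OF assms(2)] wedge_Cons[OF assms(1)] wedge_add_right
        wedge_diff_right wedge_scale_right Cons wedge_one_form_anticommute[OF h assms(2)])
qed

lemma wedge_power_Suc: "wedge_power \<omega> (Suc p) = \<omega> \<^bold>\<and> wedge_power \<omega> p"
  by (simp add: wedge_power_def wedge_list_def)

text \<open>Each factor \<omega> contributes one term when contracted. Two-forms commute with
  one-forms, so all \<open>Suc p\<close> terms coincide.\<close>

lemma wedge_power_Cons:
  assumes "homogeneous 2 \<omega>"
  shows "wedge_power \<omega> (Suc p) (v # vs) = of_nat (Suc p) * (contract v \<omega> \<^bold>\<and> wedge_power \<omega> p) vs"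
proof (induction p arbitrary: vs)
  case 0
  have "contract v unit_form = (\<lambda>vs. 0)" by (simp add: unit_form_def)
  then have "contract v (wedge_power \<omega> 0) = (\<lambda>vs. 0)" by (simp add: wedge_power_def wedge_list_def)
  then show ?case by (simp add: wedge_power_Suc wedge_Cons[OF assms])
next
  case (Suc p)
  have h: "homogeneous 1 (contract v \<omega>)"
    using homogeneous_contract[OF assms] by simp
  have "wedge_power \<omega> (Suc (Suc p)) (v # vs)
      = (contract v \<omega> \<^bold>\<and> wedge_power \<omega> (Suc p)) vs + (\<omega> \<^bold>\<and> contract v (wedge_power \<omega> (Suc p))) vs"
    by (subst wedge_power_Suc) (simp add: wedge_Cons[OF assms])
  also have "contract v (wedge_power \<omega> (Suc p)) = (\<lambda>vs. of_nat (Suc p) * (contract v \<omega> \<^bold>\<and> wedge_power \<omega> p) vs)"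
    using Suc.IH by auto
  also have "(\<omega> \<^bold>\<and> \<dots>) vs = of_nat (Suc p) * (contract v \<omega> \<^bold>\<and> wedge_power \<omega> (Suc p)) vs"
    unfolding wedge_scale_right wedge_two_form_commute[OF assms h] wedge_power_Suc ..
  finally show ?case by (simp add: algebra_simps)
qed

section \<open>Change of orthonormal basis by a Householder reflection\<close>

text \<open>A rank-one perturbation of the arguments: terms with \<open>n\<close> in two positions
  vanish, leaving only those of first order.\<close>

lemma alternating_map_add_scaled:
  fixes \<alpha> :: "('n::finite, real) form"
  assumes "alternating k \<alpha>"
  shows "\<alpha> (map (\<lambda>x. x + c x *\<^sub>R n) vs) = \<alpha> vs + (\<Sum>j<length vs. c (vs ! j) * \<alpha> (vs[j := n]))"
  using assms
proof (induction vs arbitrary: k \<alpha>)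
  case (Cons v vs)
  let ?m = "map (\<lambda>x. x + c x *\<^sub>R n) vs"
  have IH: "\<alpha> (w # ?m) = \<alpha> (w # vs) + (\<Sum>j<length vs. c (vs ! j) * \<alpha> (w # vs[j := n]))" for w
    using Cons.IH[OF alternating_contract[OF Cons.prems, of w]] .
  have 0: "\<alpha> (n # vs[j := n]) = 0" if "j < length vs" for j
    using that by (intro alternating_mem[OF Cons.prems]) (simp add: set_update_memI)
  have "\<alpha> ((v + c v *\<^sub>R n) # ?m) = \<alpha> (v # ?m) + c v * \<alpha> (n # ?m)"
    using alternating_linear_hd[OF Cons.prems, of ?m] by (simp add: linear_iff)
  then show ?case
    by (simp add: IH 0 sum.lessThan_Suc_shift del: sum.lessThan_Suc)
qed simp

lemma orthonormal_list_iff: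
  "orthonormal_list k es \<longleftrightarrow> length es = k \<and> distinct es \<and>
     (\<forall>x\<in>set es. \<forall>y\<in>set es. x \<bullet> y = (if x = y then 1 else 0))"
proof (intro iffI conjI ballI)
  assume "length es = k \<and> distinct es \<and>
     (\<forall>x\<in>set es. \<forall>y\<in>set es. x \<bullet> y = (if x = y then 1 else 0))"
  then show "orthonormal_list k es"
    by (auto simp: orthonormal_list_def nth_eq_iff_index_eq)
qed (auto simp: orthonormal_list_distinct orthonormal_list_inner, auto simp: orthonormal_list_def)

lemma orthonormal_list_mset:
  assumes "orthonormal_list k es" "mset es = mset fs" shows "orthonormal_list k fs"
  using assms mset_eq_setD[OF assms(2)] mset_eq_length[OF assms(2)] mset_eq_imp_distinct_iff[OF assms(2)]
  unfolding orthonormal_list_iff by simp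

lemma orthonormal_list_map:
  assumes "orthonormal_list k es" "\<And>x y. f x \<bullet> f y = x \<bullet> y" shows "orthonormal_list k (map f es)"
  using assms by (simp add: orthonormal_list_def)

text \<open>Of the components of \<open>x\<close> along the frame, only the one along
  \<open>es ! j\<close> survives; any other repeats an entry.\<close>

lemma alternating_update:
  fixes \<alpha> :: "('n::finite, real) form"
  assumes "alternating k \<alpha>" "orthonormal_list k es" "j < length es" "x \<in> span (set es)"
  shows "\<alpha> (es[j := x]) = (es ! j \<bullet> x) * \<alpha> es"
proof (rule linear_eq_on_span[where f = "\<lambda>x. \<alpha> (es[j := x])" and B = "set es"])
  show "linear (\<lambda>x. \<alpha> (es[j := x]))"
    using alternating_linear[OF assms(1)] assms(3) by (simp add: upd_conv_take_nth_drop)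
  show "linear (\<lambda>x. (es ! j \<bullet> x) * \<alpha> es)"
    by (simp add: linear_iff inner_add_right algebra_simps)
  fix e assume "e \<in> set es"
  then obtain i where i: "i < length es" "e = es ! i" by (auto simp: in_set_conv_nth)
  show "\<alpha> (es[j := e]) = (es ! j \<bullet> e) * \<alpha> es"
  proof (cases "i = j")
    case True
    then show ?thesis using i assms(2) by (simp add: orthonormal_list_def)
  next
    case False
    then have "es[j := e] ! i = es[j := e] ! j" using i assms(3) by simp
    then have "\<not> distinct (es[j := e])"
      using False i assms(3) by (metis length_list_update nth_eq_iff_index_eq)
    then have "\<alpha> (es[j := e]) = 0" by (rule alternating_not_distinct[OF assms(1)])
    moreover have "es ! j \<bullet> e = 0" using False i assms(2,3) by (simp add: orthonormal_list_def)
    ultimately show ?thesis by simp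
  qed
qed (fact assms(4))

lemma sum_inner_squared:
  assumes "orthonormal_list k es" "x \<in> span (set es)"
  shows "(\<Sum>j<length es. (es ! j \<bullet> x)\<^sup>2) = x \<bullet> x"
proof -
  have "(\<Sum>j<length es. (es ! j \<bullet> x)\<^sup>2) = (\<Sum>e\<in>set es. (e \<bullet> x)\<^sup>2)"
    using sum_list_distinct_conv_sum_set[OF orthonormal_list_distinct[OF assms(1)], of "\<lambda>e. (e \<bullet> x)\<^sup>2"]
    by (simp add: sum_list_sum_nth atLeast0LessThan)
  also have "\<dots> = proj es x \<bullet> x" by (simp add: proj_def inner_sum_left power2_eq_square)
  finally show ?thesis by (simp add: proj_id[OF assms])
qed

lemma span_orthonormal_list_UNIV:
  fixes es :: "(real ^ 'n::finite) list"
  assumes "orthonormal_list CARD('n) es" shows "span (set es) = UNIV"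
proof -
  have "independent (set es)"
  proof (rule pairwise_orthogonal_independent)
    show "pairwise orthogonal (set es)"
      using orthonormal_list_inner[OF assms] by (auto simp: pairwise_def orthogonal_def)
    show "0 \<notin> set es" using orthonormal_list_inner[OF assms, of 0 0] by auto
  qed
  moreover have "card (set es) = CARD('n)"
    using assms orthonormal_list_distinct[OF assms] by (simp add: distinct_card orthonormal_list_def)
  ultimately have "dim (set es) = DIM(real ^ 'n)" by (simp add: dim_eq_card_independent)
  then show ?thesis using dim_eq_full by blast
qed

text \<open>The reflection in the hyperplane normal to \<open>e - u\<close> carries \<open>e\<close>
  to \<open>u\<close> and the rest of the frame to \<open>fs\<close>. It has determinant -1 on the
  span, so the form changes by a sign only. The case \<open>u = e\<close> is separate because the
  normal is then zero.\<close>

lemma orthonormal_list_householder: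
  fixes u :: "real ^ 'n::finite"
  assumes E: "orthonormal_list k (e # es)" and u: "u \<in> span (set (e # es))" "u \<bullet> u = 1"
  obtains fs where "orthonormal_list k (u # fs)" "set fs \<subseteq> span (set (e # es))"
    "\<And>\<alpha> :: ('n, real) form. alternating k \<alpha> \<Longrightarrow> \<bar>\<alpha> (u # fs)\<bar> = \<bar>\<alpha> (e # es)\<bar>"
proof (cases "u = e")
  case True
  show ?thesis by (rule that[of es]) (use E True in \<open>auto intro: span_base\<close>)
next
  case False
  define d where "d = e - u"
  define c where "c x = - (2 * (x \<bullet> d) / (d \<bullet> d))" for x
  define H where "H x = x + c x *\<^sub>R d" for x
  have dd: "d \<bullet> d \<noteq> 0" using False by (simp add: d_def)
  have ee: "e \<bullet> e = 1" using E by (simp add: orthonormal_list_Cons)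
  have "d \<bullet> d = 2 * (e \<bullet> d)"
    by (simp add: d_def inner_diff_left inner_diff_right ee u inner_commute)
  then have He: "H e = u" using dd by (simp add: H_def c_def d_def)
  have "H x \<bullet> H y = x \<bullet> y" for x y
  proof -
    have "H x \<bullet> H y = x \<bullet> y + c y * (x \<bullet> d) + c x * (y \<bullet> d) + c x * c y * (d \<bullet> d)"
      by (simp add: H_def inner_add_left inner_add_right inner_commute)
    then show ?thesis using dd by (simp add: c_def field_simps)
  qed
  then have o: "orthonormal_list k (map H (e # es))" by (rule orthonormal_list_map[OF E])
  have dspan: "d \<in> span (set (e # es))"
    unfolding d_def by (rule span_diff[OF span_base u(1)]) simp
  show ?thesis
  proof (rule that[of "map H es"])
    show "orthonormal_list k (u # map H es)" using o by (simp add: He)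
    show "set (map H es) \<subseteq> span (set (e # es))"
      unfolding H_def using dspan by (auto intro!: span_add span_scale intro: span_base)
    fix \<alpha> :: "('n, real) form"
    assume \<alpha>: "alternating k \<alpha>"
    let ?E = "e # es"
    have "\<alpha> (u # map H es) = \<alpha> (map (\<lambda>x. x + c x *\<^sub>R d) ?E)"
      by (simp add: He[symmetric] H_def[abs_def])
    also have "\<dots> = \<alpha> ?E + (\<Sum>j<length ?E. c (?E ! j) * \<alpha> (?E[j := d]))"
      by (rule alternating_map_add_scaled[OF \<alpha>])
    \<comment> \<open>The coefficients sum to -2 by Parseval for \<open>d\<close>, which turns the
      value of the form at \<open>?E\<close> into its negative.\<close>
    also have "(\<Sum>j<length ?E. c (?E ! j) * \<alpha> (?E[j := d]))
        = (\<Sum>j<length ?E. (?E ! j \<bullet> d)\<^sup>2 * (- 2 * \<alpha> ?E / (d \<bullet> d)))"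
      by (intro sum.cong refl)
         (simp only: lessThan_iff alternating_update[OF \<alpha> E _ dspan] c_def, simp add: power2_eq_square)
    also have "\<dots> = (d \<bullet> d) * (- 2 * \<alpha> ?E / (d \<bullet> d))"
      unfolding sum_distrib_right[symmetric] sum_inner_squared[OF E dspan] ..
    finally show "\<bar>\<alpha> (u # map H es)\<bar> = \<bar>\<alpha> ?E\<bar>" using dd by simp
  qed
qed

section \<open>The complex structure\<close>

definition J :: "real ^ ('m + 'm) \<Rightarrow> real ^ ('m::finite + 'm)" where
  "J v = (\<chi> i. case i of Inl j \<Rightarrow> - v $ Inr j | Inr j \<Rightarrow> v $ Inl j)"

lemma J_nth [simp]: "J v $ Inl j = - v $ Inr j" "J v $ Inr j = v $ Inl j"
  by (simp_all add: J_def)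

lemma sum_UNIV_Plus: "(\<Sum>i\<in>(UNIV :: ('a::finite + 'b::finite) set). f i) = (\<Sum>i\<in>UNIV. f (Inl i)) + (\<Sum>i\<in>UNIV. f (Inr i))"
  by (simp add: UNIV_Plus_UNIV[symmetric] sum.Plus del: UNIV_Plus_UNIV)

lemma inner_Plus:
  "x \<bullet> y = (\<Sum>j\<in>UNIV. x $ Inl j * y $ Inl j) + (\<Sum>j\<in>UNIV. x $ Inr j * (y :: real ^ ('m::finite + 'm)) $ Inr j)"
  by (simp add: inner_vec_def sum_UNIV_Plus)

lemma vec_eq_Plus: "x = y \<longleftrightarrow> (\<forall>j. x $ Inl j = y $ Inl j \<and> x $ Inr j = (y :: 'a ^ ('m::finite + 'm)) $ Inr j)"
  unfolding vec_eq_iff by (metis sum.exhaust)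

lemma linear_J: "linear J"
  by (rule linearI) (simp_all add: vec_eq_Plus)

lemma J_J [simp]: "J (J x) = - x"
  by (simp add: vec_eq_Plus)

lemma J_inner: "J x \<bullet> y = - (x \<bullet> J y)"
  by (simp add: inner_Plus sum_negf)

lemma J_isometry [simp]: "J x \<bullet> J y = x \<bullet> y"
  by (simp add: J_inner)

lemma inner_J_self: "x \<bullet> J x = 0"
  using J_inner[of x x] by (simp add: inner_commute)

lemma J_axis: "J (axis (Inl j) 1) = axis (Inr j) 1"
  by (simp add: vec_eq_Plus axis_def)

lemma dx_single: "dx [i] [v] = v $ i" "homogeneous 1 (dx [i])"
proof -
  show "dx [i] [v] = v $ i"
    by (simp add: dx_def wedge_list_def wedge_one_form_Cons unit_form_def inner_axis')
  show "homogeneous 1 (dx [i])"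
    using alternating_homogeneous[OF alternating_dx[of "[i]"]] by simp
qed

lemma sum_form_apply: "(\<Sum>i\<in>I. \<alpha> i) vs = (\<Sum>i\<in>I. \<alpha> i vs)" for \<alpha> :: "'i \<Rightarrow> ('n, 'c::comm_monoid_add) form"
  by (induction I rule: infinite_finite_induct) auto

lemma alternating_kaehler_form: "alternating 2 (kaehler_form :: ('m::finite + 'm, real) form)"
proof -
  have "alternating (1 + 1) (dx [i] \<^bold>\<and> dx [j])" for i j :: "'m + 'm"
    using alternating_dx[of "[i]"] alternating_dx[of "[j]"] by (intro alternating_wedge) simp_all
  then have "alternating 2 (dx [Inl j] \<^bold>\<and> dx [Inr j :: 'm + 'm])" for j by (metis one_add_one)
  then have "alternating 2 (\<lambda>vs. \<Sum>j\<in>UNIV. (dx [Inl j] \<^bold>\<and> dx [Inr j :: 'm + 'm]) vs)"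
    by (rule alternating_sum)
  then show ?thesis by (simp add: kaehler_form_def sum_form_apply[abs_def])
qed

lemma kaehler_form_apply: "kaehler_form [v, w] = J v \<bullet> w"
proof -
  have "dx [i] [] = 0" for i :: "'a + 'a"
    using dx_single(2)[of i] by (simp add: homogeneous_def)
  then have "(dx [Inl j] \<^bold>\<and> dx [Inr j]) [v, w] = v $ Inl j * w $ Inr j - v $ Inr j * w $ Inl j" for j :: 'a
    by (simp add: wedge_one_form_Cons[OF dx_single(2)] dx_single(1))
  then show ?thesis
    by (simp add: kaehler_form_def sum_form_apply inner_Plus sum_subtractf sum_negf)
qed

lemma contract_kaehler_form: "contract v kaehler_form = covector (J v)"
proof
  fix vs
  show "kaehler_form (v # vs) = covector (J v) vs"
    using alternating_length[OF alternating_kaehler_form, of "v # vs"]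
    by (cases vs rule: list.exhaust[case_product list.exhaust])
       (auto simp: kaehler_form_apply covector_def split: list.splits)
qed

lemma kaehler_calibration_0: "kaehler_calibration 0 = unit_form"
  by (simp add: kaehler_calibration_def wedge_power_def wedge_list_def)

text \<open>The factor \<open>Suc p\<close> from \<open>wedge_power_Cons\<close> turns the factorial
  of \<open>Suc p\<close> into that of \<open>p\<close>. This recursion carries the induction for
  Wirtinger's inequality.\<close>

lemma kaehler_calibration_Cons:
  fixes v :: "real ^ ('m::finite + 'm)"
  shows "kaehler_calibration (Suc p) (v # vs) = (covector (J v) \<^bold>\<and> kaehler_calibration p) vs"
proof -
  have "(kaehler_calibration p :: ('m + 'm, real) form)
      = (\<lambda>vs. inverse (fact p) * wedge_power kaehler_form p vs)"
    by (simp add: kaehler_calibration_def divide_inverse mult.commute)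
  then have "(covector (J v) \<^bold>\<and> kaehler_calibration p) vs
      = inverse (fact p) * (covector (J v) \<^bold>\<and> wedge_power kaehler_form p) vs"
    by (simp add: wedge_scale_right)
  then show ?thesis
    unfolding kaehler_calibration_def wedge_power_Cons[OF alternating_homogeneous[OF alternating_kaehler_form]]
      contract_kaehler_form
    by (simp add: field_simps del: of_nat_Suc)
qed

lemma alternating_kaehler_calibration:
  "alternating (2 * p) (kaehler_calibration p :: ('m::finite + 'm, real) form)"
proof -
  have "alternating (2 * length (replicate p (kaehler_form :: ('m + 'm, real) form)))
    (wedge_power (kaehler_form :: ('m + 'm, real) form) p)"
    unfolding wedge_power_def
    by (rule alternating_wedge_list) (simp add: alternating_kaehler_form)
  then show ?thesis
    using alternating_scale[of "2 * p" "wedge_power (kaehler_form :: ('m + 'm, real) form) p" "inverse (fact p)"]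
    by (simp add: kaehler_calibration_def[abs_def] divide_inverse mult.commute)
qed

section \<open>Wirtinger's inequality\<close>

text \<open>On the remaining vectors only the projection \<xi> of \<open>J e\<close> onto their span
  is felt. In a frame \<open>u # fs\<close> of that span with \<open>u\<close> along \<xi>, the
  value factors as \<open>J e \<bullet> u\<close> times the lower calibration at \<open>fs\<close>,
  and both factors are at most 1 in absolute value.\<close>

lemma wirtinger_step:
  fixes e :: "real ^ ('m::finite + 'm)"
  assumes IH: "\<And>fs :: (real ^ ('m + 'm)) list. orthonormal_list (2 * p) fs \<Longrightarrow> \<bar>kaehler_calibration p fs\<bar> \<le> 1"
    and E: "orthonormal_list (2 * Suc p) (e # es)"
  shows "\<bar>kaehler_calibration (Suc p) (e # es)\<bar> \<le> 1 \<and>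
    (\<bar>kaehler_calibration (Suc p) (e # es)\<bar> = 1 \<longrightarrow> J e \<in> span (set (e # es)))"
proof -
  have es: "orthonormal_list (Suc (2 * p)) es" and ee: "e \<bullet> e = 1" "\<And>x. x \<in> set es \<Longrightarrow> e \<bullet> x = 0"
    using E by (auto simp: orthonormal_list_Cons)
  define \<xi> where "\<xi> = proj es (J e)"
  have \<xi>: "J e \<bullet> x = \<xi> \<bullet> x" if "x \<in> span (set es)" for x
    using proj_id[OF es that] by (metis \<xi>_def proj_inner)
  have val: "kaehler_calibration (Suc p) (e # es) = (covector (J e) \<^bold>\<and> kaehler_calibration p) es"
    by (rule kaehler_calibration_Cons)
  show ?thesis
  proof (cases "\<xi> = 0")
    case True
    have "kaehler_calibration (Suc p) (e # es) = 0"
      unfolding val by (rule wedge_one_form_vanish) (use True \<xi> in \<open>auto intro: span_base\<close>)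
    then show ?thesis by simp
  next
    case False
    define u where "u = \<xi> /\<^sub>R norm \<xi>"
    have uu: "u \<bullet> u = 1" using False by (simp add: u_def dot_square_norm power2_eq_square)
    have u: "u \<in> span (set es)"
      unfolding u_def \<xi>_def by (intro span_scale proj_in_span)
    obtain e' es' where e': "es = e' # es'"
      using es by (cases es) (auto simp: orthonormal_list_def)
    obtain fs where fs: "orthonormal_list (Suc (2 * p)) (u # fs)" "set fs \<subseteq> span (set es)"
      and \<alpha>: "\<And>\<alpha> :: ('m + 'm, real) form. alternating (Suc (2 * p)) \<alpha> \<Longrightarrow> \<bar>\<alpha> (u # fs)\<bar> = \<bar>\<alpha> es\<bar>"
      using orthonormal_list_householder[OF es[unfolded e'] u[unfolded e'] uu] unfolding e' by metis
    have "alternating (Suc (2 * p)) (contract e (kaehler_calibration (Suc p)))"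
      using alternating_contract[OF alternating_kaehler_calibration[of "Suc p"], of e] by simp
    from \<alpha>[OF this] have "\<bar>kaehler_calibration (Suc p) (e # es)\<bar> = \<bar>kaehler_calibration (Suc p) (e # u # fs)\<bar>"
      by simp
    also have "kaehler_calibration (Suc p) (e # u # fs) = (J e \<bullet> u) * kaehler_calibration p fs"
    proof -
      have "J e \<bullet> f = 0" if "f \<in> set fs" for f
      proof -
        have "u \<bullet> f = 0" using fs(1) that by (simp add: orthonormal_list_Cons)
        then have "\<xi> \<bullet> f = 0" using False by (simp add: u_def)
        then show ?thesis using \<xi> that fs(2) by auto
      qed
      then show ?thesis
        unfolding kaehler_calibration_Cons
        by (simp add: wedge_one_form_Cons wedge_one_form_vanish)
    qed
    finally have v: "\<bar>kaehler_calibration (Suc p) (e # es)\<bar> = \<bar>J e \<bullet> u\<bar> * \<bar>kaehler_calibration p fs\<bar>"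
      by (simp add: abs_mult)
    have "orthonormal_list (2 * p) fs" using fs(1) by (simp add: orthonormal_list_Cons)
    then have b2: "\<bar>kaehler_calibration p fs\<bar> \<le> 1" by (rule IH)
    have b1: "\<bar>J e \<bullet> u\<bar> \<le> 1"
      using Cauchy_Schwarz_ineq2[of "J e" u] by (simp add: norm_eq_sqrt_inner ee uu)
    have "J e \<in> span (set (e # es))" if "\<bar>kaehler_calibration (Suc p) (e # es)\<bar> = 1"
    proof -
      \<comment> \<open>Equality forces the first factor to be 1 in absolute value, so the unit
        vectors \<open>J e\<close> and \<open>u\<close> agree up to sign.\<close>
      have "\<bar>J e \<bullet> u\<bar> * \<bar>kaehler_calibration p fs\<bar> \<le> \<bar>J e \<bullet> u\<bar> * 1"
        using b2 by (intro mult_left_mono) auto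
      then have "\<bar>J e \<bullet> u\<bar> = 1" using that v b1 by linarith
      then have sq: "(J e \<bullet> u) * (J e \<bullet> u) = 1" using abs_mult_self_eq[of "J e \<bullet> u"] by simp
      have "(J e - (J e \<bullet> u) *\<^sub>R u) \<bullet> (J e - (J e \<bullet> u) *\<^sub>R u) = 0"
        using sq by (simp add: inner_diff_left inner_diff_right ee uu inner_commute[of u "J e"])
      then have "J e = (J e \<bullet> u) *\<^sub>R u" by simp
      also have "\<dots> \<in> span (set (e # es))"
        using u span_mono[of "set es" "set (e # es)"] by (intro span_scale) auto
      finally show ?thesis .
    qed
    then show ?thesis
      using mult_le_one[OF b1 abs_ge_zero b2] v by auto
  qed
qed

lemma wirtinger_inequality:
  "orthonormal_list (2 * p) es \<Longrightarrow> \<bar>kaehler_calibration p es\<bar> \<le> 1"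
proof (induction p arbitrary: es)
  case 0
  then show ?case by (simp add: kaehler_calibration_0 unit_form_def)
next
  case (Suc p)
  then obtain e es' where "es = e # es'" by (cases es) (auto simp: orthonormal_list_def)
  then show ?case using wirtinger_step[OF Suc.IH] Suc.prems by blast
qed

text \<open>Any frame vector can be moved to the front at the cost of a sign, so
  \<open>wirtinger_step\<close> applies to each of them.\<close>

lemma wirtinger_equality:
  assumes es: "orthonormal_list (2 * p) es" and eq: "kaehler_calibration p es = 1" and "x \<in> span (set es)"
  shows "J x \<in> span (set es)"
proof -
  have "J e \<in> span (set es)" if e: "e \<in> set es" for e
  proof -
    obtain as bs where es': "es = as @ e # bs" using e by (meson split_list)
    then obtain q where p: "p = Suc q" using es by (cases p) (auto simp: orthonormal_list_def)
    have m: "mset es = mset (e # as @ bs)" by (simp add: es')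
    then have "orthonormal_list (2 * Suc q) (e # as @ bs)"
      using orthonormal_list_mset[OF es m] by (simp add: p)
    moreover have "\<bar>kaehler_calibration (Suc q) (e # as @ bs)\<bar> = 1"
      using alternating_perm[OF alternating_kaehler_calibration[of p] m] eq by (auto simp: p)
    ultimately have "J e \<in> span (set (e # as @ bs))"
      using wirtinger_step[OF wirtinger_inequality] by blast
    also have "set (e # as @ bs) = set es" by (auto simp: es')
    finally show ?thesis .
  qed
  then have "J ` set es \<subseteq> span (set es)" by auto
  then have "J ` span (set es) \<subseteq> span (set es)"
    by (metis linear_J linear_span_image span_minimal subspace_span)
  then show ?thesis using assms(3) by blast
qed

text \<open>Since \<open>J\<close> is skew, the complement of a \<open>J\<close>-invariant plane is
  also \<open>J\<close>-invariant, so the projection commutes with \<open>J\<close>.\<close>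

lemma reflection_J_commute:
  assumes es: "orthonormal_list k es" and J: "\<And>x. x \<in> span (set es) \<Longrightarrow> J x \<in> span (set es)"
  shows "reflection es (J x) = J (reflection es x)"
proof -
  define b where "b = x - proj es x"
  have b: "e \<bullet> b = 0" if "e \<in> set es" for e
    using inner_proj[OF es that] by (simp add: b_def inner_diff_right)
  have "e \<bullet> J b = 0" if "e \<in> set es" for e
  proof -
    have "J e \<in> span (set es)" using J that by (simp add: span_base)
    moreover have "b \<in> (span (set es))\<^sup>\<bottom>" using b by (simp add: orthogonal_comp_span_iff)
    ultimately have "J e \<bullet> b = 0" by (auto simp: orthogonal_comp_def orthogonal_def)
    then show ?thesis by (simp add: J_inner)
  qed
  then have "proj es (J b) = 0" by (rule proj_0)
  then have "proj es (J x) = J (proj es x)"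
    by (simp add: b_def proj_id[OF es J[OF proj_in_span]] linear_diff[OF linear_J] linear_diff[OF linear_proj])
  then show ?thesis
    by (simp add: reflection_def linear_diff[OF linear_J] linear_cmul[OF linear_J])
qed

lemma kaehler_form_map:
  fixes f :: "real ^ ('m::finite + 'm) \<Rightarrow> real ^ ('m + 'm)"
  assumes "\<And>x y. J (f x) \<bullet> f y = c * (J x \<bullet> y)"
  shows "kaehler_form (map f vs) = c * kaehler_form vs"
proof (cases "length vs = 2")
  case True
  then obtain v w where "vs = [v, w]" by (auto simp: numeral_2_eq_2 length_Suc_conv)
  then show ?thesis by (simp add: kaehler_form_apply assms)
next
  case False
  then show ?thesis by (simp add: alternating_length[OF alternating_kaehler_form])
qed

lemma complex_plane_exists:
  fixes js :: "'m::finite list"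
  assumes "distinct js"
  defines "bs \<equiv> concat (map (\<lambda>j. [axis (Inl j) 1, axis (Inr j) 1 :: real ^ ('m + 'm)]) js)"
  shows "orthonormal_list (2 * length js) bs" "kaehler_calibration (length js) bs = 1"
proof -
  have "orthonormal_list (2 * length js) bs \<and> kaehler_calibration (length js) bs = 1"
    unfolding bs_def using assms(1)
  proof (induction js)
    case Nil
    then show ?case by (simp add: kaehler_calibration_0 unit_form_def)
  next
    case (Cons j js)
    have o: "axis (Inl j) 1 \<bullet> x = 0 \<and> axis (Inr j) 1 \<bullet> x = 0"
      if "x \<in> set (concat (map (\<lambda>j. [axis (Inl j) 1, axis (Inr j) 1 :: real ^ ('m + 'm)]) js))" for x
      using that Cons.prems by (auto simp: inner_axis_axis)
    have len: "length (concat (map (\<lambda>j. [axis (Inl j) 1, axis (Inr j) 1 :: real ^ ('m + 'm)]) js)) = 2 * length js"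
      by (induction js) auto
    have "(covector (axis (Inr j) 1) \<^bold>\<and> \<beta>) (concat (map (\<lambda>j. [axis (Inl j) 1, axis (Inr j) 1]) js)) = 0"
      for \<beta> :: "('m + 'm, real) form"
      by (rule wedge_one_form_vanish) (use o in auto)
    then show ?case
      using Cons o len
      by (simp add: orthonormal_list_Cons inner_axis_axis kaehler_calibration_Cons J_axis wedge_one_form_Cons)
  qed
  then show "orthonormal_list (2 * length js) bs" "kaehler_calibration (length js) bs = 1" by auto
qed

theorem compliant_kaehler:
  assumes "p \<le> CARD('m::finite)"
  shows "compliant (2 * p) (kaehler_calibration p :: ('m + 'm, real) form) U_group"
proof -
  obtain js :: "'m list" where "set js = UNIV" "distinct js"
    using finite_distinct_list[of "UNIV :: 'm set"] by auto
  then have js: "distinct (take p js)" "length (take p js) = p"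
    using assms distinct_card[of js] by auto
  show ?thesis
    unfolding U_group_def
  proof (rule compliantI)
    show "alternating (2 * p) (kaehler_calibration p :: ('m + 'm, real) form)"
      by (rule alternating_kaehler_calibration)
    show "kaehler_calibration p es \<le> 1" if "orthonormal_list (2 * p) es" for es :: "(real ^ ('m + 'm)) list"
      using wirtinger_inequality[OF that] by simp
    show "\<forall>\<beta>\<in>{kaehler_form :: ('m + 'm, real) form}. \<exists>k. alternating k \<beta>"
      using alternating_kaehler_form by blast
    fix es :: "(real ^ ('m + 'm)) list" and \<beta> :: "('m + 'm, real) form"
    assume es: "orthonormal_list (2 * p) es" "kaehler_calibration p es = 1" and \<beta>: "\<beta> \<in> {kaehler_form}"
    have "J (reflection es x) \<bullet> reflection es y = 1 * (J x \<bullet> y)" for x y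
      using reflection_J_commute[OF es(1) wirtinger_equality[OF es], of x] reflection_isometry[OF es(1)]
      by (metis mult_1)
    from kaehler_form_map[OF this] \<beta>
    show "(\<forall>vs. \<beta> (map (reflection es) vs) = \<beta> vs) \<or> (\<forall>vs. \<beta> (map (reflection es) vs) = - \<beta> vs)"
      by simp
  qed (use complex_plane_exists[OF js(1)] js(2) in auto)
qed

section \<open>The complex volume form\<close>

text \<open>Complex linearity in the first argument; alternation spreads it to all arguments.
  Alternating forms with this property are those of type (k,0).\<close>

definition J_linear :: "('m::finite + 'm, complex) form \<Rightarrow> bool" where
  "J_linear \<alpha> \<longleftrightarrow> (\<forall>v vs. \<alpha> (J v # vs) = \<i> * \<alpha> (v # vs))"

lemma J_linear_contract:
  assumes "alternating k \<alpha>" "J_linear \<alpha>" shows "J_linear (contract w \<alpha>)"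
  unfolding J_linear_def
proof (intro allI)
  fix v vs
  have "\<alpha> (w # J v # vs) = - (\<i> * \<alpha> (v # w # vs))"
    using alternating_swap[OF assms(1), of w "J v" vs] assms(2) by (simp add: J_linear_def)
  also have "\<alpha> (v # w # vs) = - \<alpha> (w # v # vs)"
    by (rule alternating_swap[OF assms(1)])
  finally show "\<alpha> (w # J v # vs) = \<i> * \<alpha> (w # v # vs)" by simp
qed

lemma J_linear_append:
  assumes "alternating k \<alpha>" "J_linear \<alpha>" shows "\<alpha> (us @ J v # vs) = \<i> * \<alpha> (us @ v # vs)"
  using assms
proof (induction us arbitrary: k \<alpha>)
  case Nil
  then show ?case by (simp add: J_linear_def)
next
  case (Cons u us)
  show ?case
    using Cons.IH[OF alternating_contract[OF Cons.prems(1)] J_linear_contract[OF Cons.prems, of u]] by simp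
qed

lemma J_linear_eq_0_span:
  assumes "alternating k \<alpha>" "J_linear \<alpha>" "\<And>vs. set vs \<subseteq> B \<Longrightarrow> \<alpha> vs = 0" "set vs \<subseteq> span (B \<union> J ` B)"
  shows "\<alpha> vs = 0"
  using assms
proof (induction vs arbitrary: k \<alpha>)
  case (Cons v vs)
  have B: "\<alpha> (b # vs) = 0" if "b \<in> B" for b
  proof -
    have "contract b \<alpha> vs = 0"
      by (rule Cons.IH[OF alternating_contract[OF Cons.prems(1)] J_linear_contract[OF Cons.prems(1,2)]])
         (use that Cons.prems in auto)
    then show ?thesis by simp
  qed
  have "\<alpha> (b # vs) = 0" if "b \<in> B \<union> J ` B" for b
    using that B Cons.prems(2) by (auto simp: J_linear_def)
  then show ?case
    using linear_eq_0_on_span[OF alternating_linear_hd[OF Cons.prems(1)], of "B \<union> J ` B" vs v] Cons.prems(4)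
    by auto
qed auto

lemma orthonormal_list_append_J:
  assumes "orthonormal_list k es" "\<And>x y. x \<in> set es \<Longrightarrow> y \<in> set es \<Longrightarrow> x \<bullet> J y = 0"
  shows "orthonormal_list (k + k) (es @ map J es)"
proof -
  have inj: "inj J" by (rule injI) (metis J_J minus_equation_iff)
  have "x \<noteq> J y" if "x \<in> set es" "y \<in> set es" for x y
    using assms(2)[OF that] orthonormal_list_inner[OF assms(1) that(1,1)] by auto
  moreover have "J x \<bullet> y = 0" if "x \<in> set es" "y \<in> set es" for x y
    using assms(2)[OF that] by (simp add: J_inner)
  ultimately show ?thesis
    using assms inj unfolding orthonormal_list_iff
    by (auto simp: distinct_map inj_eq inj_on_subset[OF inj])
qed

lemma span_J_UNIV:
  fixes es :: "(real ^ ('m::finite + 'm)) list"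
  assumes "orthonormal_list CARD('m) es" "\<And>x y. x \<in> set es \<Longrightarrow> y \<in> set es \<Longrightarrow> x \<bullet> J y = 0"
  shows "span (set es \<union> J ` set es) = UNIV"
proof -
  have "orthonormal_list CARD('m + 'm) (es @ map J es)"
    using orthonormal_list_append_J[OF assms] by simp
  from span_orthonormal_list_UNIV[OF this] show ?thesis by simp
qed

text \<open>Forms of type (m,0) make up a complex line and \<open>es\<close> is a unitary basis, so
  one value determines the form. Identities for \<Upsilon> are checked at a single frame this
  way.\<close>

lemma J_linear_eq_0:
  fixes es :: "(real ^ ('m::finite + 'm)) list"
  assumes "orthonormal_list CARD('m) es" "\<And>x y. x \<in> set es \<Longrightarrow> y \<in> set es \<Longrightarrow> x \<bullet> J y = 0"
    and "alternating CARD('m) \<alpha>" "J_linear \<alpha>" "\<alpha> es = 0"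
  shows "\<alpha> vs = 0"
proof (rule J_linear_eq_0_span[OF assms(3,4)])
  have len: "length es = CARD('m)" using assms(1) by (simp add: orthonormal_list_def)
  show "\<alpha> ws = 0" if "set ws \<subseteq> set es" for ws
    using alternating_eq_0_list[of es \<alpha> ws] assms(3,5) orthonormal_list_distinct[OF assms(1)] that
    by (simp add: len)
  show "set vs \<subseteq> span (set es \<union> J ` set es)" by (simp add: span_J_UNIV[OF assms(1,2)])
qed

lemma alternating_dz: "alternating 1 (dz j)"
proof -
  have d: "alternating 1 (dx [i])" for i :: "'a + 'a"
    using alternating_dx[of "[i]"] by simp
  have l: "linear complex_of_real" by (rule linearI) (simp_all add: scaleR_conv_of_real)
  show ?thesis
    unfolding dz_def
    by (intro alternating_add alternating_scale alternating_linear_image[OF d l])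
qed

lemma dz_apply: "dz j [v] = Complex (v $ Inl j) (v $ Inr j)"
  by (simp add: dz_def dx_single(1) complex_eq_iff)

lemma homogeneous_dz: "homogeneous 1 (dz j)"
  by (rule alternating_homogeneous[OF alternating_dz])

lemma wedge_list_Cons: "wedge_list (\<alpha> # \<alpha>s) = \<alpha> \<^bold>\<and> wedge_list \<alpha>s"
  by (simp add: wedge_list_def)

lemma J_linear_wedge_dz: "J_linear (wedge_list (map dz js))"
proof (induction js)
  case Nil
  then show ?case by (simp add: J_linear_def wedge_list_def unit_form_def)
next
  case (Cons j js)
  let ?\<beta> = "wedge_list (map dz js)"
  have "contract (J v) ?\<beta> = (\<lambda>vs. \<i> * ?\<beta> (v # vs))" for v
    using Cons by (simp add: J_linear_def)
  then have "(dz j \<^bold>\<and> ?\<beta>) (J v # vs) = \<i> * (dz j \<^bold>\<and> ?\<beta>) (v # vs)" for v vs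
  proof -
    assume "\<And>v. contract (J v) ?\<beta> = (\<lambda>vs. \<i> * ?\<beta> (v # vs))"
    then have "(dz j \<^bold>\<and> contract (J v) ?\<beta>) vs = \<i> * (dz j \<^bold>\<and> contract v ?\<beta>) vs"
      by (simp only: wedge_scale_right)
    moreover have "dz j [J v] = \<i> * dz j [v]" by (simp add: dz_apply complex_eq_iff)
    ultimately show ?thesis
      by (simp add: wedge_one_form_Cons[OF homogeneous_dz] right_diff_distrib)
  qed
  then show ?case by (simp add: J_linear_def wedge_list_Cons)
qed

lemma alternating_wedge_dz: "alternating (length js) (wedge_list (map dz js))"
proof -
  have "alternating (1 * length (map dz js)) (wedge_list (map dz js))"
    by (rule alternating_wedge_list) (auto simp only: set_map alternating_dz)
  then show ?thesis by simp
qed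

lemma wedge_dz_axis:
  assumes "distinct js"
  shows "wedge_list (map dz js) (map (\<lambda>j. axis (Inl j) 1) js) = 1"
  using assms
proof (induction js)
  case Nil
  then show ?case by (simp add: wedge_list_def unit_form_def)
next
  case (Cons j js)
  have "(dz j \<^bold>\<and> \<beta>) (map (\<lambda>j. axis (Inl j) 1) js) = 0" for \<beta>
    by (rule wedge_one_form_vanish[OF homogeneous_dz])
       (use Cons.prems in \<open>auto simp: dz_apply axis_def complex_eq_iff\<close>)
  moreover have "dz j [axis (Inl j) 1] = 1" by (simp add: dz_apply axis_def complex_eq_iff)
  ultimately show ?case
    using Cons by (simp add: wedge_list_Cons wedge_one_form_Cons[OF homogeneous_dz])
qed

abbreviation (input) index_list :: "'m::{finite,linorder} list" where
  "index_list \<equiv> sorted_list_of_set UNIV"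

lemma length_index_list: "length (index_list :: 'm list) = CARD('m::{finite,linorder})"
  by (simp add: length_sorted_list_of_set)

lemma alternating_Upsilon: "alternating CARD('m) (Upsilon :: ('m::{finite,linorder} + 'm, complex) form)"
  using alternating_wedge_dz[of "index_list :: 'm list"] by (simp add: Upsilon_def length_index_list)

lemma J_linear_Upsilon: "J_linear Upsilon"
  unfolding Upsilon_def by (rule J_linear_wedge_dz)

lemma Upsilon_J: "Upsilon (J v # vs) = \<i> * Upsilon (v # vs)"
  using J_linear_Upsilon unfolding J_linear_def by blast

definition x_axes :: "(real ^ ('m::{finite,linorder} + 'm)) list" where
  "x_axes = map (\<lambda>j. axis (Inl j) 1) (sorted_list_of_set UNIV)"

lemma Upsilon_x_axes: "Upsilon x_axes = 1"
  unfolding Upsilon_def x_axes_def by (rule wedge_dz_axis) simp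

lemma orthonormal_x_axes: "orthonormal_list CARD('m) (x_axes :: (real ^ ('m::{finite,linorder} + 'm)) list)"
  unfolding orthonormal_list_iff x_axes_def
  by (auto simp: length_index_list distinct_map inj_on_def axis_eq_axis inner_axis_axis)

lemma x_axes_J: "x \<in> set x_axes \<Longrightarrow> y \<in> set x_axes \<Longrightarrow> x \<bullet> J y = 0"
  by (auto simp: x_axes_def J_axis inner_axis_axis)

section \<open>The special Lagrangian inequality\<close>

text \<open>The vector \<open>w\<close> representing \<open>f\<close> has length at most
  \<open>M\<close>, as seen by testing \<open>f\<close> on \<open>w\<close>. Equality in
  Cauchy-Schwarz at \<open>v\<close> then gives \<open>w = M *\<^sub>R v\<close>.\<close>

lemma linear_functional_maximum:
  fixes f :: "real ^ 'n::finite \<Rightarrow> real"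
  assumes f: "linear f" "\<And>x. f x \<le> M * norm x" and v: "norm v = 1" "f v = M"
  shows "f x = M * (v \<bullet> x)"
proof -
  define w where "w = (\<chi> i. f (axis i 1))"
  have w: "f x = w \<bullet> x" for x
    using linear_coordinates[OF f(1), of x] by (simp add: w_def inner_vec_def mult.commute)
  \<comment> \<open>The bound at \<open>- v\<close> reads \<open>- M \<le> M\<close>.\<close>
  have M: "M \<ge> 0" using f(2)[of "- v"] v linear_neg[OF f(1), of v] by simp
  have vv: "v \<bullet> v = 1" using v(1) by (simp add: norm_eq_1)
  have "norm w * norm w \<le> M * norm w"
    using f(2)[of w] by (simp add: w dot_square_norm power2_eq_square)
  then have "norm w \<le> M" using M by (cases "norm w = 0") auto
  then have "w \<bullet> w \<le> M * M"
    using M by (simp add: dot_square_norm power2_eq_square mult_mono)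
  moreover have "(w - M *\<^sub>R v) \<bullet> (w - M *\<^sub>R v) = w \<bullet> w - M * M"
    using v(2) by (simp add: inner_diff_left inner_diff_right w inner_commute[of v w] vv)
  ultimately have "(w - M *\<^sub>R v) \<bullet> (w - M *\<^sub>R v) \<le> 0" by simp
  then have "w = M *\<^sub>R v" by (metis inner_gt_zero_iff not_less right_minus_eq)
  then show ?thesis by (simp add: w)
qed

lemma alternating_Re_Upsilon:
  "alternating CARD('m) (Re_form (Upsilon :: ('m::{finite,linorder} + 'm, complex) form))"
  unfolding Re_form_def
  by (rule alternating_linear_image[OF alternating_Upsilon]) (simp add: bounded_linear_Re bounded_linear.linear)

lemma alternating_Im_Upsilon:
  "alternating CARD('m) (Im_form (Upsilon :: ('m::{finite,linorder} + 'm, complex) form))"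
  unfolding Im_form_def
  by (rule alternating_linear_image[OF alternating_Upsilon]) (simp add: bounded_linear_Im bounded_linear.linear)

text \<open>At a maximum of \<open>Re \<Upsilon>\<close> the functional obtained by varying one argument is a multiple of
  the inner product with that argument.\<close>

lemma Upsilon_maximum:
  fixes vs :: "(real ^ ('m::{finite,linorder} + 'm)) list"
  assumes len: "length vs = CARD('m)" and unit: "\<And>v. v \<in> set vs \<Longrightarrow> norm v = 1"
    and M: "Re (Upsilon vs) = M" "M > 0"
    and max: "\<And>ws :: (real ^ ('m + 'm)) list. length ws = CARD('m) \<Longrightarrow> (\<And>w. w \<in> set ws \<Longrightarrow> norm w = 1)
      \<Longrightarrow> Re (Upsilon ws) \<le> M"
  shows "orthonormal_list CARD('m) vs" "\<And>x y. x \<in> set vs \<Longrightarrow> y \<in> set vs \<Longrightarrow> x \<bullet> J y = 0"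
    "Upsilon vs = of_real M"
proof -
  let ?R = "\<lambda>i x. Re (Upsilon (vs[i := x]))"
  have lin: "linear (?R i)" if "i < CARD('m)" for i
    using alternating_linear[OF alternating_Re_Upsilon] that len
    by (simp add: upd_conv_take_nth_drop Re_form_def)
  have crit: "?R i x = M * (vs ! i \<bullet> x)" if i: "i < CARD('m)" for i x
  proof (rule linear_functional_maximum[OF lin[OF i]])
    show "norm (vs ! i) = 1" using unit i len by simp
    show "?R i (vs ! i) = M" using M by simp
    fix x
    show "?R i x \<le> M * norm x"
    proof (cases "x = 0")
      case True
      then show ?thesis using linear_0[OF lin[OF i]] by simp
    next
      case False
      have "Re (Upsilon (vs[i := x /\<^sub>R norm x])) \<le> M"
      proof (rule max)
        fix w assume "w \<in> set (vs[i := x /\<^sub>R norm x])"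
        then have "w = x /\<^sub>R norm x \<or> w \<in> set vs" using set_update_subset_insert by fast
        then show "norm w = 1" using False unit by auto
      qed (simp add: len)
      then show ?thesis
        using False by (simp add: linear_cmul[OF lin[OF i]] field_simps)
    qed
  qed
  \<comment> \<open>The critical equation at \<open>J x\<close>, read with Re (i z) = - Im z,
    controls the imaginary part.\<close>
  have Jcrit: "M * (vs ! i \<bullet> J x) = - Im (Upsilon (vs[i := x]))" if i: "i < CARD('m)" for i x
  proof -
    have "Upsilon (vs[i := J x]) = \<i> * Upsilon (vs[i := x])"
      using J_linear_append[OF alternating_Upsilon J_linear_Upsilon] i len by (simp add: upd_conv_take_nth_drop)
    then show ?thesis using crit[OF i, of "J x"] by simp
  qed
  have rep: "Upsilon (vs[i := vs ! j]) = 0" if "i < CARD('m)" "j < CARD('m)" "i \<noteq> j" for i j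
  proof (rule alternating_not_distinct[OF alternating_Upsilon])
    have "vs[i := vs ! j] ! i = vs[i := vs ! j] ! j" using that len by simp
    then show "\<not> distinct (vs[i := vs ! j])"
      using that len by (metis length_list_update nth_eq_iff_index_eq)
  qed
  \<comment> \<open>Inserting another frame vector kills the whole complex value: its real part
    gives orthogonality, its imaginary part through \<open>Jcrit\<close> the Lagrangian
    condition.\<close>
  have orth: "vs ! i \<bullet> vs ! j = 0" if "i < CARD('m)" "j < CARD('m)" "i \<noteq> j" for i j
    using crit[OF that(1), of "vs ! j"] rep[OF that] M(2) by simp
  then show "orthonormal_list CARD('m) vs"
    using unit len by (auto simp: orthonormal_list_def norm_eq_1)
  have lag: "vs ! i \<bullet> J (vs ! j) = 0" if "i < CARD('m)" "j < CARD('m)" for i j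
  proof (cases "i = j")
    case True
    then show ?thesis by (simp add: inner_J_self)
  next
    case False
    then show ?thesis using Jcrit[OF that(1), of "vs ! j"] rep[OF that] M(2) by simp
  qed
  show "x \<bullet> J y = 0" if "x \<in> set vs" "y \<in> set vs" for x y
    using that len lag by (auto simp: in_set_conv_nth)
  \<comment> \<open>Putting \<open>vs ! 0\<close> back into position 0 changes nothing, and every
    vector is orthogonal to its image under \<open>J\<close>.\<close>
  have "Im (Upsilon vs) = 0"
    using Jcrit[of 0 "vs ! 0"] by (simp add: inner_J_self)
  then show "Upsilon vs = of_real M"
    by (intro complex_eqI) (simp_all only: M(1) Re_complex_of_real Im_complex_of_real)
qed

text \<open>Frames are encoded as vectors of vectors, so that a maximizing frame can be found by
  compactness of a product of spheres.\<close>

lemma alternating_continuous: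
  fixes \<alpha> :: "('n::finite, real) form"
  assumes "alternating k \<alpha>"
  shows "continuous_on UNIV (\<lambda>X :: (real ^ 'n) ^ 'k::finite. \<alpha> (map (\<lambda>j. X $ j) js))"
  using assms
proof (induction js arbitrary: k \<alpha>)
  case (Cons j js)
  have "\<alpha> (map (\<lambda>j. X $ j) (j # js)) = (\<Sum>i\<in>UNIV. X $ j $ i * \<alpha> (axis i 1 # map (\<lambda>j. X $ j) js))" for X :: "(real ^ 'n) ^ 'k"
    unfolding list.map by (rule linear_coordinates[OF alternating_linear_hd[OF Cons.prems]])
  moreover have "continuous_on UNIV (\<lambda>X. \<Sum>i\<in>UNIV. X $ j $ i * \<alpha> (axis i 1 # map (\<lambda>j. X $ j) js))"
    by (intro continuous_on_sum continuous_on_mult Cons.IH[OF alternating_contract[OF Cons.prems]]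
        continuous_on_component continuous_on_id)
  ultimately show ?case by (simp only:)
qed simp

text \<open>If \<open>X\<close> maximises \<open>Re \<Upsilon>\<close> then it is a unitary frame, and the unitary map \<open>U\<close> with
  columns \<open>X\<close> satisfies \<open>\<Upsilon> (U ws) = M \<Upsilon> ws\<close>.  Evaluating at \<open>ws = X\<close> gives \<open>M\<^sup>2 \<le> M\<close>.\<close>

lemma Re_Upsilon_le_1:
  fixes ws :: "(real ^ ('m::{finite,linorder} + 'm)) list"
  assumes "length ws = CARD('m)" "\<And>w. w \<in> set ws \<Longrightarrow> norm w = 1"
  shows "Re (Upsilon ws) \<le> 1"
proof -
  define frame where "frame X = map (\<lambda>j. X $ j) (sorted_list_of_set UNIV)"
    for X :: "(real ^ ('m + 'm), 'm) vec"
  have len: "length (frame X) = CARD('m)" for X by (simp add: frame_def length_index_list)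
  \<comment> \<open>No orthogonality is imposed, so that each vector can be varied independently
    over its sphere; orthonormality of a maximizer is a consequence.\<close>
  define K where "K = {X :: (real ^ ('m + 'm), 'm) vec. \<forall>j. norm (X $ j) = 1}"
  have K: "X \<in> K \<longleftrightarrow> (\<forall>v\<in>set (frame X). norm v = 1)" for X
    by (simp add: K_def frame_def)
  have "closed K"
    unfolding K_def by (intro closed_Collect_all closed_Collect_eq continuous_intros)
  moreover have "bounded K"
    unfolding bounded_iff
  proof (intro exI ballI)
    fix X assume "X \<in> K"
    then have "(\<Sum>j\<in>UNIV. norm (X $ j)) = real CARD('m)" by (simp add: K_def)
    then show "norm X \<le> real CARD('m)" using L2_set_le_sum[of UNIV "\<lambda>j. norm (X $ j)"] by (simp add: norm_vec_def)
  qed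
  ultimately have "compact K" by (simp add: compact_eq_bounded_closed)
  have surj: "\<exists>X\<in>K. frame X = ws" if "length ws = CARD('m)" "\<forall>w\<in>set ws. norm w = 1"
    for ws :: "(real ^ ('m + 'm)) list"
  proof -
    define X :: "(real ^ ('m + 'm), 'm) vec" where
      "X = (\<chi> j. the (map_of (zip (sorted_list_of_set UNIV) ws) j))"
    have "frame X = ws"
    proof (rule nth_equalityI)
      fix i assume "i < length (frame X)"
      then show "frame X ! i = ws ! i"
        using that(1) map_of_zip_nth[of "sorted_list_of_set (UNIV :: 'm set)" ws i]
        by (simp add: frame_def X_def length_index_list)
    qed (simp add: len that(1))
    then show ?thesis using K that(2) by blast
  qed
  have "x_axes = frame (\<chi> j. axis (Inl j) 1)" by (simp add: x_axes_def frame_def)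
  then have axes: "(\<chi> j. axis (Inl j) 1) \<in> K" by (simp add: K_def norm_axis_1)
  have "continuous_on K (\<lambda>X. Re (Upsilon (frame X)))"
    using alternating_continuous[OF alternating_Re_Upsilon, of "sorted_list_of_set (UNIV :: 'm set)"]
    unfolding frame_def Re_form_def by (rule continuous_on_subset) simp
  then obtain X where X: "X \<in> K" and max: "\<And>Y. Y \<in> K \<Longrightarrow> Re (Upsilon (frame Y)) \<le> Re (Upsilon (frame X))"
    using continuous_attains_sup[OF \<open>compact K\<close>] axes by blast
  define M where "M = Re (Upsilon (frame X))"
  have maxM: "Re (Upsilon vs) \<le> M" if "length vs = CARD('m)" "\<And>w. w \<in> set vs \<Longrightarrow> norm w = 1"
    for vs :: "(real ^ ('m + 'm)) list"
    using surj[of vs] that max unfolding M_def by blast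
  have "Re (Upsilon (x_axes :: (real ^ ('m + 'm)) list)) \<le> M"
    using max[OF axes] \<open>x_axes = frame (\<chi> j. axis (Inl j) 1)\<close> by (simp add: M_def)
  then have M1: "M \<ge> 1" by (simp add: Upsilon_x_axes)
  have norm: "norm v = 1" if "v \<in> set (frame X)" for v using X K that by blast
  note unitary = Upsilon_maximum[OF len norm M_def[symmetric] _ maxM]
  have on: "orthonormal_list CARD('m) (frame X)" by (rule unitary(1)) (use M1 in auto)
  have JX: "X $ i \<bullet> J (X $ j) = 0" for i j
    by (rule unitary(2)) (use M1 in \<open>auto simp: frame_def\<close>)
  have UpsX: "Upsilon (frame X) = of_real M" by (rule unitary(3)) (use M1 in auto)
  have XX: "X $ i \<bullet> X $ j = (if i = j then 1 else 0)" for i j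
  proof -
    have "distinct (map (\<lambda>j. X $ j) (sorted_list_of_set UNIV))"
      using orthonormal_list_distinct[OF on] by (simp add: frame_def)
    then have "inj (\<lambda>j. X $ j)" by (simp add: distinct_map)
    then show ?thesis
      using orthonormal_list_inner[OF on, of "X $ i" "X $ j"] by (simp add: frame_def inj_eq)
  qed
  \<comment> \<open>The complex linear map taking the \<open>j\<close>-th x-axis to
    \<open>X $ j\<close>; the relations \<open>XX\<close> and \<open>JX\<close> make it preserve
    norms.\<close>
  define U where "U w = (\<Sum>j\<in>UNIV. w $ Inl j *\<^sub>R X $ j) + (\<Sum>j\<in>UNIV. w $ Inr j *\<^sub>R J (X $ j))" for w
  have linU: "linear U"
    unfolding U_def by (rule linearI) (simp_all add: scaleR_add_left sum.distrib scaleR_sum_right algebra_simps)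
  have JU: "U (J w) = J (U w)" for w
    by (simp add: U_def linear_add[OF linear_J] linear_sum[OF linear_J] linear_cmul[OF linear_J] sum_negf)
  have U_norm: "U w \<bullet> U w = w \<bullet> w" for w
  proof -
    have JX': "J (X $ i) \<bullet> X $ j = 0" for i j using JX[of j i] by (simp add: inner_commute)
    show ?thesis
      unfolding U_def inner_Plus[of w w]
      by (simp add: inner_add_left inner_add_right inner_sum_left inner_sum_right JX JX' XX
          if_distrib[of "\<lambda>c. _ * c"] cong: if_cong)
  qed
  have "Upsilon (map U ws) = of_real M * Upsilon ws" for ws
  proof -
    have "Upsilon (map U ws) - of_real M * Upsilon ws = 0"
    \<comment> \<open>Both sides have type (m,0), so comparison at the x-axes suffices.\<close>
    proof (rule J_linear_eq_0[OF orthonormal_x_axes x_axes_J])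
      show "alternating CARD('m) (\<lambda>ws. Upsilon (map U ws) - of_real M * Upsilon ws)"
        by (intro alternating_diff alternating_map[OF alternating_Upsilon linU] alternating_scale alternating_Upsilon)
      show "J_linear (\<lambda>ws. Upsilon (map U ws) - of_real M * Upsilon ws)"
        by (simp add: J_linear_def JU Upsilon_J algebra_simps)
      have "U (axis (Inl j) 1) = X $ j" for j
        by (simp add: U_def axis_def if_distrib[of "\<lambda>c. c *\<^sub>R _"] cong: if_cong)
      then have "map U x_axes = frame X" by (simp add: x_axes_def frame_def)
      then show "Upsilon (map U x_axes) - of_real M * Upsilon x_axes = 0"
        by (simp add: UpsX Upsilon_x_axes)
    qed
    then show ?thesis by simp
  qed
  then have "Re (Upsilon (map U (frame X))) = M * M" by (simp add: UpsX)
  moreover have "Re (Upsilon (map U (frame X))) \<le> M"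
    using norm U_norm by (intro maxM) (auto simp: len norm_eq_sqrt_inner)
  ultimately have "M \<le> 1" using M1 by simp
  then show ?thesis using maxM[OF assms] by simp
qed

lemma orthonormal_list_norm: "orthonormal_list k es \<Longrightarrow> e \<in> set es \<Longrightarrow> norm e = 1"
  using orthonormal_list_inner[of k es e e] by (simp add: norm_eq_1)

theorem compliant_special_Lagrangian:
  "compliant CARD('m::{finite,linorder}) (Re_form (Upsilon :: ('m + 'm, complex) form)) SU_group"
  unfolding SU_group_def
proof (rule compliantI[OF alternating_Re_Upsilon])
  show le: "Re_form Upsilon es \<le> 1" if "orthonormal_list CARD('m) es" for es :: "(real ^ ('m + 'm)) list"
    unfolding Re_form_def
    by (rule Re_Upsilon_le_1) (use that orthonormal_list_norm[OF that] in \<open>auto simp: orthonormal_list_def\<close>)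
  show "orthonormal_list CARD('m) (x_axes :: (real ^ ('m + 'm)) list)" by (rule orthonormal_x_axes)
  show "Re_form Upsilon (x_axes :: (real ^ ('m + 'm)) list) = 1" by (simp add: Re_form_def Upsilon_x_axes)
  show "\<forall>\<beta>\<in>{kaehler_form, Re_form Upsilon, Im_form Upsilon :: ('m + 'm, real) form}. \<exists>k. alternating k \<beta>"
    using alternating_kaehler_form alternating_Re_Upsilon alternating_Im_Upsilon by blast
  fix es :: "(real ^ ('m + 'm)) list" and \<beta> :: "('m + 'm, real) form"
  assume es: "orthonormal_list CARD('m) es" "Re_form Upsilon es = 1"
    and \<beta>: "\<beta> \<in> {kaehler_form, Re_form Upsilon, Im_form Upsilon}"
  have len: "length es = CARD('m)" using es(1) by (simp add: orthonormal_list_def)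
  have "Re (Upsilon es) = 1" using es(2) by (simp add: Re_form_def)
  \<comment> \<open>With \<open>M = 1\<close> the inequality says that a calibrated frame is a
    maximizer, so the first-order analysis applies to it.\<close>
  note max = Upsilon_maximum[OF len orthonormal_list_norm[OF es(1)] this zero_less_one Re_Upsilon_le_1]
  have JW: "x \<bullet> J y = 0" if "x \<in> set es" "y \<in> set es" for x y
    by (rule max(2)) (use that in auto)
  have Ups: "Upsilon es = 1" using max(3) by simp
  have RJ: "reflection es (J x) = - J (reflection es x)" for x
  \<comment> \<open>The frame is fixed and its image under \<open>J\<close> is negated by the
    reflection; together they span the space.\<close>
  proof (rule linear_eq_on_span[where f = "\<lambda>x. reflection es (J x)" and B = "set es \<union> J ` set es"])
    show "linear (\<lambda>x. reflection es (J x))"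
      using linear_compose[OF linear_J linear_reflection] by (simp add: o_def)
    show "linear (\<lambda>x. - J (reflection es x))"
      using linear_compose_neg[OF linear_compose[OF linear_reflection linear_J]] by (simp add: o_def)
    show "x \<in> span (set es \<union> J ` set es)" by (simp add: span_J_UNIV[OF es(1) JW])
    fix x assume "x \<in> set es \<union> J ` set es"
    then obtain e where e: "e \<in> set es" "x = e \<or> x = J e" by auto
    have "reflection es e = e" using reflection_id[OF es(1)] e by (simp add: span_base)
    moreover have "reflection es (J e) = - J e" by (rule reflection_neg) (use JW e in auto)
    ultimately show "reflection es (J x) = - J (reflection es x)"
      using e(2) by (auto simp: linear_neg[OF linear_reflection] linear_neg[OF linear_J])
  qed
  have "J (reflection es x) \<bullet> reflection es y = (-1) * (J x \<bullet> y)" for x y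
    using RJ[of x] reflection_isometry[OF es(1), of "J x" y] by (simp add: minus_equation_iff)
  note \<omega> = kaehler_form_map[of "reflection es", OF this]
  have \<Upsilon>: "Upsilon (map (reflection es) vs) = cnj (Upsilon vs)" for vs
  proof -
    have lin: "linear cnj" by (simp add: bounded_linear_cnj bounded_linear.linear)
    have neg: "Upsilon (- v # vs) = - Upsilon (v # vs)" for v and vs :: "(real ^ ('m + 'm)) list"
      using linear_neg[OF alternating_linear_hd[OF alternating_Upsilon], of v] by simp
    \<comment> \<open>The pullback of \<Upsilon> is conjugate linear for \<open>J\<close>.
      Conjugating its values restores \<open>J\<close>-linearity, so comparison at \<open>es\<close>
      suffices.\<close>
    have "cnj (Upsilon (map (reflection es) vs)) - Upsilon vs = 0"
    proof (rule J_linear_eq_0[OF es(1) JW])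
      show "alternating CARD('m) (\<lambda>vs. cnj (Upsilon (map (reflection es) vs)) - Upsilon vs)"
        by (intro alternating_diff alternating_linear_image[OF _ lin] alternating_map[OF alternating_Upsilon]
            linear_reflection alternating_Upsilon)
      show "J_linear (\<lambda>vs. cnj (Upsilon (map (reflection es) vs)) - Upsilon vs)"
        by (simp add: J_linear_def RJ neg Upsilon_J algebra_simps)
      have "map (reflection es) es = es"
        using reflection_id[OF es(1)] by (intro map_idI) (simp add: span_base)
      then show "cnj (Upsilon (map (reflection es) es)) - Upsilon es = 0" by (simp add: Ups)
    qed
    then show ?thesis by (metis complex_cnj_cnj right_minus_eq)
  qed
  show "(\<forall>vs. \<beta> (map (reflection es) vs) = \<beta> vs) \<or> (\<forall>vs. \<beta> (map (reflection es) vs) = - \<beta> vs)"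
    using \<beta> \<omega> \<Upsilon> by (auto simp: Re_form_def Im_form_def)
qed

section \<open>Evaluation of wedge products of one-forms\<close>

lemma wedge_one_form_2:
  assumes "homogeneous 1 \<alpha>"
  shows "(\<alpha> \<^bold>\<and> \<beta>) [x, y] = \<alpha> [x] * \<beta> [y] - \<alpha> [y] * \<beta> [x]"
  using assms by (simp add: wedge_one_form_Cons[OF assms]) (simp add: homogeneous_def)

lemma wedge_one_form_3:
  assumes "homogeneous 1 \<alpha>"
  shows "(\<alpha> \<^bold>\<and> \<beta>) [x, y, z] = \<alpha> [x] * \<beta> [y, z] - \<alpha> [y] * \<beta> [x, z] + \<alpha> [z] * \<beta> [x, y]"
  by (subst wedge_one_form_Cons[OF assms]) (simp add: wedge_one_form_2[OF assms])

lemma wedge_one_form_4: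
  assumes "homogeneous 1 \<alpha>"
  shows "(\<alpha> \<^bold>\<and> \<beta>) [x, y, z, w] = \<alpha> [x] * \<beta> [y, z, w] - \<alpha> [y] * \<beta> [x, z, w]
      + \<alpha> [z] * \<beta> [x, y, w] - \<alpha> [w] * \<beta> [x, y, z]"
  by (subst wedge_one_form_Cons[OF assms]) (simp add: wedge_one_form_3[OF assms])

lemma wedge_unit_form_right:
  assumes "homogeneous 1 \<alpha>" shows "(\<alpha> \<^bold>\<and> unit_form) vs = \<alpha> vs"
proof (cases vs)
  case Nil
  then show ?thesis using assms by (simp add: homogeneous_def)
next
  case (Cons v ws)
  have "contract v unit_form = (\<lambda>vs. 0)" by (simp add: unit_form_def)
  then show ?thesis using assms
    by (auto simp: Cons wedge_one_form_Cons[OF assms] unit_form_def homogeneous_def)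
qed

text \<open>Rewrites a product starting with \<open>dx [i, j]\<close> as iterated products with
  one-forms, which the expansion rules \<open>wedge_dx\<close> evaluate.\<close>

lemma wedge_one_forms_assoc:
  assumes "alternating 1 \<alpha>" "alternating 1 \<beta>"
  shows "((\<alpha> \<^bold>\<and> \<beta>) \<^bold>\<and> \<gamma>) vs = (\<alpha> \<^bold>\<and> (\<beta> \<^bold>\<and> \<gamma>)) vs"
proof (induction vs arbitrary: \<gamma>)
  case Nil
  then show ?case by simp
next
  case (Cons v vs)
  note h\<alpha> = alternating_homogeneous[OF assms(1)] and h\<beta> = alternating_homogeneous[OF assms(2)]
  have h: "homogeneous (1 + 1) (\<alpha> \<^bold>\<and> \<beta>)"
    by (intro alternating_homogeneous alternating_wedge assms)
  have "contract v \<beta> = (\<lambda>vs. \<beta> [v] * unit_form vs)"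
    using h\<beta> by (auto simp: fun_eq_iff unit_form_def homogeneous_def)
  then have "contract v (\<alpha> \<^bold>\<and> \<beta>) = (\<lambda>ws. \<alpha> [v] * \<beta> ws - \<beta> [v] * \<alpha> ws)"
    by (simp add: wedge_one_form_Cons[OF h\<alpha>] wedge_scale_right wedge_unit_form_right[OF h\<alpha>])
  moreover have "((\<lambda>ws. \<alpha> [v] * \<beta> ws - \<beta> [v] * \<alpha> ws) \<^bold>\<and> \<gamma>) vs = \<alpha> [v] * (\<beta> \<^bold>\<and> \<gamma>) vs - \<beta> [v] * (\<alpha> \<^bold>\<and> \<gamma>) vs"
    using wedge_add_left[of "\<lambda>ws. \<alpha> [v] * \<beta> ws" "\<lambda>ws. - \<beta> [v] * \<alpha> ws" \<gamma> vs]
    unfolding wedge_scale_left by simp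
  ultimately show ?case
    by (simp add: wedge_Cons[OF h] wedge_one_form_Cons[OF h\<alpha>] wedge_one_form_Cons[OF h\<beta>]
        wedge_diff_right wedge_scale_right Cons)
qed

lemma dx_Cons: "dx (i # js) = dx [i] \<^bold>\<and> dx js"
proof -
  have "dx [i] = covector (axis i 1)"
    using wedge_unit_form_right[of "covector (axis i 1)"] by (simp add: dx_def wedge_list_def fun_eq_iff)
  then show ?thesis by (simp add: dx_def wedge_list_def)
qed

lemma dx_2_wedge: "(dx [i, j] \<^bold>\<and> \<gamma>) vs = (dx [i] \<^bold>\<and> (dx [j] \<^bold>\<and> \<gamma>)) vs"
  unfolding dx_Cons[of i "[j]"]
  by (rule wedge_one_forms_assoc) (use alternating_dx[of "[i]"] alternating_dx[of "[j]"] in simp_all)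

lemmas wedge_dx = wedge_one_form_2[OF dx_single(2)] wedge_one_form_3[OF dx_single(2)] wedge_one_form_4[OF dx_single(2)]

lemma dx_apply_2: "dx [i, j] [x, y] = x $ i * y $ j - y $ i * x $ j"
  by (simp add: dx_Cons[of i "[j]"] wedge_dx dx_single(1))

lemma dx_apply_3: "dx [i, j, k] [x, y, z] =
    x $ i * dx [j, k] [y, z] - y $ i * dx [j, k] [x, z] + z $ i * dx [j, k] [x, y]"
  by (simp add: dx_Cons[of i "[j, k]"] wedge_dx dx_single(1))

lemma dx_apply_4: "dx [i, j, k, l] [x, y, z, w] =
    x $ i * dx [j, k, l] [y, z, w] - y $ i * dx [j, k, l] [x, z, w]
      + z $ i * dx [j, k, l] [x, y, w] - w $ i * dx [j, k, l] [x, y, z]"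
  by (simp add: dx_Cons[of i "[j, k, l]"] wedge_dx dx_single(1))

lemmas dx_apply = dx_single(1) dx_apply_2 dx_apply_3 dx_apply_4

lemma alternating_plus: "alternating k \<alpha> \<Longrightarrow> alternating k \<beta> \<Longrightarrow> alternating k (\<alpha> + \<beta>)"
  unfolding plus_fun_def by (rule alternating_add)

lemma alternating_minus: "alternating k \<alpha> \<Longrightarrow> alternating k \<beta> \<Longrightarrow> alternating k (\<alpha> - \<beta>)"
  unfolding fun_diff_def by (rule alternating_diff)

lemma alternating_dx_wedge:
  "alternating l \<beta> \<Longrightarrow> length js + l = k \<Longrightarrow> alternating k (dx js \<^bold>\<and> \<beta>)"
  using alternating_wedge[OF alternating_dx] by blast

lemma alternating_dx': "length js = k \<Longrightarrow> alternating k (dx js)"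
  using alternating_dx by blast

lemma alternating_phi_form: "alternating 3 phi_form"
  unfolding phi_form_def
  by (intro alternating_minus alternating_dx_wedge[of 2] alternating_plus alternating_dx') simp_all

lemma alternating_psi_form: "alternating 4 psi_form"
  unfolding psi_form_def
  by (intro alternating_minus alternating_dx_wedge[of 2] alternating_plus alternating_dx') simp_all

lemma alternating_cayley_form: "alternating 4 cayley_form"
  unfolding cayley_form_def
  by (intro alternating_plus alternating_dx_wedge[OF alternating_phi_form] alternating_psi_form) simp

lemma phi_form_apply: "phi_form [x, y, z] =
    dx [1,2,3] [x, y, z]
    - (x $ 1 * (dx [4,5] [y, z] + dx [6,7] [y, z]) - y $ 1 * (dx [4,5] [x, z] + dx [6,7] [x, z]) + z $ 1 * (dx [4,5] [x, y] + dx [6,7] [x, y]))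
    - (x $ 2 * (dx [4,6] [y, z] + dx [7,5] [y, z]) - y $ 2 * (dx [4,6] [x, z] + dx [7,5] [x, z]) + z $ 2 * (dx [4,6] [x, y] + dx [7,5] [x, y]))
    - (x $ 3 * (dx [4,7] [y, z] + dx [5,6] [y, z]) - y $ 3 * (dx [4,7] [x, z] + dx [5,6] [x, z]) + z $ 3 * (dx [4,7] [x, y] + dx [5,6] [x, y]))"
  unfolding phi_form_def by (simp only: wedge_dx dx_single(1) minus_apply plus_fun_apply)

lemma dx_2_wedge_apply: "(dx [i, j] \<^bold>\<and> \<beta>) [x, y, z, w] =
    dx [i, j] [x, y] * \<beta> [z, w] - dx [i, j] [x, z] * \<beta> [y, w] + dx [i, j] [x, w] * \<beta> [y, z]
    + dx [i, j] [y, z] * \<beta> [x, w] - dx [i, j] [y, w] * \<beta> [x, z] + dx [i, j] [z, w] * \<beta> [x, y]"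
  unfolding dx_2_wedge by (simp add: wedge_dx dx_apply) algebra

lemma psi_form_apply: "psi_form [x, y, z, w] = dx [4,5,6,7] [x, y, z, w]
    - (dx [2,3] \<^bold>\<and> (dx [4,5] + dx [6,7])) [x, y, z, w]
    - (dx [3,1] \<^bold>\<and> (dx [4,6] + dx [7,5])) [x, y, z, w]
    - (dx [1,2] \<^bold>\<and> (dx [4,7] + dx [5,6])) [x, y, z, w]"
  unfolding psi_form_def by (simp only: minus_apply)

lemma cayley_form_apply: "cayley_form [x, y, z, w] =
    x $ 0 * phi_form [y, z, w] - y $ 0 * phi_form [x, z, w] + z $ 0 * phi_form [x, y, w] - w $ 0 * phi_form [x, y, z]
    + psi_form [x, y, z, w]"
  unfolding cayley_form_def by (simp only: plus_fun_apply wedge_dx dx_single(1))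

section \<open>Octonions and the Cayley form\<close>

lemma exhaust_8: "x = 0 \<or> x = 1 \<or> x = 2 \<or> x = 3 \<or> x = 4 \<or> x = 5 \<or> x = 6 \<or> x = (7 :: 8)"
proof (induction x)
  case (of_int z)
  then have "0 \<le> z" "z < 8" by simp_all
  then have "z = 0 \<or> z = 1 \<or> z = 2 \<or> z = 3 \<or> z = 4 \<or> z = 5 \<or> z = 6 \<or> z = 7" by arith
  then show ?case by auto
qed

lemma exhaust_7: "x = 1 \<or> x = 2 \<or> x = 3 \<or> x = 4 \<or> x = 5 \<or> x = 6 \<or> x = (7 :: 7)"
proof (induction x)
  case (of_int z)
  then have "0 \<le> z" "z < 7" by simp_all
  \<comment> \<open>The representative 0 is the label \<open>7\<close>.\<close>
  then have "z = 0 \<or> z = 1 \<or> z = 2 \<or> z = 3 \<or> z = 4 \<or> z = 5 \<or> z = 6" by arith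
  then show ?case by auto
qed

lemma UNIV_8: "(UNIV :: 8 set) = {0, 1, 2, 3, 4, 5, 6, 7}"
  using exhaust_8 by blast

lemma UNIV_7: "(UNIV :: 7 set) = {1, 2, 3, 4, 5, 6, 7}"
  using exhaust_7 by blast

lemma sum_8: "sum f (UNIV :: 8 set) = f 0 + f 1 + f 2 + f 3 + f 4 + f 5 + f 6 + f 7"
  unfolding UNIV_8 by (simp add: add.assoc)

lemma sum_7: "sum f (UNIV :: 7 set) = f 1 + f 2 + f 3 + f 4 + f 5 + f 6 + f 7"
  unfolding UNIV_7 by (simp add: add.assoc)

lemma forall_8: "(\<forall>i::8. P i) \<longleftrightarrow> P 0 \<and> P 1 \<and> P 2 \<and> P 3 \<and> P 4 \<and> P 5 \<and> P 6 \<and> P 7"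
  using exhaust_8 by metis

lemma inner_8: "x \<bullet> y = x $ 0 * y $ 0 + x $ 1 * y $ 1 + x $ 2 * y $ 2 + x $ 3 * y $ 3
    + x $ 4 * y $ 4 + x $ 5 * y $ 5 + x $ 6 * y $ 6 + x $ 7 * (y :: real ^ 8) $ 7"
  by (simp add: inner_vec_def sum_8)

lemma inner_7: "x \<bullet> y = x $ 1 * y $ 1 + x $ 2 * y $ 2 + x $ 3 * y $ 3
    + x $ 4 * y $ 4 + x $ 5 * y $ 5 + x $ 6 * y $ 6 + x $ 7 * (y :: real ^ 7) $ 7"
  by (simp add: inner_vec_def sum_7)

definition vec8 :: "real \<Rightarrow> real \<Rightarrow> real \<Rightarrow> real \<Rightarrow> real \<Rightarrow> real \<Rightarrow> real \<Rightarrow> real \<Rightarrow> real ^ 8" where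
  "vec8 a b c d e f g h = (\<chi> i. if i = 0 then a else if i = 1 then b else if i = 2 then c
     else if i = 3 then d else if i = 4 then e else if i = 5 then f else if i = 6 then g else h)"

lemma vec8_nth [simp]: "vec8 a b c d e f g h $ 0 = a" "vec8 a b c d e f g h $ 1 = b"
  "vec8 a b c d e f g h $ 2 = c" "vec8 a b c d e f g h $ 3 = d" "vec8 a b c d e f g h $ 4 = e"
  "vec8 a b c d e f g h $ 5 = f" "vec8 a b c d e f g h $ 6 = g" "vec8 a b c d e f g h $ 7 = h"
  by (simp_all add: vec8_def)

text \<open>The sign of the imaginary product is chosen opposite to the cross product of \<open>\<phi>\<close>, so that
  \<open>\<Phi>(x, y, z, w) = \<langle>x (y\<^sup>* z), w\<rangle>\<close> for orthogonal \<open>x, y, z\<close>.\<close>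

definition oct_mult :: "real ^ 8 \<Rightarrow> real ^ 8 \<Rightarrow> real ^ 8" where
  "oct_mult x y = vec8
    (x $ 0 * y $ 0 - x $ 1 * y $ 1 - x $ 2 * y $ 2 - x $ 3 * y $ 3 - x $ 4 * y $ 4 - x $ 5 * y $ 5 - x $ 6 * y $ 6 - x $ 7 * y $ 7)
    (x $ 0 * y $ 1 + x $ 1 * y $ 0 - x $ 2 * y $ 3 + x $ 3 * y $ 2 + x $ 4 * y $ 5 - x $ 5 * y $ 4 + x $ 6 * y $ 7 - x $ 7 * y $ 6)
    (x $ 0 * y $ 2 + x $ 1 * y $ 3 + x $ 2 * y $ 0 - x $ 3 * y $ 1 + x $ 4 * y $ 6 - x $ 5 * y $ 7 - x $ 6 * y $ 4 + x $ 7 * y $ 5)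
    (x $ 0 * y $ 3 - x $ 1 * y $ 2 + x $ 2 * y $ 1 + x $ 3 * y $ 0 + x $ 4 * y $ 7 + x $ 5 * y $ 6 - x $ 6 * y $ 5 - x $ 7 * y $ 4)
    (x $ 0 * y $ 4 - x $ 1 * y $ 5 - x $ 2 * y $ 6 - x $ 3 * y $ 7 + x $ 4 * y $ 0 + x $ 5 * y $ 1 + x $ 6 * y $ 2 + x $ 7 * y $ 3)
    (x $ 0 * y $ 5 + x $ 1 * y $ 4 + x $ 2 * y $ 7 - x $ 3 * y $ 6 - x $ 4 * y $ 1 + x $ 5 * y $ 0 + x $ 6 * y $ 3 - x $ 7 * y $ 2)
    (x $ 0 * y $ 6 - x $ 1 * y $ 7 + x $ 2 * y $ 4 + x $ 3 * y $ 5 - x $ 4 * y $ 2 - x $ 5 * y $ 3 + x $ 6 * y $ 0 + x $ 7 * y $ 1)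
    (x $ 0 * y $ 7 + x $ 1 * y $ 6 - x $ 2 * y $ 5 + x $ 3 * y $ 4 - x $ 4 * y $ 3 + x $ 5 * y $ 2 - x $ 6 * y $ 1 + x $ 7 * y $ 0)"

definition oct_cnj :: "real ^ 8 \<Rightarrow> real ^ 8" where
  "oct_cnj x = vec8 (x $ 0) (- x $ 1) (- x $ 2) (- x $ 3) (- x $ 4) (- x $ 5) (- x $ 6) (- x $ 7)"

text \<open>Degen's eight-square identity.\<close>

lemma oct_mult_norm: "oct_mult x y \<bullet> oct_mult x y = (x \<bullet> x) * (y \<bullet> y)"
  unfolding oct_mult_def inner_8 vec8_nth by algebra

lemma oct_cnj_norm: "oct_cnj x \<bullet> oct_cnj x = x \<bullet> x"
  unfolding oct_cnj_def inner_8 vec8_nth by simp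

section \<open>The threefold cross product on eight-dimensional space\<close>

definition triple :: "real ^ 8 \<Rightarrow> real ^ 8 \<Rightarrow> real ^ 8 \<Rightarrow> real ^ 8" where
  "triple x y z = (\<chi> k. cayley_form [x, y, z, axis k 1])"

lemma triple_inner: "triple x y z \<bullet> w = cayley_form [x, y, z, w]"
  using linear_coordinates[OF alternating_linear[OF alternating_cayley_form, of "[x, y, z]" "[]"], of w]
  by (simp add: triple_def inner_vec_def mult.commute)

text \<open>The subtracted term makes the octonion product x (y* z) alternating and vanishes on
  orthogonal arguments. In each coordinate the claim is a polynomial identity.\<close>

lemma triple_eq_oct:
  "triple x y z = oct_mult x (oct_mult (oct_cnj y) z) - ((x \<bullet> y) *\<^sub>R z + (y \<bullet> z) *\<^sub>R x - (x \<bullet> z) *\<^sub>R y)"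
  unfolding vec_eq_iff forall_8 triple_def
  by (intro conjI; simp add: cayley_form_apply phi_form_apply psi_form_apply dx_2_wedge_apply dx_apply axis_def
     oct_mult_def oct_cnj_def inner_8; algebra)

text \<open>For orthogonal arguments only the octonion product remains, and its norm is
  multiplicative. The Cayley inequality is Cauchy-Schwarz combined with this length.\<close>

lemma triple_norm:
  assumes "x \<bullet> y = 0" "x \<bullet> z = 0" "y \<bullet> z = 0"
  shows "triple x y z \<bullet> triple x y z = (x \<bullet> x) * (y \<bullet> y) * (z \<bullet> z)"
  by (simp add: triple_eq_oct assms oct_mult_norm oct_cnj_norm)

lemma cayley_form_not_distinct: "\<not> distinct vs \<Longrightarrow> cayley_form vs = 0"
  by (rule alternating_not_distinct[OF alternating_cayley_form])

lemma cayley_form_swap12: "cayley_form [x, y, z, w] = - cayley_form [y, x, z, w]"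
  by (rule alternating_swap[OF alternating_cayley_form])

lemma cayley_form_swap23: "cayley_form [x, y, z, w] = - cayley_form [x, z, y, w]"
  using alternating_swap[OF alternating_contract[OF alternating_cayley_form, of x], of y z] by simp

lemma cayley_form_swap34: "cayley_form [x, y, z, w] = - cayley_form [x, y, w, z]"
  using alternating_swap[OF alternating_contract[OF alternating_contract[OF alternating_cayley_form, of x], of y], of z w]
  by simp

lemma triple_orthogonal: "triple x y z \<bullet> x = 0" "triple x y z \<bullet> y = 0" "triple x y z \<bullet> z = 0"
  by (simp_all add: triple_inner cayley_form_not_distinct)

lemma triple_swap: "triple x y z = - triple x z y"
  using cayley_form_swap23[of x y z] by (simp add: vec_eq_iff triple_def)

text \<open>For orthonormal \<open>x, y\<close> the map \<open>triple x y\<close> is a skew isometry of the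
  complement of \<open>x, y\<close>, so it squares to \<open>-1\<close>.\<close>

lemma triple_triple:
  assumes "x \<bullet> x = 1" "y \<bullet> y = 1" "x \<bullet> y = 0" "x \<bullet> z = 0" "y \<bullet> z = 0"
  shows "triple x y (triple x y z) = - z"
proof -
  define t where "t = triple x y z"
  have tt: "t \<bullet> t = z \<bullet> z" using triple_norm[of x y z] assms by (simp add: t_def)
  have "x \<bullet> t = 0" "y \<bullet> t = 0" using triple_orthogonal[of x y z] by (simp_all add: t_def inner_commute)
  then have "triple x y t \<bullet> triple x y t = t \<bullet> t" using triple_norm[of x y t] assms by simp
  \<comment> \<open>\<open>triple x y t\<close> has the length of \<open>z\<close>, and its inner
    product with \<open>z\<close> is minus the square of that length; so their sum has length
    zero.\<close>
  moreover have "triple x y t \<bullet> z = - (t \<bullet> t)"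
    using cayley_form_swap34[of x y t z] by (simp add: triple_inner[symmetric] t_def)
  ultimately have "(triple x y t + z) \<bullet> (triple x y t + z) = 0"
    by (simp add: inner_add_left inner_add_right inner_commute[of z "triple x y t"] tt)
  then show ?thesis by (simp add: t_def eq_neg_iff_add_eq_0)
qed

lemma cayley_form_le_1:
  assumes "orthonormal_list 4 es" shows "\<bar>cayley_form es\<bar> \<le> 1"
proof -
  obtain a b c d where es: "es = [a, b, c, d]"
    using assms by (auto simp: orthonormal_list_def numeral_eq_Suc length_Suc_conv)
  then have "norm (triple a b c) = 1" "norm d = 1"
    using assms triple_norm[of a b c] by (auto simp: orthonormal_list_Cons norm_eq_1)
  then show ?thesis
    using Cauchy_Schwarz_ineq2[of "triple a b c" d] by (simp add: es triple_inner)
qed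

text \<open>The equality case of Cauchy-Schwarz for two unit vectors.\<close>

lemma triple_eq_of_calibrated:
  assumes "orthonormal_list 4 [a, b, c, d]" "\<bar>cayley_form [a, b, c, d]\<bar> = 1"
  shows "triple a b c = cayley_form [a, b, c, d] *\<^sub>R d"
proof -
  define t where "t = triple a b c"
  define r where "r = cayley_form [a, b, c, d]"
  have r: "t \<bullet> d = r" by (simp add: t_def r_def triple_inner)
  have tt: "t \<bullet> t = 1" "d \<bullet> d = 1"
    using assms(1) triple_norm[of a b c] by (auto simp: t_def orthonormal_list_Cons)
  have rr: "r * r = 1" using assms(2) abs_mult_self_eq[of r] by (simp add: r_def)
  have "(t - r *\<^sub>R d) \<bullet> (t - r *\<^sub>R d) = 0"
    by (simp add: inner_diff_left inner_diff_right tt r rr inner_commute[of d t])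
  then show ?thesis by (simp add: t_def r_def)
qed

section \<open>Components of the Cayley form relative to a calibrated plane\<close>

lemma orthonormal_list_4_cases:
  assumes "orthonormal_list 4 es" "x \<in> set es"
  obtains a b c where "mset es = mset [x, a, b, c]"
proof -
  obtain as bs where es: "es = as @ x # bs" using assms(2) by (meson split_list)
  then have "length (as @ bs) = 3" using assms(1) by (simp add: orthonormal_list_def)
  then obtain a b c where "as @ bs = [a, b, c]"
    unfolding numeral_eq_Suc pred_numeral_simps length_Suc_conv length_0_conv by auto
  then have "mset (as @ bs) = mset [a, b, c]" by simp
  then show ?thesis using es by (intro that[of a b c]) simp
qed

lemma cayley_form_perm:
  assumes "orthonormal_list 4 es" "\<bar>cayley_form es\<bar> = 1" "mset es = mset fs"
  shows "orthonormal_list 4 fs" "\<bar>cayley_form fs\<bar> = 1"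
  using orthonormal_list_mset[OF assms(1,3)] alternating_perm[OF alternating_cayley_form assms(3)] assms(2)
  by auto

text \<open>The cross product of three distinct frame vectors is plus or minus the fourth, hence
  orthogonal to every normal \<open>u\<close>.\<close>

lemma cayley_form_31:
  assumes es: "orthonormal_list 4 es" "\<bar>cayley_form es\<bar> = 1"
    and abc: "a \<in> set es" "b \<in> set es" "c \<in> set es"
    and u: "\<And>e. e \<in> set es \<Longrightarrow> e \<bullet> u = 0"
  shows "cayley_form [a, b, c, u] = 0"
proof (cases "distinct [a, b, c]")
  case False
  then show ?thesis by (intro cayley_form_not_distinct) auto
next
  case True
  obtain p q r where pqr: "mset es = mset [a, p, q, r]"
    using orthonormal_list_4_cases[OF es(1) abc(1)] by blast
  have "b \<in> {p, q, r}" "c \<in> {p, q, r}"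
    using True abc mset_eq_setD[OF pqr] by auto
  then have "\<exists>d. mset es = mset [a, b, c, d]" using True pqr by (auto simp: add_mset_commute)
  then obtain d where m: "mset es = mset [a, b, c, d]" by blast
  have "triple a b c = cayley_form [a, b, c, d] *\<^sub>R d"
    by (rule triple_eq_of_calibrated[OF cayley_form_perm[OF es m]])
  moreover have "d \<in> set es" using mset_eq_setD[OF m] by auto
  ultimately show ?thesis using u by (metis inner_scaleR_left mult_zero_right triple_inner)
qed

text \<open>Write \<open>v \<times> v'\<close> for \<open>triple w v v'\<close>.  For a unit vector \<open>u\<close> orthogonal to the Cayley plane
  spanned by \<open>w, a, b, c\<close>, the complement of the plane is spanned by \<open>u\<close> and the three vectors \<open>e \<times> u\<close>,
  \<open>e = a, b, c\<close>, and \<open>u \<times> (e \<times> u) = e\<close> lies in the plane.\<close>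

lemma cayley_form_13:
  assumes es: "orthonormal_list 4 es" "\<bar>cayley_form es\<bar> = 1" and w: "w \<in> set es"
    and u: "\<And>e. e \<in> set es \<Longrightarrow> e \<bullet> u = 0" and v: "\<And>e. e \<in> set es \<Longrightarrow> e \<bullet> v = 0"
    and s: "\<And>e. e \<in> set es \<Longrightarrow> e \<bullet> s = 0"
  shows "cayley_form [w, u, v, s] = 0"
proof -
  have unit: "cayley_form [w, u, v, s] = 0"
    if uu: "u \<bullet> u = 1" and u: "\<And>e. e \<in> set es \<Longrightarrow> e \<bullet> u = 0" for u
  proof -
    obtain a b c where m: "mset es = mset [w, a, b, c]"
      using orthonormal_list_4_cases[OF es(1) w] by blast
    have set: "set es = {w, a, b, c}" using mset_eq_setD[OF m] by simp
    have on: "orthonormal_list 4 [w, a, b, c]" by (rule cayley_form_perm[OF es m])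
    have ww: "w \<bullet> w = 1" "a \<bullet> a = 1" "b \<bullet> b = 1" "c \<bullet> c = 1" "w \<bullet> a = 0" "w \<bullet> b = 0" "w \<bullet> c = 0"
      "a \<bullet> b = 0" "a \<bullet> c = 0" "b \<bullet> c = 0"
      using on by (auto simp: orthonormal_list_Cons)
    define X where "X e = triple w e u" for e
    have Xnorm: "X e \<bullet> X e = e \<bullet> e" if "w \<bullet> e = 0" "e \<bullet> u = 0" for e
      unfolding X_def using triple_norm[of w e u] that ww u uu w by simp
    have Xadd: "X (e + f) = X e + X f" for e f
    proof -
      have "cayley_form [w, e + f, u, k] = cayley_form [w, e, u, k] + cayley_form [w, f, u, k]" for k
        using linear_add[OF alternating_linear[OF alternating_cayley_form, of "[w]" "[u, k]"]] by simp
      then show ?thesis by (simp add: X_def triple_def vec_eq_iff)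
    qed
    \<comment> \<open>Polarization of \<open>Xnorm\<close> at \<open>e + f\<close>.\<close>
    have Xorth: "X e \<bullet> X f = 0" if "e \<in> {a, b, c}" "f \<in> {a, b, c}" "e \<noteq> f" for e f
    proof -
      have 0: "w \<bullet> e = 0" "w \<bullet> f = 0"
        using that ww by auto
      have 1: "e \<bullet> u = 0" "f \<bullet> u = 0"
        using that u set by auto
      have 2: "e \<bullet> f = 0" "f \<bullet> e = 0"
        using that orthonormal_list_inner[OF es(1), of e f] by (auto simp: set inner_commute[of f e])
      have "X (e + f) \<bullet> X (e + f) = (e + f) \<bullet> (e + f)"
        by (intro Xnorm) (simp_all add: inner_add_left inner_add_right 0 1)
      then have "X e \<bullet> X f + X f \<bullet> X e = 0"
        by (simp add: Xadd inner_add_left inner_add_right Xnorm[OF 0(1) 1(1)] Xnorm[OF 0(2) 1(2)] 2)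
      then show ?thesis by (simp add: inner_commute[of "X f" "X e"])
    qed
    have XW: "x \<bullet> X e = 0" if "x \<in> {w, a, b, c}" "e \<in> {a, b, c}" for x e
    proof -
      have "cayley_form [w, e, x, u] = 0"
        by (rule cayley_form_31[OF es]) (use that set u in auto)
      then show ?thesis
        using cayley_form_swap34[of w e x u] triple_inner[of w e u x] by (simp add: X_def inner_commute)
    qed
    have Xu: "u \<bullet> X e = 0" for e
      using triple_orthogonal(3)[of w e u] by (simp add: X_def inner_commute)
    \<comment> \<open>Eight orthonormal vectors, hence a basis in which \<open>v\<close> can be
      expanded.\<close>
    let ?L = "[w, a, b, c, u, X a, X b, X c]"
    have "orthonormal_list 8 ?L"
      using ww uu Xnorm[of a] Xnorm[of b] Xnorm[of c] Xorth[of a b] Xorth[of a c] Xorth[of b c] XW Xu u set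
        orthonormal_list_distinct[OF on]
      by (simp add: orthonormal_list_Cons)
    then have L: "orthonormal_list CARD(8) ?L" by simp
    have "v = proj ?L v" using proj_id[OF L] span_orthonormal_list_UNIV[OF L] by simp
    also have "cayley_form [w, u, proj ?L v, s] = (\<Sum>l\<in>set ?L. (l \<bullet> v) * cayley_form [w, u, l, s])"
    proof -
      have l: "linear (\<lambda>v. cayley_form [w, u, v, s])"
        using alternating_linear[OF alternating_cayley_form, of "[w, u]"] by simp
      show ?thesis
        unfolding proj_def by (simp only: linear_sum[OF l] linear_cmul[OF l] real_scaleR_def)
    qed
    also have "\<dots> = 0"
    proof (intro sum.neutral ballI)
      fix l assume "l \<in> set ?L"
      \<comment> \<open>A frame vector has coefficient zero because \<open>v\<close> is normal;
        \<open>u\<close> repeats an argument; for \<open>X e\<close> the cross product with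
        \<open>w\<close> and \<open>u\<close> returns \<open>e\<close>, which is orthogonal to
        \<open>s\<close>.\<close>
      then consider "l \<in> set es" | "l = u" | e where "e \<in> {a, b, c}" "l = X e"
        by (auto simp: set)
      then show "(l \<bullet> v) * cayley_form [w, u, l, s] = 0"
      proof cases
        case 3
        have "triple w u (X e) = - triple w u (triple w u e)"
        proof -
          have "triple w u (- x) = - triple w u x" for x
          proof -
            have "cayley_form [w, u, - x, k] = - cayley_form [w, u, x, k]" for k
              using linear_neg[OF alternating_linear[OF alternating_cayley_form, of "[w, u]" "[k]"]] by simp
            then show ?thesis by (simp add: triple_def vec_eq_iff)
          qed
          then show ?thesis by (simp add: X_def triple_swap[of w e u])
        qed
        also have "\<dots> = e"
        proof -
          have "e \<in> set es" "w \<bullet> e = 0" using 3(1) set ww by auto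
          then have "triple w u (triple w u e) = - e"
            using u[of e] by (intro triple_triple) (simp_all add: ww uu u w inner_commute[of u e])
          then show ?thesis by simp
        qed
        finally have "cayley_form [w, u, X e, s] = e \<bullet> s" by (metis triple_inner)
        then show ?thesis using 3 s set by auto
      qed (auto simp: v cayley_form_not_distinct)
    qed
    finally show ?thesis .
  qed
  show ?thesis
  proof (cases "u = 0")
    case True
    then show ?thesis
      using linear_0[OF alternating_linear[OF alternating_cayley_form, of "[w]" "[v, s]"]] by simp
  next
    case False
    have "cayley_form [w, u /\<^sub>R norm u, v, s] = 0"
      by (rule unit) (use False u in \<open>auto simp: dot_square_norm power2_eq_square\<close>)
    then show ?thesis
      using False linear_cmul[OF alternating_linear[OF alternating_cayley_form, of "[w]" "[v, s]"]] by simp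
  qed
qed

lemma cayley_form_reflection:
  assumes es: "orthonormal_list 4 es" "\<bar>cayley_form es\<bar> = 1"
  shows "cayley_form (map (reflection es) vs) = cayley_form vs"
proof -
  \<comment> \<open>By multilinearity it suffices to test lists whose entries are frame vectors or
    normals; the vanishing lemmas apply to such entries directly.\<close>
  define B where "B = set es \<union> {u. \<forall>e\<in>set es. e \<bullet> u = 0}"
  have "x \<in> span B" for x
  proof -
    have "proj es x \<in> span B"
      using proj_in_span span_mono[of "set es" B] by (auto simp: B_def)
    moreover have "x - proj es x \<in> span B"
      using inner_proj[OF es(1)] by (intro span_base) (simp add: B_def inner_diff_right)
    ultimately show ?thesis using span_add[of "proj es x" B "x - proj es x"] by simp
  qed
  then have span: "set vs \<subseteq> span B" by auto
  have "cayley_form (map (reflection es) vs) - cayley_form vs = 0"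
  proof (rule alternating_eq_0_span[OF _ _ span, where k = 4])
    show "alternating 4 (\<lambda>vs. cayley_form (map (reflection es) vs) - cayley_form vs)"
      by (intro alternating_diff alternating_map alternating_cayley_form linear_reflection)
    fix vs assume B: "set vs \<subseteq> B"
    show "cayley_form (map (reflection es) vs) - cayley_form vs = 0"
    proof (cases "length vs = 4")
      case False
      then show ?thesis by (simp add: alternating_length[OF alternating_cayley_form])
    next
      case True
      then obtain x y z w where vs: "vs = [x, y, z, w]"
        by (auto simp: numeral_eq_Suc length_Suc_conv)
      define P where "P v \<longleftrightarrow> v \<in> set es" for v
      define Q where "Q v \<longleftrightarrow> (\<forall>e\<in>set es. e \<bullet> v = 0)" for v
      have R: "P v \<Longrightarrow> reflection es v = v" "Q v \<Longrightarrow> reflection es v = - v" for v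
        using reflection_id[OF es(1)] reflection_neg[of es v] by (auto simp: P_def Q_def span_base)
      have n1: "cayley_form [- a, b, c, d] = - cayley_form [a, b, c, d]" for a b c d
        using linear_neg[OF alternating_linear[OF alternating_cayley_form, of "[]" "[b, c, d]"]] by simp
      have n2: "cayley_form [a, - b, c, d] = - cayley_form [a, b, c, d]" for a b c d
        using linear_neg[OF alternating_linear[OF alternating_cayley_form, of "[a]" "[c, d]"]] by simp
      have n3: "cayley_form [a, b, - c, d] = - cayley_form [a, b, c, d]" for a b c d
        using linear_neg[OF alternating_linear[OF alternating_cayley_form, of "[a, b]" "[d]"]] by simp
      have n4: "cayley_form [a, b, c, - d] = - cayley_form [a, b, c, d]" for a b c d
        using linear_neg[OF alternating_linear[OF alternating_cayley_form, of "[a, b, c]" "[]"]] by simp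
      have p1: "cayley_form [a, b, c, d] = 0" if "P a" "P b" "P c" "Q d" for a b c d
        using cayley_form_31[OF es] that by (auto simp: P_def Q_def)
      have p2: "cayley_form [a, b, d, c] = 0" if "P a" "P b" "P c" "Q d" for a b c d
        using p1[OF that] cayley_form_swap34[of a b c d] by simp
      have p3: "cayley_form [a, d, b, c] = 0" if "P a" "P b" "P c" "Q d" for a b c d
        using p2[OF that] cayley_form_swap23[of a b d c] by simp
      have p4: "cayley_form [d, a, b, c] = 0" if "P a" "P b" "P c" "Q d" for a b c d
        using p3[OF that] cayley_form_swap12[of a d b c] by simp
      have q1: "cayley_form [a, b, c, d] = 0" if "P a" "Q b" "Q c" "Q d" for a b c d
        using cayley_form_13[OF es] that by (auto simp: P_def Q_def)
      have q2: "cayley_form [b, a, c, d] = 0" if "P a" "Q b" "Q c" "Q d" for a b c d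
        using q1[OF that] cayley_form_swap12[of a b c d] by simp
      have q3: "cayley_form [b, c, a, d] = 0" if "P a" "Q b" "Q c" "Q d" for a b c d
        using q2[OF that] cayley_form_swap23[of b a c d] by simp
      have q4: "cayley_form [b, c, d, a] = 0" if "P a" "Q b" "Q c" "Q d" for a b c d
        using q3[OF that] cayley_form_swap34[of b c a d] by simp
      have "P x \<or> Q x" "P y \<or> Q y" "P z \<or> Q z" "P w \<or> Q w"
        using B by (auto simp: vs B_def P_def Q_def)
      \<comment> \<open>Sixteen cases: with an even number of normal entries the signs cancel, with
        one or three the value vanishes by the \<open>p\<close> or \<open>q\<close> facts.\<close>
      then show ?thesis
        by (elim disjE) (simp_all add: vs R n1 n2 n3 n4 p1 p2 p3 p4 q1 q2 q3 q4)
    qed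
  qed
  then show ?thesis by simp
qed

lemma cayley_form_axis: "cayley_form [axis 0 1, axis 1 1, axis 2 1, axis 3 1] = 1"
  by (simp add: cayley_form_apply phi_form_apply psi_form_apply dx_2_wedge_apply dx_apply axis_def)

theorem compliant_cayley: "compliant 4 cayley_form Spin7_group"
  unfolding Spin7_group_def
proof (rule compliantI[OF alternating_cayley_form])
  show "cayley_form es \<le> 1" if "orthonormal_list 4 es" for es
    using cayley_form_le_1[OF that] by simp
  show "orthonormal_list 4 [axis 0 1, axis 1 1, axis 2 1, axis 3 1 :: real ^ 8]"
    by (simp add: orthonormal_list_Cons inner_axis_axis)
  show "\<forall>\<beta>\<in>{cayley_form}. \<exists>k. alternating k \<beta>" using alternating_cayley_form by blast
qed (use cayley_form_axis cayley_form_reflection in auto)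

section \<open>Associative and coassociative planes as Cayley planes\<close>

definition emb :: "real ^ 7 \<Rightarrow> real ^ 8" where
  "emb x = vec8 0 (x $ 1) (x $ 2) (x $ 3) (x $ 4) (x $ 5) (x $ 6) (x $ 7)"

lemma linear_emb: "linear emb"
  by (rule linearI) (simp_all add: vec_eq_iff forall_8 emb_def)

lemma emb_inner [simp]: "emb x \<bullet> emb y = x \<bullet> y"
  by (simp add: inner_7 inner_8 emb_def)

lemma axis_inner_emb [simp]: "axis 0 1 \<bullet> emb x = 0"
  by (simp add: inner_axis' emb_def)

lemma inj_emb: "inj emb"
proof (rule injI)
  fix x y assume "emb x = emb y"
  then have "emb (x - y) = 0" by (simp add: linear_diff[OF linear_emb])
  then have "(x - y) \<bullet> (x - y) = 0" by (metis emb_inner inner_zero_left)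
  then show "x = y" by simp
qed

lemma phi_form_emb: "phi_form [x, y, z] = cayley_form [axis 0 1, emb x, emb y, emb z]"
  by (simp add: cayley_form_apply phi_form_apply psi_form_apply dx_2_wedge_apply dx_apply axis_def emb_def)

lemma psi_form_emb: "psi_form [x, y, z, w] = cayley_form [emb x, emb y, emb z, emb w]"
  by (simp add: cayley_form_apply phi_form_apply psi_form_apply dx_2_wedge_apply dx_apply emb_def)

lemma orthonormal_list_emb: "orthonormal_list k es \<Longrightarrow> orthonormal_list k (map emb es)"
  by (simp add: orthonormal_list_def)

lemma proj_emb: "proj (map emb es) (emb x) = emb (proj es x)"
  by (simp add: proj_def sum.reindex[OF inj_on_subset[OF inj_emb]] linear_sum[OF linear_emb] linear_cmul[OF linear_emb])

lemma reflection_emb: "reflection (map emb es) (emb x) = emb (reflection es x)"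
  by (simp add: reflection_def proj_emb linear_diff[OF linear_emb] linear_cmul[OF linear_emb])

lemma proj_Cons: "e \<notin> set es \<Longrightarrow> proj (e # es) x = (e \<bullet> x) *\<^sub>R e + proj es x"
  by (simp add: proj_def)

lemma axis_notin_emb: "axis 0 1 \<notin> emb ` A"
proof
  assume "axis 0 1 \<in> emb ` A"
  then obtain x where "axis 0 1 = emb x" by auto
  then have "(axis 0 1 :: real ^ 8) $ 0 = emb x $ 0" by (simp only:)
  then show False by (simp add: emb_def axis_def)
qed

text \<open>The added axis is orthogonal to the embedded space, so adjoining it to the plane does
  not change the projection of embedded vectors.\<close>

lemma reflection_axis_emb: "reflection (axis 0 1 # map emb es) (emb x) = emb (reflection es x)"
  unfolding reflection_emb[symmetric] using proj_Cons[of "axis 0 1" "map emb es" "emb x"]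
  by (simp add: reflection_def axis_notin_emb)

lemma phi_form_extend:
  assumes "orthonormal_list 3 es"
  shows "orthonormal_list 4 (axis 0 1 # map emb es)" "phi_form es = cayley_form (axis 0 1 # map emb es)"
proof -
  obtain a b c where es: "es = [a, b, c]"
    using assms by (auto simp: orthonormal_list_def numeral_eq_Suc length_Suc_conv)
  show "phi_form es = cayley_form (axis 0 1 # map emb es)" by (simp add: es phi_form_emb)
  show "orthonormal_list 4 (axis 0 1 # map emb es)"
    using assms by (simp add: es orthonormal_list_Cons inner_axis_axis)
qed

lemma psi_form_extend:
  assumes "orthonormal_list 4 es"
  shows "psi_form es = cayley_form (map emb es)"
proof -
  obtain a b c d where "es = [a, b, c, d]"
    using assms by (auto simp: orthonormal_list_def numeral_eq_Suc length_Suc_conv)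
  then show ?thesis by (simp add: psi_form_emb)
qed

lemma phi_form_eqI:
  assumes "\<And>x y z. phi_form (map f [x, y, z]) = c * phi_form [x, y, z]"
  shows "phi_form (map f vs) = c * (phi_form vs :: real)"
proof (cases "length vs = 3")
  case True
  then obtain x y z where "vs = [x, y, z]" by (auto simp: numeral_eq_Suc length_Suc_conv)
  then show ?thesis using assms by simp
next
  case False
  then show ?thesis by (simp add: alternating_length[OF alternating_phi_form])
qed

theorem compliant_associative: "compliant 3 (phi_form :: (7, real) form) G2_group"
  unfolding G2_group_def
proof (rule compliantI[OF alternating_phi_form])
  show "phi_form es \<le> 1" if "orthonormal_list 3 es" for es :: "(real ^ 7) list"
    using cayley_form_le_1[OF phi_form_extend(1)[OF that]] phi_form_extend(2)[OF that] by simp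
  show "orthonormal_list 3 [axis 1 1, axis 2 1, axis 3 1 :: real ^ 7]"
    by (simp add: orthonormal_list_Cons inner_axis_axis)
  show "phi_form [axis 1 1, axis 2 1, axis 3 1 :: real ^ 7] = 1"
    by (simp add: phi_form_apply dx_apply axis_def)
  show "\<forall>\<beta>\<in>{phi_form :: (7, real) form}. \<exists>k. alternating k \<beta>" using alternating_phi_form by blast
  fix es :: "(real ^ 7) list" and \<beta> :: "(7, real) form"
  assume es: "orthonormal_list 3 es" "phi_form es = 1" and \<beta>: "\<beta> \<in> {phi_form}"
  let ?fs = "axis 0 1 # map emb es"
  note fs = phi_form_extend[OF es(1)]
  \<comment> \<open>The extra axis lies in the Cayley plane and is fixed, so contracting the
    invariant Cayley form with it leaves \<phi> invariant.\<close>
  have "axis 0 1 \<in> span (set ?fs)" by (intro span_base) simp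
  then have "reflection ?fs (axis 0 1) = axis 0 1" by (rule reflection_id[OF fs(1)])
  then have "phi_form (map (reflection es) [x, y, z]) = 1 * phi_form [x, y, z]" for x y z
    using cayley_form_reflection[OF fs(1), of "[axis 0 1, emb x, emb y, emb z]"] fs(2) es(2)
    by (simp add: phi_form_emb reflection_axis_emb)
  from phi_form_eqI[of "reflection es", OF this] \<beta>
  show "(\<forall>vs. \<beta> (map (reflection es) vs) = \<beta> vs) \<or> (\<forall>vs. \<beta> (map (reflection es) vs) = - \<beta> vs)"
    by simp
qed

theorem compliant_coassociative: "compliant 4 (psi_form :: (7, real) form) G2_group"
  unfolding G2_group_def
proof (rule compliantI[OF alternating_psi_form])
  show "psi_form es \<le> 1" if "orthonormal_list 4 es" for es :: "(real ^ 7) list"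
    using cayley_form_le_1[OF orthonormal_list_emb[OF that]] psi_form_extend[OF that] by simp
  show "orthonormal_list 4 [axis 4 1, axis 5 1, axis 6 1, axis 7 1 :: real ^ 7]"
    by (simp add: orthonormal_list_Cons inner_axis_axis)
  show "psi_form [axis 4 1, axis 5 1, axis 6 1, axis 7 1 :: real ^ 7] = 1"
    by (simp add: psi_form_apply dx_2_wedge_apply dx_apply axis_def)
  show "\<forall>\<beta>\<in>{phi_form :: (7, real) form}. \<exists>k. alternating k \<beta>" using alternating_phi_form by blast
  fix es :: "(real ^ 7) list" and \<beta> :: "(7, real) form"
  assume es: "orthonormal_list 4 es" "psi_form es = 1" and \<beta>: "\<beta> \<in> {phi_form}"
  let ?fs = "map emb es"
  \<comment> \<open>Here the extra axis is normal to the Cayley plane and changes sign, so \<phi>,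
    the contraction with it, is negated.\<close>
  have "reflection ?fs (axis 0 1) = - axis 0 1"
    by (rule reflection_neg) (auto simp: inner_commute[of _ "axis 0 1"])
  moreover have "cayley_form [- a, b, c, d] = - cayley_form [a, b, c, d]" for a b c d
    using linear_neg[OF alternating_linear[OF alternating_cayley_form, of "[]" "[b, c, d]"]] by simp
  ultimately have "phi_form (map (reflection es) [x, y, z]) = (-1) * phi_form [x, y, z]" for x y z
    using cayley_form_reflection[OF orthonormal_list_emb[OF es(1)], of "[axis 0 1, emb x, emb y, emb z]"]
      psi_form_extend[OF es(1)] es(2)
    by (simp add: phi_form_emb reflection_emb)
  from phi_form_eqI[of "reflection es", OF this] \<beta>
  show "(\<forall>vs. \<beta> (map (reflection es) vs) = \<beta> vs) \<or> (\<forall>vs. \<beta> (map (reflection es) vs) = - \<beta> vs)"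
    by simp
qed

theorem mainTheorem5:
  shows "(\<forall>p. 1 \<le> p \<and> p \<le> CARD('m::{finite,linorder}) \<longrightarrow>
            compliant (2 * p) (kaehler_calibration p :: ('m + 'm, real) form) U_group)
       \<and> compliant CARD('m) (Re_form (Upsilon :: ('m + 'm, complex) form)) SU_group
       \<and> compliant 3 (phi_form :: (7, real) form) G2_group
       \<and> compliant 4 (psi_form :: (7, real) form) G2_group
       \<and> compliant 4 cayley_form Spin7_group"
proof (intro conjI allI impI)
  fix p :: nat
  assume "1 \<le> p \<and> p \<le> CARD('m)"
  then show "compliant (2 * p) (kaehler_calibration p :: ('m + 'm, real) form) U_group"
    by (intro compliant_kaehler) simp
qed (rule compliant_special_Lagrangian compliant_associative compliant_coassociative compliant_cayley)+

end
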